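(* Let $\mathbf A$ be a finite algebra from a congruence modular variety with $\mathrm{typ}\{\mathbf A\}\subseteq\{2,4\}$, and suppose there is a congruence $\beta\in\mathrm{Con}(\mathbf A)$ such that $\mathrm{typ}\{\mathbf A/\beta\}=\{4\}$, every prime quotient $\gamma\prec\delta$ with $\delta\le\beta$ has type 2, and $\mathbf A/\beta$ is a subdirect product of totally ordered algebras. Then $\mathrm{nuP}_{\mathbf A}\subseteq\mathsf{nuItDet}\circ\mathrm{MONOTONE}$, and in particular $\mathrm{nuP}_{\mathbf A}\subseteq\mathsf{NC}^2\circ\mathrm{MONOTONE}$.
   Context: A finite algebra has finite universe and finitely many basic operations. An $n$-ary circuit over $\mathbf A$ is a DAG with one output node, sources labelled by variables or constants from $A$, gates labelled by basic operations; size is nodes plus edges. A NuDFA over $\mathbf A$ is $(\{t_n\}_{n\ge1},\iota,S)$ with $t_n$ an $n$-ary circuit, $\iota:\{0,1\}\to A$, $S\subseteq A$, accepting $b\in\{0,1\}^n$ iff $t_n(\iota(b_1),\dots,\iota(b_n))\in S$; polynomial size means size of $t_n$ polynomial in $n$; $\mathrm{nuP}_{\mathbf A}$ is the class of languages over $\{0,1\}$ accepted by polynomial-size NuDFAs over $\mathbf A$. $\mathrm{typ}\{\mathbf A\}$ is the set of tame congruence theory types of prime quotients of $\mathbf A$. An algebra is totally ordered if some total order on its universe is preserved by all its operations. An ABP over $\mathrm{GF}(p)$ is a directed acyclic multigraph with one source and one sink, edges labelled by variables or constants of $\mathrm{GF}(p)$, computing the sum over source–sink paths of the products of labels; size is vertices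 plus edges. A $\mathrm{BABP}_p$ gate is labelled by an ABP over $\mathrm{GF}(p)$ and $T\subseteq\mathrm{GF}(p)$ and outputs 1 on Boolean inputs iff the polynomial value lies in $T$; its size is the ABP's size. $\mathsf{nuItDet}\circ\mathrm{MONOTONE}$ is the class of languages $L$ for which there are primes $p_1,\dots,p_h$ such that for each $n$, $L\cap\{0,1\}^n$ is recognized by a layered circuit with a single top $\mathrm{BABP}_{p_1}$ gate, layer $i$ consisting of $\mathrm{BABP}_{p_i}$ gates fed by layer $i+1$, and the bottom layer of $\mathrm{BABP}_{p_h}$ gates fed by monotone circuits (fan-in-2 $\wedge,\vee$ gates only) on the input bits, of total size polynomial in $n$. $\mathsf{NC}^2\circ\mathrm{MONOTONE}$ is defined analogously with a nonuniform $\mathsf{NC}^2$ circuit (polynomial size, depth $O(\log^2 n)$, fan-in-2 $\wedge,\vee$ and $\neg$) on top of polynomial-size monotone circuits. *)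

theory Defs
  imports Complex_Main "HOL-Computational_Algebra.Primes"
begin

text \<open>An algebra is a carrier set together with a finite list of basic operations,
  each given by its arity and a function on argument lists.\<close>

type_synonym 'a alg = "'a set \<times> (nat \<times> ('a list \<Rightarrow> 'a)) list"

definition car :: "'a alg \<Rightarrow> 'a set" where "car A = fst A"
definition ops :: "'a alg \<Rightarrow> (nat \<times> ('a list \<Rightarrow> 'a)) list" where "ops A = snd A"

definition finite_alg :: "'a alg \<Rightarrow> bool" where
  "finite_alg A \<longleftrightarrow> finite (car A) \<and> car A \<noteq> {} \<and>
     (\<forall>(k, f) \<in> set (ops A). \<forall>xs. length xs = k \<and> set xs \<subseteq> car A \<longrightarrow> f xs \<in> car A)"

definition is_cong :: "'a alg \<Rightarrow> ('a \<times> 'a) set \<Rightarrow> bool" where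
  "is_cong A \<theta> \<longleftrightarrow> equiv (car A) \<theta> \<and>
     (\<forall>(k, f) \<in> set (ops A). \<forall>xs ys. length xs = k \<and> length ys = k \<and>
        set xs \<subseteq> car A \<and> set ys \<subseteq> car A \<and> list_all2 (\<lambda>x y. (x, y) \<in> \<theta>) xs ys
        \<longrightarrow> (f xs, f ys) \<in> \<theta>)"

definition Con :: "'a alg \<Rightarrow> ('a \<times> 'a) set set" where
  "Con A = {\<theta>. is_cong A \<theta>}"

definition prime_quot :: "'a alg \<Rightarrow> ('a \<times> 'a) set \<Rightarrow> ('a \<times> 'a) set \<Rightarrow> bool" where
  "prime_quot A \<alpha> \<beta> \<longleftrightarrow> \<alpha> \<in> Con A \<and> \<beta> \<in> Con A \<and> \<alpha> \<subset> \<beta> \<and>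
     \<not> (\<exists>\<gamma> \<in> Con A. \<alpha> \<subset> \<gamma> \<and> \<gamma> \<subset> \<beta>)"

definition quot :: "'a alg \<Rightarrow> ('a \<times> 'a) set \<Rightarrow> 'a set alg" where
  "quot A \<theta> = (car A // \<theta>,
     map (\<lambda>(k, f). (k, \<lambda>Xs. \<theta> `` {f (map (\<lambda>X. SOME x. x \<in> X) Xs)})) (ops A))"

definition cjoin :: "'a alg \<Rightarrow> ('a \<times> 'a) set \<Rightarrow> ('a \<times> 'a) set \<Rightarrow> ('a \<times> 'a) set" where
  "cjoin A x y = \<Inter> {\<theta> \<in> Con A. x \<union> y \<subseteq> \<theta>}"

definition con_modular :: "'a alg \<Rightarrow> bool" where
  "con_modular A \<longleftrightarrow> (\<forall>x \<in> Con A. \<forall>y \<in> Con A. \<forall>z \<in> Con A.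
      x \<subseteq> z \<longrightarrow> cjoin A x (y \<inter> z) = cjoin A x y \<inter> z)"

definition pow_alg :: "'a alg \<Rightarrow> nat \<Rightarrow> 'a list alg" where
  "pow_alg A n = ({xs. length xs = n \<and> set xs \<subseteq> car A},
     map (\<lambda>(k, f). (k, \<lambda>xss. map (\<lambda>i. f (map (\<lambda>xs. xs ! i) xss)) [0..<n])) (ops A))"

definition subuniverse :: "'a alg \<Rightarrow> 'a set \<Rightarrow> bool" where
  "subuniverse A B \<longleftrightarrow> B \<subseteq> car A \<and>
     (\<forall>(k, f) \<in> set (ops A). \<forall>xs. length xs = k \<and> set xs \<subseteq> B \<longrightarrow> f xs \<in> B)"

definition cm_variety :: "'a alg \<Rightarrow> bool" where
  "cm_variety A \<longleftrightarrow> (\<forall>n B. subuniverse (pow_alg A n) B \<longrightarrow> con_modular (B, ops (pow_alg A n)))"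

datatype 'a tm = V nat | K 'a | Ap nat "'a tm list"

fun tm_eval :: "(nat \<times> ('a list \<Rightarrow> 'a)) list \<Rightarrow> 'a list \<Rightarrow> 'a tm \<Rightarrow> 'a" where
  "tm_eval os xs (V i) = xs ! i"
| "tm_eval os xs (K a) = a"
| "tm_eval os xs (Ap j ts) = snd (os ! j) (map (tm_eval os xs) ts)"

fun tm_wf :: "'a alg \<Rightarrow> nat \<Rightarrow> 'a tm \<Rightarrow> bool" where
  "tm_wf A n (V i) = (i < n)"
| "tm_wf A n (K a) = (a \<in> car A)"
| "tm_wf A n (Ap j ts) = (j < length (ops A) \<and> length ts = fst (ops A ! j) \<and>
                          (\<forall>t \<in> set ts. tm_wf A n t))"

definition pol_unary :: "'a alg \<Rightarrow> ('a \<Rightarrow> 'a) \<Rightarrow> bool" where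
  "pol_unary A f \<longleftrightarrow> (\<exists>t. tm_wf A 1 t \<and> (\<forall>x \<in> car A. f x = tm_eval (ops A) [x] t))"

definition nbhds :: "'a alg \<Rightarrow> ('a \<times> 'a) set \<Rightarrow> ('a \<times> 'a) set \<Rightarrow> 'a set set" where
  "nbhds A \<alpha> \<beta> = {f ` car A | f. pol_unary A f \<and> (\<exists>(x, y) \<in> \<beta>. (f x, f y) \<notin> \<alpha>)}"

definition min_set :: "'a alg \<Rightarrow> ('a \<times> 'a) set \<Rightarrow> ('a \<times> 'a) set \<Rightarrow> 'a set \<Rightarrow> bool" where
  "min_set A \<alpha> \<beta> U \<longleftrightarrow> U \<in> nbhds A \<alpha> \<beta> \<and> (\<forall>W \<in> nbhds A \<alpha> \<beta>. W \<subseteq> U \<longrightarrow> W = U)"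

definition is_trace :: "'a alg \<Rightarrow> ('a \<times> 'a) set \<Rightarrow> ('a \<times> 'a) set \<Rightarrow> 'a set \<Rightarrow> bool" where
  "is_trace A \<alpha> \<beta> N \<longleftrightarrow> (\<exists>U b. min_set A \<alpha> \<beta> U \<and> b \<in> U \<and> N = U \<inter> \<beta> `` {b} \<and>
      \<not> (N \<times> N \<subseteq> \<alpha>))"

text \<open>The \<open>n\<close>-ary polynomial operations of the minimal algebra \<open>A|_N / \<alpha>|_N\<close>
  (a function \<open>g\<close> on lists of \<open>\<alpha>|_N\<close>-classes, considered on \<open>(N/\<alpha>)^n\<close> only).\<close>
definition ind_pol :: "'a alg \<Rightarrow> ('a \<times> 'a) set \<Rightarrow> 'a set \<Rightarrow> nat \<Rightarrow> ('a set list \<Rightarrow> 'a set) \<Rightarrow> bool" where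
  "ind_pol A \<alpha> N n g \<longleftrightarrow> (\<exists>t. tm_wf A n t \<and>
     (\<forall>xs. length xs = n \<and> set xs \<subseteq> N \<longrightarrow> tm_eval (ops A) xs t \<in> N) \<and>
     (\<forall>xs. length xs = n \<and> set xs \<subseteq> N \<longrightarrow>
        g (map (\<lambda>x. (\<alpha> \<inter> N \<times> N) `` {x}) xs) = (\<alpha> \<inter> N \<times> N) `` {tm_eval (ops A) xs t}))"

definition cube :: "'b set \<Rightarrow> nat \<Rightarrow> 'b list set" where
  "cube M n = {Xs. length Xs = n \<and> set Xs \<subseteq> M}"

text \<open>Type 4: the induced minimal algebra is polynomially equivalent to the 2-element
  lattice, i.e. its polynomial clone is the clone of all monotone operations on a
  2-element chain.\<close>
definition type4_min :: "'a alg \<Rightarrow> ('a \<times> 'a) set \<Rightarrow> 'a set \<Rightarrow> bool" where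
  "type4_min A \<alpha> N \<longleftrightarrow> (let M = N // (\<alpha> \<inter> N \<times> N) in
     \<exists>a b. M = {a, b} \<and> a \<noteq> b \<and>
       (let le = (\<lambda>X Y. X = Y \<or> (X = a \<and> Y = b)) in
        \<forall>n g. ind_pol A \<alpha> N n g \<longleftrightarrow>
          ((\<forall>Xs \<in> cube M n. g Xs \<in> M) \<and>
           (\<forall>Xs \<in> cube M n. \<forall>Ys \<in> cube M n. list_all2 le Xs Ys \<longrightarrow> le (g Xs) (g Ys)))))"

text \<open>Type 2: the induced minimal algebra is polynomially equivalent to a vector space
  over a (finite) field: an abelian group \<open>(M,+,0,-)\<close> and a set \<open>R\<close> of additive
  endomorphisms forming a division ring (the scalar action of the field), such that the
  polynomial operations are exactly the affine maps \<open>\<Sum> r_i x_i + c\<close>.\<close>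
definition type2_min :: "'a alg \<Rightarrow> ('a \<times> 'a) set \<Rightarrow> 'a set \<Rightarrow> bool" where
  "type2_min A \<alpha> N \<longleftrightarrow> (let M = N // (\<alpha> \<inter> N \<times> N) in
     \<exists>plus zero neg R.
       zero \<in> M \<and>
       (\<forall>x \<in> M. \<forall>y \<in> M. plus x y \<in> M) \<and> (\<forall>x \<in> M. neg x \<in> M) \<and>
       (\<forall>x \<in> M. \<forall>y \<in> M. \<forall>z \<in> M. plus (plus x y) z = plus x (plus y z)) \<and>
       (\<forall>x \<in> M. \<forall>y \<in> M. plus x y = plus y x) \<and>
       (\<forall>x \<in> M. plus zero x = x) \<and> (\<forall>x \<in> M. plus (neg x) x = zero) \<and>
       (\<forall>r \<in> R. (\<forall>x \<in> M. r x \<in> M) \<and> (\<forall>x \<in> M. \<forall>y \<in> M. r (plus x y) = plus (r x) (r y))) \<and>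
       (\<exists>r \<in> R. \<forall>x \<in> M. r x = x) \<and> (\<exists>r \<in> R. \<forall>x \<in> M. r x = zero) \<and>
       (\<forall>r \<in> R. \<forall>s \<in> R. (\<exists>u \<in> R. \<forall>x \<in> M. u x = plus (r x) (s x)) \<and>
                           (\<exists>u \<in> R. \<forall>x \<in> M. u x = r (s x))) \<and>
       (\<forall>r \<in> R. \<exists>u \<in> R. \<forall>x \<in> M. u x = neg (r x)) \<and>
       (\<forall>r \<in> R. (\<exists>x \<in> M. r x \<noteq> zero) \<longrightarrow> inj_on r M) \<and>
       (\<forall>n g. ind_pol A \<alpha> N n g \<longleftrightarrow>
          (\<exists>rs c. length rs = n \<and> set rs \<subseteq> R \<and> c \<in> M \<and>
             (\<forall>Xs \<in> cube M n. g Xs = foldr plus (map2 (\<lambda>r X. r X) rs Xs) c))))"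

text \<open>The type of a prime quotient is the type of (any of) its traces.\<close>
definition has_type2 :: "'a alg \<Rightarrow> ('a \<times> 'a) set \<Rightarrow> ('a \<times> 'a) set \<Rightarrow> bool" where
  "has_type2 A \<alpha> \<beta> \<longleftrightarrow> (\<exists>N. is_trace A \<alpha> \<beta> N \<and> type2_min A \<alpha> N)"

definition has_type4 :: "'a alg \<Rightarrow> ('a \<times> 'a) set \<Rightarrow> ('a \<times> 'a) set \<Rightarrow> bool" where
  "has_type4 A \<alpha> \<beta> \<longleftrightarrow> (\<exists>N. is_trace A \<alpha> \<beta> N \<and> type4_min A \<alpha> N)"

definition tot_ordered :: "'a alg \<Rightarrow> bool" where
  "tot_ordered A \<longleftrightarrow> (\<exists>le. le \<subseteq> car A \<times> car A \<and> linear_order_on (car A) le \<and>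
     (\<forall>(k, f) \<in> set (ops A). \<forall>xs ys. length xs = k \<and> length ys = k \<and>
        set xs \<subseteq> car A \<and> set ys \<subseteq> car A \<and> list_all2 (\<lambda>x y. (x, y) \<in> le) xs ys
        \<longrightarrow> (f xs, f ys) \<in> le))"

text \<open>\<open>C\<close> is (isomorphic to) a subdirect product of totally ordered algebras: there is a
  family of congruences of \<open>C\<close> with trivial intersection whose quotients are totally
  ordered.\<close>
definition subdirect_tot :: "'a alg \<Rightarrow> bool" where
  "subdirect_tot C \<longleftrightarrow> (\<exists>\<Theta> \<subseteq> Con C. (\<forall>\<theta> \<in> \<Theta>. tot_ordered (quot C \<theta>)) \<and>
     {(x, y). x \<in> car C \<and> y \<in> car C \<and> (\<forall>\<theta> \<in> \<Theta>. (x, y) \<in> \<theta>)} = Id_on (car C))"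

datatype 'a agate = AIn nat | ACst 'a | AOp nat "nat list"

text \<open>A circuit is a list of gates in topological order; each gate only reads earlier
  gates; the output is the last gate.\<close>
definition acirc_wf :: "'a alg \<Rightarrow> nat \<Rightarrow> 'a agate list \<Rightarrow> bool" where
  "acirc_wf A n gs \<longleftrightarrow> gs \<noteq> [] \<and> (\<forall>j < length gs. case gs ! j of
       AIn i \<Rightarrow> i < n
     | ACst a \<Rightarrow> a \<in> car A
     | AOp k as \<Rightarrow> k < length (ops A) \<and> length as = fst (ops A ! k) \<and> (\<forall>a \<in> set as. a < j))"

fun agate_val :: "'a alg \<Rightarrow> 'a list \<Rightarrow> 'a list \<Rightarrow> 'a agate \<Rightarrow> 'a" where
  "agate_val A xs vs (AIn i) = xs ! i"
| "agate_val A xs vs (ACst a) = a"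
| "agate_val A xs vs (AOp k as) = snd (ops A ! k) (map (\<lambda>a. vs ! a) as)"

definition acirc_eval :: "'a alg \<Rightarrow> 'a list \<Rightarrow> 'a agate list \<Rightarrow> 'a" where
  "acirc_eval A xs gs = last (foldl (\<lambda>vs g. vs @ [agate_val A xs vs g]) [] gs)"

fun agate_fanin :: "'a agate \<Rightarrow> nat" where
  "agate_fanin (AOp k as) = length as"
| "agate_fanin _ = 0"

definition acirc_size :: "'a agate list \<Rightarrow> nat" where
  "acirc_size gs = length gs + sum_list (map agate_fanin gs)"

definition nuP :: "'a alg \<Rightarrow> bool list set set" where
  "nuP A = {L. \<exists>(\<iota> :: bool \<Rightarrow> 'a) S t c k. (\<forall>b. \<iota> b \<in> car A) \<and> S \<subseteq> car A \<and>
      (\<forall>n \<ge> 1. acirc_wf A n (t n) \<and> acirc_size (t n) \<le> c * n ^ k + c) \<and>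
      (\<forall>w. length w \<ge> 1 \<longrightarrow> (w \<in> L \<longleftrightarrow> acirc_eval A (map \<iota> w) (t (length w)) \<in> S))}"

datatype bgate = BIn nat | BAnd nat nat | BOr nat nat | BNot nat

definition bcirc_wf :: "bool \<Rightarrow> nat \<Rightarrow> bgate list \<Rightarrow> bool" where
  "bcirc_wf mon n gs \<longleftrightarrow> gs \<noteq> [] \<and> (\<forall>j < length gs. case gs ! j of
       BIn i \<Rightarrow> i < n
     | BAnd a b \<Rightarrow> a < j \<and> b < j
     | BOr a b \<Rightarrow> a < j \<and> b < j
     | BNot a \<Rightarrow> \<not> mon \<and> a < j)"

fun bgate_val :: "bool list \<Rightarrow> bool list \<Rightarrow> bgate \<Rightarrow> bool" where
  "bgate_val xs vs (BIn i) = xs ! i"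
| "bgate_val xs vs (BAnd a b) = (vs ! a \<and> vs ! b)"
| "bgate_val xs vs (BOr a b) = (vs ! a \<or> vs ! b)"
| "bgate_val xs vs (BNot a) = (\<not> vs ! a)"

definition bcirc_eval :: "bool list \<Rightarrow> bgate list \<Rightarrow> bool" where
  "bcirc_eval xs gs = last (foldl (\<lambda>vs g. vs @ [bgate_val xs vs g]) [] gs)"

fun bgate_depth :: "nat list \<Rightarrow> bgate \<Rightarrow> nat" where
  "bgate_depth ds (BIn i) = 0"
| "bgate_depth ds (BAnd a b) = Suc (max (ds ! a) (ds ! b))"
| "bgate_depth ds (BOr a b) = Suc (max (ds ! a) (ds ! b))"
| "bgate_depth ds (BNot a) = Suc (ds ! a)"

definition bcirc_depth :: "bgate list \<Rightarrow> nat" where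
  "bcirc_depth gs = last (foldl (\<lambda>ds g. ds @ [bgate_depth ds g]) [] gs)"

fun bgate_fanin :: "bgate \<Rightarrow> nat" where
  "bgate_fanin (BIn i) = 0"
| "bgate_fanin (BAnd a b) = 2"
| "bgate_fanin (BOr a b) = 2"
| "bgate_fanin (BNot a) = 1"

definition bcirc_size :: "bgate list \<Rightarrow> nat" where
  "bcirc_size gs = length gs + sum_list (map bgate_fanin gs)"

datatype ablabel = LV nat | LC int

text \<open>A BABP gate: number of vertices \<open>m\<close> (vertices \<open>0..m-1\<close>, source \<open>0\<close>,
  sink \<open>m-1\<close>), a list of labelled edges \<open>(u, v, label)\<close> with \<open>u < v\<close> (acyclic),
  and the accepting set \<open>T \<subseteq> GF(p) = {0..p-1}\<close>.\<close>
type_synonym babp = "nat \<times> (nat \<times> nat \<times> ablabel) list \<times> int set"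

definition babp_wf :: "nat \<Rightarrow> nat \<Rightarrow> babp \<Rightarrow> bool" where
  "babp_wf p k G = (case G of (m, E, T) \<Rightarrow> m \<ge> 1 \<and> T \<subseteq> {0..<int p} \<and>
     (\<forall>(u, v, l) \<in> set E. u < v \<and> v < m \<and>
        (case l of LV i \<Rightarrow> i < k | LC c \<Rightarrow> 0 \<le> c \<and> c < int p)))"

fun walk :: "(nat \<times> nat \<times> ablabel) list \<Rightarrow> nat \<Rightarrow> nat list \<Rightarrow> nat \<Rightarrow> bool" where
  "walk E u [] v = (u = v)"
| "walk E u (e # es) v = (e < length E \<and> fst (E ! e) = u \<and> walk E (fst (snd (E ! e))) es v)"

fun label_val :: "bool list \<Rightarrow> ablabel \<Rightarrow> int" where
  "label_val xs (LV i) = of_bool (xs ! i)"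
| "label_val xs (LC c) = c"

text \<open>Value of the ABP: sum over all source-sink paths (lists of edge indices; a path in
  a DAG never uses more edges than there are) of the product of the labels, in GF(p).\<close>
definition abp_value :: "nat \<Rightarrow> babp \<Rightarrow> bool list \<Rightarrow> int" where
  "abp_value p G xs = (case G of (m, E, T) \<Rightarrow>
     (\<Sum>ps \<in> {ps. length ps \<le> length E \<and> walk E 0 ps (m - 1)}.
        \<Prod>e \<leftarrow> ps. label_val xs (snd (snd (E ! e)))) mod int p)"

definition babp_eval :: "nat \<Rightarrow> babp \<Rightarrow> bool list \<Rightarrow> bool" where
  "babp_eval p G xs = (case G of (m, E, T) \<Rightarrow> abp_value p G xs \<in> T)"

definition babp_size :: "babp \<Rightarrow> nat" where
  "babp_size G = (case G of (m, E, T) \<Rightarrow> m + length E)"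

text \<open>Layered circuit: layers \<open>Ls ! 0\<close> (top, a single gate), ..., \<open>Ls ! (h-1)\<close>
  (bottom); layer \<open>i\<close> consists of \<open>BABP_{p_i}\<close> gates reading the outputs of layer
  \<open>i+1\<close>, the bottom layer reads the outputs of the monotone circuits \<open>Ms\<close>.\<close>
definition itdet_wf :: "nat list \<Rightarrow> nat \<Rightarrow> babp list list \<Rightarrow> bgate list list \<Rightarrow> bool" where
  "itdet_wf ps n Ls Ms \<longleftrightarrow> length Ls = length ps \<and> length (hd Ls) = 1 \<and>
     (\<forall>M \<in> set Ms. bcirc_wf True n M) \<and>
     (\<forall>i < length Ls. \<forall>G \<in> set (Ls ! i).
        babp_wf (ps ! i) (if Suc i < length Ls then length (Ls ! Suc i) else length Ms) G)"

definition itdet_eval :: "nat list \<Rightarrow> babp list list \<Rightarrow> bgate list list \<Rightarrow> bool list \<Rightarrow> bool" where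
  "itdet_eval ps Ls Ms w = hd (foldr (\<lambda>(layer, p) inp. map (\<lambda>G. babp_eval p G inp) layer)
        (zip Ls ps) (map (bcirc_eval w) Ms))"

definition itdet_size :: "babp list list \<Rightarrow> bgate list list \<Rightarrow> nat" where
  "itdet_size Ls Ms = sum_list (map (\<lambda>layer. sum_list (map babp_size layer)) Ls) +
                      sum_list (map bcirc_size Ms)"

definition nuItDet_MON :: "bool list set set" where
  "nuItDet_MON = {L. \<exists>ps c k. ps \<noteq> [] \<and> (\<forall>p \<in> set ps. prime p) \<and>
     (\<forall>n \<ge> 1. \<exists>Ls Ms. itdet_wf ps n Ls Ms \<and> itdet_size Ls Ms \<le> c * n ^ k + c \<and>
        (\<forall>w. length w = n \<longrightarrow> (w \<in> L \<longleftrightarrow> itdet_eval ps Ls Ms w)))}"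

definition NC2_MON :: "bool list set set" where
  "NC2_MON = {L. \<exists>c k. \<forall>n \<ge> 1. \<exists>Ms top.
      (\<forall>M \<in> set Ms. bcirc_wf True n M) \<and> bcirc_wf False (length Ms) top \<and>
      bcirc_size top + sum_list (map bcirc_size Ms) \<le> c * n ^ k + c \<and>
      real (bcirc_depth top) \<le> real c * (log 2 (real n))\<^sup>2 + real c \<and>
      (\<forall>w. length w = n \<longrightarrow> (w \<in> L \<longleftrightarrow> bcirc_eval (map (\<lambda>M. bcirc_eval w M) Ms) top))}"

end

theory Submission
  imports Defs "HOL-Number_Theory.Residues" "HOL-Algebra.Multiplicative_Group"
begin

text \<open>
  Evaluate the circuit modulo smaller and smaller congruences. Modulo \<open>\<beta>\<close> the algebra is a
  subdirect product of chains, each of which may be oriented so that \<open>\<iota> 0 \<le> \<iota> 1\<close>; then every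
  threshold \<open>gate \<ge> a\<close> is a monotone Boolean function of the input, computed gate by gate.

  Below \<open>\<beta>\<close> one descends along prime quotients \<open>\<gamma> \<prec> \<delta>\<close> of type 2. Fix a trace \<open>N\<close>, so that
  \<open>N/\<gamma>\<close> is an elementary abelian \<open>p\<close>-group. As \<open>\<delta>\<close> is generated over \<open>\<gamma>\<close> by any pair outside
  \<open>\<gamma>\<close>, the elements of a \<open>\<delta>\<close>-class are separated modulo \<open>\<gamma>\<close> by the coordinates \<open>\<chi> \<circ> f\<close>, with \<open>f\<close> a
  unary polynomial mapping the class into \<open>N\<close> and \<open>\<chi>\<close> a character of \<open>N/\<gamma>\<close>, and for the same
  reason every basic operation, restricted to \<open>\<delta>\<close>-classes, is affine over \<open>GF(p)\<close> in these
  coordinates. Once the \<open>\<delta>\<close>-classes of all gates are known, the coordinates therefore satisfy a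
  linear recurrence along the circuit, which is a branching program over \<open>GF(p)\<close>; Fermat's
  theorem turns the coordinates into indicators of the \<open>\<gamma>\<close>-classes.

  Finally, a branching program is evaluated in \<open>NC\<^sup>2\<close> by repeated squaring of its adjacency
  matrix.
\<close>

section \<open>Extending Boolean circuits\<close>

text \<open>Unfolding a circuit into a formula may be exponential, so values must be shared: one
  branching program holds the coordinates of all gates. This succeeds because on each tuple of
  \<open>\<delta>\<close>-classes a coordinate of an operation is a constant plus coordinates of the
  arguments, while the tuple itself is read off from class indicators, which are Boolean inputs from
  the layer below. Hence two unknown values are never multiplied. The scalars of
  \<open>N/\<gamma>\<close> may form a field larger than \<open>GF(p)\<close>; additive characters
  avoid them, at the price of several coordinates per class. The number of layers is bounded by the
  length of a chain of congruences and does not depend on the input length. Exact classes modulo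
  \<open>\<beta>\<close> are not monotone in the input, so a first layer over \<open>GF(2)\<close>
  combines neighbouring thresholds into class indicators; a last one tests acceptance. Both Boolean
  circuits and branching programs are built by relative extension: given some functions, a stated
  amount of additional material provides further ones. Costs then add up without any naming of gates
  or vertices.\<close>

definition bvals :: "bool list \<Rightarrow> bgate list \<Rightarrow> bool list" where
  "bvals xs gs = foldl (\<lambda>vs g. vs @ [bgate_val xs vs g]) [] gs"

definition bdeps :: "bgate list \<Rightarrow> nat list" where
  "bdeps gs = foldl (\<lambda>ds g. ds @ [bgate_depth ds g]) [] gs"

lemma bvals_Nil [simp]: "bvals xs [] = []"
  by (simp add: bvals_def)

lemma bvals_snoc: "bvals xs (gs @ [g]) = bvals xs gs @ [bgate_val xs (bvals xs gs) g]"
  by (simp add: bvals_def)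

lemma bdeps_Nil [simp]: "bdeps [] = []"
  by (simp add: bdeps_def)

lemma bdeps_snoc: "bdeps (gs @ [g]) = bdeps gs @ [bgate_depth (bdeps gs) g]"
  by (simp add: bdeps_def)

lemma length_bvals [simp]: "length (bvals xs gs) = length gs"
  by (induction gs rule: rev_induct) (auto simp: bvals_snoc)

lemma length_bdeps [simp]: "length (bdeps gs) = length gs"
  by (induction gs rule: rev_induct) (auto simp: bdeps_snoc)

lemma bvals_append_nth: "j < length gs \<Longrightarrow> bvals xs (gs @ gs') ! j = bvals xs gs ! j"
proof (induction gs' rule: rev_induct)
  case (snoc g gs')
  then show ?case by (simp add: bvals_snoc nth_append flip: append_assoc)
qed simp

lemma bdeps_append_nth: "j < length gs \<Longrightarrow> bdeps (gs @ gs') ! j = bdeps gs ! j"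
proof (induction gs' rule: rev_induct)
  case (snoc g gs')
  then show ?case by (simp add: bdeps_snoc nth_append flip: append_assoc)
qed simp

text \<open>The output of a circuit is its last gate, so cutting the list after gate
  \<open>j\<close> makes that gate the output. One gate list can thus serve many functions.\<close>

lemma bcirc_eval_take:
  assumes "j < length gs"
  shows "bcirc_eval xs (take (Suc j) gs) = bvals xs gs ! j"
proof -
  have "bcirc_eval xs (take (Suc j) gs) = last (bvals xs (take (Suc j) gs))"
    by (simp add: bcirc_eval_def bvals_def)
  also have "\<dots> = bvals xs (take (Suc j) gs) ! j"
    using assms by (subst last_conv_nth) (auto simp flip: length_0_conv)
  also have "\<dots> = bvals xs gs ! j"
    using bvals_append_nth[of j "take (Suc j) gs" xs "drop (Suc j) gs"] assms by simp
  finally show ?thesis .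
qed

lemma bcirc_depth_take:
  assumes "j < length gs"
  shows "bcirc_depth (take (Suc j) gs) = bdeps gs ! j"
proof -
  have "bcirc_depth (take (Suc j) gs) = last (bdeps (take (Suc j) gs))"
    by (simp add: bcirc_depth_def bdeps_def)
  also have "\<dots> = bdeps (take (Suc j) gs) ! j"
    using assms by (subst last_conv_nth) (auto simp flip: length_0_conv)
  also have "\<dots> = bdeps gs ! j"
    using bdeps_append_nth[of j "take (Suc j) gs" "drop (Suc j) gs"] assms by simp
  finally show ?thesis .
qed

fun bgate_wf :: "bool \<Rightarrow> nat \<Rightarrow> nat \<Rightarrow> bgate \<Rightarrow> bool" where
  "bgate_wf mo n j (BIn i) = (i < n)"
| "bgate_wf mo n j (BAnd a b) = (a < j \<and> b < j)"
| "bgate_wf mo n j (BOr a b) = (a < j \<and> b < j)"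
| "bgate_wf mo n j (BNot a) = (\<not> mo \<and> a < j)"

definition bgates_wf :: "bool \<Rightarrow> nat \<Rightarrow> bgate list \<Rightarrow> bool" where
  "bgates_wf mo n gs \<longleftrightarrow> (\<forall>j < length gs. bgate_wf mo n j (gs ! j))"

lemma bcirc_wf_alt: "bcirc_wf mo n gs \<longleftrightarrow> gs \<noteq> [] \<and> bgates_wf mo n gs"
proof -
  have "(case g of BIn i \<Rightarrow> i < n | BAnd a b \<Rightarrow> a < j \<and> b < j | BOr a b \<Rightarrow> a < j \<and> b < j
     | BNot a \<Rightarrow> \<not> mo \<and> a < j) = bgate_wf mo n j g" for g j
    by (cases g) auto
  then show ?thesis by (simp add: bcirc_wf_def bgates_wf_def)
qed

lemma bgates_wf_snoc:
  "bgates_wf mo n (gs @ [g]) \<longleftrightarrow> bgates_wf mo n gs \<and> bgate_wf mo n (length gs) g"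
  unfolding bgates_wf_def by (auto simp: nth_append less_Suc_eq)

lemma bgates_wf_take: "bgates_wf mo n gs \<Longrightarrow> bgates_wf mo n (take j gs)"
  unfolding bgates_wf_def by auto

lemma bcirc_size_le: "bcirc_size gs \<le> 3 * length gs"
proof -
  have "bgate_fanin g \<le> 2" for g by (cases g) auto
  then have "sum_list (map bgate_fanin gs) \<le> 2 * length gs"
    using sum_list_mono[of gs bgate_fanin "\<lambda>_. 2"] by (simp add: sum_list_triv)
  then show ?thesis by (simp add: bcirc_size_def)
qed

text \<open>Monotone circuits have no constants, so constant functions count as provided by
  every circuit.\<close>
definition bprov :: "nat \<Rightarrow> bgate list \<Rightarrow> nat \<Rightarrow> (bool list \<Rightarrow> bool) \<Rightarrow> bool" where
  "bprov n gs d f \<longleftrightarrow> (\<exists>b. \<forall>xs. length xs = n \<longrightarrow> f xs = b) \<or>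
     (\<exists>j < length gs. bdeps gs ! j \<le> d \<and> (\<forall>xs. length xs = n \<longrightarrow> bvals xs gs ! j = f xs))"

text \<open>Quantifying over every list that already provides \<open>F\<close> makes costs
  compositional: the gates for \<open>F\<close> are shared, \<open>s\<close> counts new gates only,
  and \<open>d\<close> is depth above the level \<open>e\<close> at which \<open>F\<close> is
  available.\<close>

definition bext ::
  "bool \<Rightarrow> nat \<Rightarrow> nat \<Rightarrow> nat \<Rightarrow> (bool list \<Rightarrow> bool) set \<Rightarrow> (bool list \<Rightarrow> bool) set \<Rightarrow> bool" where
  "bext mo n s d F G \<longleftrightarrow> (\<forall>gs e. bgates_wf mo n gs \<and> (\<forall>f\<in>F. bprov n gs e f) \<longrightarrow>
     (\<exists>gs'. bgates_wf mo n (gs @ gs') \<and> length gs' \<le> s \<and> (\<forall>g\<in>G. bprov n (gs @ gs') (e + d) g)))"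

lemma bprov_append: "bprov n gs d f \<Longrightarrow> d \<le> d' \<Longrightarrow> bprov n (gs @ gs') d' f"
  unfolding bprov_def
proof (elim disjE exE conjE)
  fix j assume "j < length gs" "bdeps gs ! j \<le> d" "d \<le> d'"
    "\<forall>xs. length xs = n \<longrightarrow> bvals xs gs ! j = f xs"
  then show "(\<exists>b. \<forall>xs. length xs = n \<longrightarrow> f xs = b) \<or> (\<exists>j < length (gs @ gs').
     bdeps (gs @ gs') ! j \<le> d' \<and> (\<forall>xs. length xs = n \<longrightarrow> bvals xs (gs @ gs') ! j = f xs))"
    by (intro disjI2 exI[of _ j]) (auto simp: bvals_append_nth bdeps_append_nth)
qed blast

lemma bprov_mono: "bprov n gs d f \<Longrightarrow> d \<le> d' \<Longrightarrow> bprov n gs d' f"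
  using bprov_append[of n gs d f d' "[]"] by simp

lemma bprov_const: "bprov n gs d (\<lambda>xs. b)"
  unfolding bprov_def by blast

lemma bprov_cong:
  "bprov n gs d f \<Longrightarrow> (\<And>xs. length xs = n \<Longrightarrow> f xs = g xs) \<Longrightarrow> bprov n gs d g"
  unfolding bprov_def by auto

lemma bextI_subset: "G \<subseteq> F \<Longrightarrow> bext mo n s d F G"
  unfolding bext_def using bprov_mono[OF _ le_add1]
  by (metis append.right_neutral le0 list.size(3) subsetD)

lemma bext_const: "bext mo n s d F {\<lambda>xs. b}"
  unfolding bext_def by (auto intro!: exI[of _ "[]"] bprov_const)

lemma bext_cong:
  assumes "bext mo n s d F G"
    and "\<And>h. h \<in> H \<Longrightarrow> \<exists>g\<in>G. \<forall>xs. length xs = n \<longrightarrow> g xs = h xs"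
  shows "bext mo n s d F H"
  unfolding bext_def
proof (intro allI impI)
  fix gs e assume "bgates_wf mo n gs \<and> (\<forall>f\<in>F. bprov n gs e f)"
  then obtain gs' where 1: "bgates_wf mo n (gs @ gs')" "length gs' \<le> s"
    and 2: "\<forall>g\<in>G. bprov n (gs @ gs') (e + d) g"
    using assms(1) unfolding bext_def by meson
  have "\<forall>h\<in>H. bprov n (gs @ gs') (e + d) h"
    using assms(2) 2 bprov_cong by metis
  with 1 show "\<exists>gs'. bgates_wf mo n (gs @ gs') \<and> length gs' \<le> s \<and>
      (\<forall>g\<in>H. bprov n (gs @ gs') (e + d) g)" by blast
qed

lemma bext_mono:
  assumes "bext mo n s d F G" "s \<le> s'" "d \<le> d'" "F \<subseteq> F'" "G' \<subseteq> G"
  shows "bext mo n s' d' F' G'"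
  unfolding bext_def
proof (intro allI impI)
  fix gs e assume "bgates_wf mo n gs \<and> (\<forall>f\<in>F'. bprov n gs e f)"
  then obtain gs' where 1: "bgates_wf mo n (gs @ gs')" "length gs' \<le> s"
    and 2: "\<forall>g\<in>G. bprov n (gs @ gs') (e + d) g"
    using assms(1,4) unfolding bext_def by (meson subsetD)
  have "\<forall>g\<in>G'. bprov n (gs @ gs') (e + d') g"
    using 2 assms(3,5) by (meson bprov_mono nat_add_left_cancel_le subsetD)
  with 1 assms(2) show "\<exists>gs'. bgates_wf mo n (gs @ gs') \<and> length gs' \<le> s' \<and>
      (\<forall>g\<in>G'. bprov n (gs @ gs') (e + d') g)" using le_trans by blast
qed

lemma bext_trans:
  assumes "bext mo n s d F G" "bext mo n s' d' G H"
  shows "bext mo n (s + s') (d + d') F H"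
  unfolding bext_def
proof (intro allI impI)
  fix gs e assume "bgates_wf mo n gs \<and> (\<forall>f\<in>F. bprov n gs e f)"
  then obtain gs' where 1: "bgates_wf mo n (gs @ gs')" "length gs' \<le> s"
    and 2: "\<forall>g\<in>G. bprov n (gs @ gs') (e + d) g"
    using assms(1) unfolding bext_def by meson
  then obtain gs'' where 3: "bgates_wf mo n ((gs @ gs') @ gs'')" "length gs'' \<le> s'"
    and 4: "\<forall>g\<in>H. bprov n ((gs @ gs') @ gs'') (e + d + d') g"
    using assms(2) unfolding bext_def by meson
  show "\<exists>gs'. bgates_wf mo n (gs @ gs') \<and> length gs' \<le> s + s' \<and>
      (\<forall>g\<in>H. bprov n (gs @ gs') (e + (d + d')) g)"
    using 1 3 4 by (intro exI[of _ "gs' @ gs''"]) (auto simp: add.assoc)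
qed

text \<open>Parallel composition: all members start from the same level, so sizes add but depths do
  not. In \<open>bext_trans\<close> both add.\<close>

lemma bext_UN:
  assumes "finite I" "\<And>i. i \<in> I \<Longrightarrow> bext mo n s d F (G i)"
  shows "bext mo n (card I * s) d F (\<Union>i\<in>I. G i)"
  using assms
proof (induction I rule: finite_induct)
  case empty
  then show ?case by (simp add: bextI_subset)
next
  case (insert i I)
  show ?case
    unfolding bext_def
  proof (intro allI impI)
    fix gs e assume a: "bgates_wf mo n gs \<and> (\<forall>f\<in>F. bprov n gs e f)"
    have "bext mo n (card I * s) d F (\<Union>i\<in>I. G i)" using insert by auto
    then obtain gs' where 1: "bgates_wf mo n (gs @ gs')" "length gs' \<le> card I * s"
      and 2: "\<forall>g\<in>(\<Union>i\<in>I. G i). bprov n (gs @ gs') (e + d) g"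
      using a unfolding bext_def by meson
    have "\<forall>f\<in>F. bprov n (gs @ gs') e f" using a bprov_append by blast
    moreover have "bext mo n s d F (G i)" using insert by auto
    ultimately obtain gs'' where 3: "bgates_wf mo n ((gs @ gs') @ gs'')" "length gs'' \<le> s"
      and 4: "\<forall>g\<in>G i. bprov n ((gs @ gs') @ gs'') (e + d) g"
      using 1 unfolding bext_def by meson
    have "\<forall>g\<in>(\<Union>i\<in>insert i I. G i). bprov n ((gs @ gs') @ gs'') (e + d) g"
      using 2 4 bprov_append by blast
    then show "\<exists>gs'. bgates_wf mo n (gs @ gs') \<and> length gs' \<le> card (insert i I) * s \<and>
      (\<forall>g\<in>(\<Union>i\<in>insert i I. G i). bprov n (gs @ gs') (e + d) g)"
      using 1 3 insert(1,2) by (intro exI[of _ "gs' @ gs''"]) auto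
  qed
qed

lemma bext_Un:
  assumes "bext mo n s d F G" "bext mo n s' d F G'"
  shows "bext mo n (s + s') d F (G \<union> G')"
  unfolding bext_def
proof (intro allI impI)
  fix gs e assume a: "bgates_wf mo n gs \<and> (\<forall>f\<in>F. bprov n gs e f)"
  then obtain gs' where 1: "bgates_wf mo n (gs @ gs')" "length gs' \<le> s"
    and 2: "\<forall>g\<in>G. bprov n (gs @ gs') (e + d) g"
    using assms(1) unfolding bext_def by meson
  have "\<forall>f\<in>F. bprov n (gs @ gs') e f" using a bprov_append by blast
  then obtain gs'' where 3: "bgates_wf mo n ((gs @ gs') @ gs'')" "length gs'' \<le> s'"
    and 4: "\<forall>g\<in>G'. bprov n ((gs @ gs') @ gs'') (e + d) g"
    using 1 assms(2) unfolding bext_def by meson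
  have "\<forall>g\<in>G \<union> G'. bprov n ((gs @ gs') @ gs'') (e + d) g"
    using 2 4 bprov_append by blast
  then show "\<exists>gs'. bgates_wf mo n (gs @ gs') \<and> length gs' \<le> s + s' \<and>
      (\<forall>g\<in>G \<union> G'. bprov n (gs @ gs') (e + d) g)"
    using 1 3 by (intro exI[of _ "gs' @ gs''"]) auto
qed

lemma bext_keep: "bext mo n s d F G \<Longrightarrow> bext mo n s d F (F \<union> G)"
  using bext_Un[of mo n 0 d F F s G] bextI_subset[of F F] by simp

lemma bext_not:
  assumes "f \<in> F"
  shows "bext False n 1 1 F {\<lambda>xs. \<not> f xs}"
  unfolding bext_def
proof (intro allI impI)
  fix gs e assume a: "bgates_wf False n gs \<and> (\<forall>f\<in>F. bprov n gs e f)"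
  then have "bprov n gs e f" using assms by blast
  then consider b where "\<forall>xs. length xs = n \<longrightarrow> f xs = b"
    | j where "j < length gs" "bdeps gs ! j \<le> e" "\<forall>xs. length xs = n \<longrightarrow> bvals xs gs ! j = f xs"
    unfolding bprov_def by blast
  then show "\<exists>gs'. bgates_wf False n (gs @ gs') \<and> length gs' \<le> 1 \<and>
      (\<forall>g\<in>{\<lambda>xs. \<not> f xs}. bprov n (gs @ gs') (e + 1) g)"
  proof cases
    case 1
    then show ?thesis using a by (intro exI[of _ "[]"]) (auto simp: bprov_def)
  next
    case 2
    have "bprov n (gs @ [BNot j]) (e + 1) (\<lambda>xs. \<not> f xs)"
      unfolding bprov_def using 2
      by (intro disjI2 exI[of _ "length gs"]) (auto simp: bvals_snoc bdeps_snoc nth_append)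
    then show ?thesis using a 2 by (intro exI[of _ "[BNot j]"]) (auto simp: bgates_wf_snoc)
  qed
qed

lemma bext_and_or:
  assumes "f \<in> F" "g \<in> F"
  shows "bext mo n 1 1 F {\<lambda>xs. f xs \<and> g xs}" "bext mo n 1 1 F {\<lambda>xs. f xs \<or> g xs}"
proof -
  have *: "\<exists>gs'. bgates_wf mo n (gs @ gs') \<and> length gs' \<le> 1 \<and>
      bprov n (gs @ gs') (e + 1) (\<lambda>xs. if c then f xs \<and> g xs else f xs \<or> g xs)"
    if a: "bgates_wf mo n gs" "\<forall>f\<in>F. bprov n gs e f" for gs e c
  proof -
    have pf: "bprov n gs (e + 1) f" and pg: "bprov n gs (e + 1) g"
      using a assms bprov_mono le_add1 by blast+
    have nil: ?thesis if "bprov n gs (e + 1) (\<lambda>xs. if c then f xs \<and> g xs else f xs \<or> g xs)"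
      using that a by (intro exI[of _ "[]"]) auto
    consider b where "\<forall>xs. length xs = n \<longrightarrow> f xs = b" | b where "\<forall>xs. length xs = n \<longrightarrow> g xs = b"
      | i j where "i < length gs" "bdeps gs ! i \<le> e" "\<forall>xs. length xs = n \<longrightarrow> bvals xs gs ! i = f xs"
         "j < length gs" "bdeps gs ! j \<le> e" "\<forall>xs. length xs = n \<longrightarrow> bvals xs gs ! j = g xs"
    proof -
      have "bprov n gs e f" "bprov n gs e g" using a assms by auto
      then show thesis unfolding bprov_def using that by (elim disjE exE conjE) blast+
    qed
    then show ?thesis
    proof cases
      case 1
      \<comment> \<open>A constant operand has no gate. As \<open>c\<close> selects conjunction
        (True) or disjunction (False), \<open>b = c\<close> says that the constant is the neutral
        element; otherwise it is absorbing and the result is constant.\<close>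
      show ?thesis
      proof (cases "b = c")
        case True
        show ?thesis by (rule nil, rule bprov_cong[OF pg]) (use 1 True in auto)
      next
        case False
        show ?thesis by (rule nil, rule bprov_cong[OF bprov_const[of _ _ _ b]]) (use 1 False in auto)
      qed
    next
      case 2
      show ?thesis
      proof (cases "b = c")
        case True
        show ?thesis by (rule nil, rule bprov_cong[OF pf]) (use 2 True in auto)
      next
        case False
        show ?thesis by (rule nil, rule bprov_cong[OF bprov_const[of _ _ _ b]]) (use 2 False in auto)
      qed
    next
      case 3
      let ?g = "if c then BAnd i j else BOr i j"
      have "bprov n (gs @ [?g]) (e + 1) (\<lambda>xs. if c then f xs \<and> g xs else f xs \<or> g xs)"
        unfolding bprov_def using 3
        by (intro disjI2 exI[of _ "length gs"]) (auto simp: bvals_snoc bdeps_snoc nth_append)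
      then show ?thesis using a 3 by (intro exI[of _ "[?g]"]) (auto simp: bgates_wf_snoc)
    qed
  qed
  show "bext mo n 1 1 F {\<lambda>xs. f xs \<and> g xs}" unfolding bext_def using *[where c = True] by simp
  show "bext mo n 1 1 F {\<lambda>xs. f xs \<or> g xs}" unfolding bext_def using *[where c = False] by simp
qed

text \<open>A chain of gates, whose depth is therefore the size of \<open>I\<close>. This suffices
  for index sets bounded in terms of the algebra or the prime; long sums use the balanced tree of
  \<open>bext_onehot_sum_list\<close>.\<close>

lemma bext_Ball:
  assumes "finite I" "\<And>i. i \<in> I \<Longrightarrow> f i \<in> F"
  shows "bext mo n (card I) (card I) F {\<lambda>xs. \<forall>i\<in>I. f i xs}"
  using assms
proof (induction I rule: finite_induct)
  case empty
  then show ?case using bext_const[of mo n 0 0 F True] by simp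
next
  case (insert i I)
  let ?g = "\<lambda>xs. \<forall>i\<in>I. f i xs"
  have "bext mo n (card I) (card I) F (F \<union> {?g})"
    by (rule bext_keep, rule insert.IH, rule insert.prems) simp
  moreover have "bext mo n 1 1 (F \<union> {?g}) {\<lambda>xs. f i xs \<and> ?g xs}"
    by (rule bext_and_or) (simp_all add: insert.prems)
  ultimately have "bext mo n (card I + 1) (card I + 1) F {\<lambda>xs. f i xs \<and> ?g xs}"
    by (rule bext_trans)
  then show ?case using insert(1,2) by simp
qed

lemma bext_Bex:
  assumes "finite I" "\<And>i. i \<in> I \<Longrightarrow> f i \<in> F"
  shows "bext mo n (card I) (card I) F {\<lambda>xs. \<exists>i\<in>I. f i xs}"
  using assms
proof (induction I rule: finite_induct)
  case empty
  then show ?case using bext_const[of mo n 0 0 F False] by simp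
next
  case (insert i I)
  let ?g = "\<lambda>xs. \<exists>i\<in>I. f i xs"
  have "bext mo n (card I) (card I) F (F \<union> {?g})"
    by (rule bext_keep, rule insert.IH, rule insert.prems) simp
  moreover have "bext mo n 1 1 (F \<union> {?g}) {\<lambda>xs. f i xs \<or> ?g xs}"
    by (rule bext_and_or) (simp_all add: insert.prems)
  ultimately have "bext mo n (card I + 1) (card I + 1) F {\<lambda>xs. f i xs \<or> ?g xs}"
    by (rule bext_trans)
  then show ?case using insert(1,2) by simp
qed

text \<open>Disjunctive normal form over given functions. No negation occurs, so it serves monotone
  circuits as well.\<close>

lemma bext_Bex_Ball:
  assumes "finite I" "\<And>i. i \<in> I \<Longrightarrow> finite (J i) \<and> card (J i) \<le> r"
    "\<And>i j. i \<in> I \<Longrightarrow> j \<in> J i \<Longrightarrow> f i j \<in> F"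
  shows "bext mo n (card I * (r + 1)) (card I + r) F {\<lambda>xs. \<exists>i\<in>I. \<forall>j\<in>J i. f i j xs}"
proof -
  let ?g = "\<lambda>i xs. \<forall>j\<in>J i. f i j xs"
  have "bext mo n (card I * r) r F (\<Union>i\<in>I. {?g i})"
  proof (rule bext_UN[OF assms(1)])
    fix i assume i: "i \<in> I"
    have "bext mo n (card (J i)) (card (J i)) F {?g i}"
      using assms(2)[OF i] by (intro bext_Ball) (simp_all add: assms(3)[OF i])
    then show "bext mo n r r F {?g i}" by (rule bext_mono) (use assms(2)[OF i] in auto)
  qed
  moreover have "bext mo n (card I) (card I) (\<Union>i\<in>I. {?g i}) {\<lambda>xs. \<exists>i\<in>I. ?g i xs}"
    by (rule bext_Bex[OF assms(1)]) blast
  ultimately have "bext mo n (card I * r + card I) (r + card I) F {\<lambda>xs. \<exists>i\<in>I. ?g i xs}"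
    by (rule bext_trans)
  then show ?thesis by (simp add: algebra_simps)
qed

section \<open>Algebraic branching programs as linear recurrences\<close>

text \<open>The path sum at an arbitrary vertex, over the integers and without a bound on the
  length: in a forward edge list there are only finitely many walks anyway.\<close>

definition pv :: "(nat \<times> nat \<times> ablabel) list \<Rightarrow> bool list \<Rightarrow> nat \<Rightarrow> int" where
  "pv E z v = (\<Sum>ps \<in> {ps. walk E 0 ps v}. \<Prod>e \<leftarrow> ps. label_val z (snd (snd (E ! e))))"

definition forward :: "(nat \<times> nat \<times> ablabel) list \<Rightarrow> bool" where
  "forward E \<longleftrightarrow> (\<forall>a b l. (a, b, l) \<in> set E \<longrightarrow> a < b)"

lemma forwardD: "forward E \<Longrightarrow> (a, b, l) \<in> set E \<Longrightarrow> a < b"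
  unfolding forward_def by blast

lemma walk_snoc:
  "walk E u (ps @ [e]) v \<longleftrightarrow> walk E u ps (fst (E ! e)) \<and> e < length E \<and> fst (snd (E ! e)) = v"
  by (induction ps arbitrary: u) auto

lemma walk_sorted:
  assumes "forward E" "walk E u ps v"
  shows "sorted_wrt (<) (map (\<lambda>e. fst (snd (E ! e))) ps) \<and>
    (\<forall>e\<in>set ps. u < fst (snd (E ! e)) \<and> e < length E)"
  using assms(2)
proof (induction ps arbitrary: u)
  case (Cons e ps)
  have "u < fst (snd (E ! e))"
    using forwardD[OF assms(1), of "fst (E ! e)" "fst (snd (E ! e))" "snd (snd (E ! e))"] Cons.prems
    by (auto simp: in_set_conv_nth)
  then show ?case using Cons.IH[of "fst (snd (E ! e))"] Cons.prems by fastforce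
qed simp

text \<open>The heads of the edges along a walk strictly increase, so no edge is used twice.\<close>

lemma walk_length:
  assumes "forward E" "walk E u ps v"
  shows "set ps \<subseteq> {..<length E} \<and> length ps \<le> length E"
proof -
  have w: "sorted_wrt (<) (map (\<lambda>e. fst (snd (E ! e))) ps)" "set ps \<subseteq> {..<length E}"
    using walk_sorted[OF assms] by auto
  then have "distinct ps" by (metis distinct_map strict_sorted_iff)
  then show ?thesis using w card_mono[OF _ w(2)] by (simp add: distinct_card)
qed

lemma finite_walks:
  assumes "forward E"
  shows "finite {ps. walk E u ps v}"
proof (rule finite_subset)
  show "{ps. walk E u ps v} \<subseteq> {ps. set ps \<subseteq> {..<length E} \<and> length ps \<le> length E}"
    using walk_length[OF assms] by blast
qed (simp add: finite_lists_length_le)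

lemma abp_value_pv:
  assumes "forward E"
  shows "abp_value p (m, E, T) z = pv E z (m - 1) mod int p"
proof -
  have "{ps. length ps \<le> length E \<and> walk E 0 ps (m - 1)} = {ps. walk E 0 ps (m - 1)}"
    using walk_length[OF assms] by blast
  then show ?thesis by (simp add: abp_value_def pv_def)
qed

text \<open>Split off the last edge: apart from the empty walk at the source, a walk into
  \<open>v\<close> extends a walk to the tail of exactly one edge with head \<open>v\<close>.
  Parallel edges stay apart because walks are lists of edge indices.\<close>

lemma pv_rec:
  assumes "forward E"
  shows "pv E z v = of_bool (v = 0) +
    (\<Sum>(a, b, l) \<leftarrow> E. if b = v then pv E z a * label_val z l else 0)"
proof -
  define W where "W v = {ps. walk E 0 ps v}" for v
  define I where "I = {e. e < length E \<and> fst (snd (E ! e)) = v}"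
  define X where "X e = (\<lambda>ps. ps @ [e]) ` W (fst (E ! e))" for e
  let ?P = "\<lambda>ps. \<Prod>e \<leftarrow> ps. label_val z (snd (snd (E ! e)))"
  have W: "W v = (if v = 0 then {[]} else {}) \<union> (\<Union>e\<in>I. X e)"
  proof -
    have "ps \<in> W v \<longleftrightarrow> ps \<in> (if v = 0 then {[]} else {}) \<union> (\<Union>e\<in>I. X e)" for ps
      by (cases ps rule: rev_cases) (auto simp: W_def I_def X_def walk_snoc)
    then show ?thesis by blast
  qed
  have fin: "finite (X e)" for e
    unfolding X_def W_def using finite_walks[OF assms] by simp
  have "pv E z v = sum ?P (W v)" by (simp add: pv_def W_def)
  also have "\<dots> = sum ?P (if v = 0 then {[]} else {}) + sum ?P (\<Union>e\<in>I. X e)"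
    unfolding W using fin by (intro sum.union_disjoint) (auto simp: I_def X_def)
  also have "sum ?P (if v = 0 then {[]} else {}) = of_bool (v = 0)" by simp
  also have "sum ?P (\<Union>e\<in>I. X e) = (\<Sum>e\<in>I. sum ?P (X e))"
    using fin by (intro sum.UNION_disjoint) (auto simp: I_def X_def)
  also have "\<dots> = (\<Sum>e\<in>I. pv E z (fst (E ! e)) * label_val z (snd (snd (E ! e))))"
  proof (rule sum.cong[OF refl])
    fix e
    have "sum ?P (X e) = (\<Sum>ps\<in>W (fst (E ! e)). ?P (ps @ [e]))"
      unfolding X_def by (subst sum.reindex) (auto simp: inj_on_def)
    then show "sum ?P (X e) = pv E z (fst (E ! e)) * label_val z (snd (snd (E ! e)))"
      by (simp add: pv_def W_def sum_distrib_right)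
  qed
  also have "\<dots> = (\<Sum>e<length E. if fst (snd (E ! e)) = v
      then pv E z (fst (E ! e)) * label_val z (snd (snd (E ! e))) else 0)"
    unfolding I_def by (subst sum.inter_filter[symmetric]) (auto intro: sum.cong)
  also have "\<dots> = (\<Sum>(a, b, l) \<leftarrow> E. if b = v then pv E z a * label_val z l else 0)"
    by (simp add: sum_list_sum_nth case_prod_unfold atLeast0LessThan)
  finally show ?thesis .
qed

section \<open>Branching programs by repeated squaring\<close>

fun walks_of_length :: "(nat \<times> nat \<times> ablabel) list \<Rightarrow> bool list \<Rightarrow> nat \<Rightarrow> nat \<Rightarrow> int" where
  "walks_of_length E z 0 v = of_bool (v = 0)"
| "walks_of_length E z (Suc j) v =
    (\<Sum>(a, b, l) \<leftarrow> E. if b = v then walks_of_length E z j a * label_val z l else 0)"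

text \<open>Each edge raises the vertex number, so \<open>j\<close> steps from vertex 0 lead at
  least to vertex \<open>j\<close>.\<close>

lemma walks_of_length_eq_0:
  assumes "forward E" "v < j"
  shows "walks_of_length E z j v = 0"
  using assms(2)
proof (induction j arbitrary: v)
  case (Suc j)
  have "(if b = v then walks_of_length E z j a * label_val z l else 0) = 0"
    if "(a, b, l) \<in> set E" for a b l
    using Suc.IH[of a] forwardD[OF assms(1) that] Suc.prems by auto
  then have "map (\<lambda>(a, b, l). if b = v then walks_of_length E z j a * label_val z l else 0) E =
      map (\<lambda>_. 0) E" by (intro map_cong) auto
  then have "walks_of_length E z (Suc j) v = sum_list (map (\<lambda>_. 0) E)"
    unfolding walks_of_length.simps by (rule arg_cong)
  then show ?case by simp
qed simp

text \<open>Summing the recurrence graded by length gives back \<open>pv_rec\<close>; the surplus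
  term of length \<open>Suc J\<close> vanishes because \<open>v < Suc J\<close>.\<close>

lemma pv_eq_sum_walks:
  assumes wf: "forward E" and "v \<le> J"
  shows "pv E z v = (\<Sum>j\<le>J. walks_of_length E z j v)"
  using assms(2)
proof (induction v rule: less_induct)
  case (less v)
  have "(\<Sum>(a, b, l) \<leftarrow> E. if b = v then pv E z a * label_val z l else 0) =
      (\<Sum>(a, b, l) \<leftarrow> E. \<Sum>j\<le>J. if b = v then walks_of_length E z j a * label_val z l else 0)"
  proof (intro arg_cong[of _ _ sum_list] map_cong refl, clarify)
    fix a b l assume "(a, b, l) \<in> set E"
    then have "pv E z a = (\<Sum>j\<le>J. walks_of_length E z j a)" if "b = v"
      using less that forwardD[OF wf] by (metis less_imp_le_nat order.strict_trans2)
    then show "(if b = v then pv E z a * label_val z l else 0) =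
       (\<Sum>j\<le>J. if b = v then walks_of_length E z j a * label_val z l else 0)"
      by (simp add: sum_distrib_right)
  qed
  also have "\<dots> = (\<Sum>j\<le>J. walks_of_length E z (Suc j) v)"
    by (simp add: sum_list_sum_nth case_prod_unfold sum.swap[where A = "{..J}"])
  finally have "pv E z v = walks_of_length E z 0 v + (\<Sum>j\<le>J. walks_of_length E z (Suc j) v)"
    using pv_rec[OF wf, of z v] by simp
  also have "\<dots> = (\<Sum>j\<le>Suc J. walks_of_length E z j v)"
    by (simp only: sum.atMost_Suc_shift)
  finally show ?case using walks_of_length_eq_0[OF wf, of v "Suc J"] less.prems by simp
qed

text \<open>The loop at the sink makes the \<open>L\<close>-th power of the matrix collect all walks of
  length at most \<open>L\<close> that end there.\<close>
definition abp_mat :: "nat \<Rightarrow> (nat \<times> nat \<times> ablabel) list \<Rightarrow> bool list \<Rightarrow> nat \<Rightarrow> nat \<Rightarrow> int" where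
  "abp_mat m E z u v = (\<Sum>(a, b, l) \<leftarrow> E. if a = u \<and> b = v then label_val z l else 0) +
     of_bool (u = m - 1 \<and> v = m - 1)"

fun mat_pow :: "nat \<Rightarrow> (nat \<Rightarrow> nat \<Rightarrow> int) \<Rightarrow> nat \<Rightarrow> nat \<Rightarrow> nat \<Rightarrow> int" where
  "mat_pow m B 0 u v = of_bool (u = v)"
| "mat_pow m B (Suc n) u v = (\<Sum>x<m. mat_pow m B n u x * B x v)"

fun mat_sq :: "nat \<Rightarrow> (nat \<Rightarrow> nat \<Rightarrow> int) \<Rightarrow> nat \<Rightarrow> nat \<Rightarrow> nat \<Rightarrow> int" where
  "mat_sq m B 0 u v = B u v"
| "mat_sq m B (Suc l) u v = (\<Sum>x<m. mat_sq m B l u x * mat_sq m B l x v)"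

lemma mat_pow_add:
  assumes "v < m"
  shows "mat_pow m B (a + b) u v = (\<Sum>x<m. mat_pow m B a u x * mat_pow m B b x v)"
  using assms
proof (induction b arbitrary: v)
  case 0
  have "(\<Sum>x<m. mat_pow m B a u x * mat_pow m B 0 x v) =
      (\<Sum>x<m. if x = v then mat_pow m B a u x else 0)"
    by (intro sum.cong) auto
  then show ?case using 0 by simp
next
  case (Suc b)
  have "mat_pow m B (a + Suc b) u v =
      (\<Sum>y<m. (\<Sum>x<m. mat_pow m B a u x * mat_pow m B b x y) * B y v)"
    using Suc.IH by simp
  also have "\<dots> = (\<Sum>y<m. \<Sum>x<m. mat_pow m B a u x * (mat_pow m B b x y * B y v))"
    by (simp add: sum_distrib_right mult.assoc)
  also have "\<dots> = (\<Sum>x<m. \<Sum>y<m. mat_pow m B a u x * (mat_pow m B b x y * B y v))"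
    by (rule sum.swap)
  finally show ?case by (simp add: sum_distrib_left)
qed

lemma mat_sq_eq_pow:
  assumes "u < m" "v < m"
  shows "mat_sq m B l u v = mat_pow m B (2 ^ l) u v"
  using assms
proof (induction l arbitrary: u v)
  case 0
  have "mat_pow m B 1 u v = (\<Sum>x<m. if x = u then B x v else 0)"
    unfolding One_nat_def mat_pow.simps by (intro sum.cong) auto
  then show ?case using 0 by simp
next
  case (Suc l)
  then show ?case using mat_pow_add[of v m B "2 ^ l" "2 ^ l" u] by (simp add: mult_2)
qed

text \<open>No edge leaves the sink, so its loop feeds only itself: the other columns keep counting
  walks of one exact length, and the sink column carries all earlier totals along.\<close>

lemma mat_pow_abp:
  assumes wf: "\<forall>a b l. (a, b, l) \<in> set E \<longrightarrow> a < b \<and> b < m" and "v < m"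
  shows "mat_pow m (abp_mat m E z) n 0 v =
    (if v = m - 1 then (\<Sum>j\<le>n. walks_of_length E z j v) else walks_of_length E z n v)"
  using assms(2)
proof (induction n arbitrary: v)
  case (Suc n)
  let ?p = "mat_pow m (abp_mat m E z) n 0"
  have "(\<Sum>x<m. ?p x * (\<Sum>(a, b, l) \<leftarrow> E. if a = x \<and> b = v then label_val z l else 0)) =
     (\<Sum>(a, b, l) \<leftarrow> E. \<Sum>x<m. if a = x \<and> b = v then ?p x * label_val z l else 0)"
    by (simp add: sum_list_sum_nth case_prod_unfold sum_distrib_left
        sum.swap[where A = "{..<m}"] if_distrib cong: if_cong)
  also have "\<dots> = (\<Sum>(a, b, l) \<leftarrow> E. if b = v then walks_of_length E z n a * label_val z l else 0)"
  proof (intro arg_cong[of _ _ sum_list] map_cong refl, clarify)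
    fix a b l assume e: "(a, b, l) \<in> set E"
    then have ab: "a < m" "a \<noteq> m - 1" using wf by fastforce+
    have "(\<Sum>x<m. if a = x \<and> b = v then ?p x * label_val z l else 0) =
       (\<Sum>x<m. if x = a then (if b = v then ?p a * label_val z l else 0) else 0)"
      by (intro sum.cong) auto
    then show "(\<Sum>x<m. if a = x \<and> b = v then ?p x * label_val z l else 0) =
       (if b = v then walks_of_length E z n a * label_val z l else 0)"
      using Suc.IH[OF ab(1)] ab by simp
  qed
  finally have 1: "(\<Sum>x<m. ?p x * (\<Sum>(a, b, l) \<leftarrow> E. if a = x \<and> b = v then label_val z l else 0)) =
    walks_of_length E z (Suc n) v" by simp
  have "(\<Sum>x<m. ?p x * of_bool (x = m - 1 \<and> v = m - 1)) =
      (\<Sum>x<m. if x = m - 1 then of_bool (v = m - 1) * ?p (m - 1) else 0)"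
    by (intro sum.cong) auto
  also have "\<dots> = of_bool (v = m - 1) * ?p (m - 1)" using Suc.prems by simp
  finally have 2: "(\<Sum>x<m. ?p x * of_bool (x = m - 1 \<and> v = m - 1)) =
      of_bool (v = m - 1) * ?p (m - 1)" .
  have "mat_pow m (abp_mat m E z) (Suc n) 0 v =
      walks_of_length E z (Suc n) v + of_bool (v = m - 1) * ?p (m - 1)"
    unfolding mat_pow.simps abp_mat_def[of m E z _ v] distrib_left sum.distrib 1 2 ..
  then show ?case using Suc.IH[of "m - 1"] Suc.prems by auto
qed auto

lemma abp_value_mat_sq:
  assumes wf: "babp_wf p k (m, E, T)" and "m \<le> 2 ^ L"
  shows "abp_value p (m, E, T) z = mat_sq m (abp_mat m E z) L 0 (m - 1) mod int p"
proof -
  have wf': "\<forall>a b l. (a, b, l) \<in> set E \<longrightarrow> a < b \<and> b < m" and m: "m \<ge> 1" and fwd: "forward E"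
    using wf by (auto simp: babp_wf_def forward_def)
  have "mat_sq m (abp_mat m E z) L 0 (m - 1) = pv E z (m - 1)"
    using m assms(2) mat_sq_eq_pow[of 0 m "m - 1"] mat_pow_abp[OF wf', of "m - 1"]
      pv_eq_sum_walks[OF fwd, of "m - 1" "2 ^ L" z] by simp
  then show ?thesis using abp_value_pv[OF fwd, of p m T z] by simp
qed

section \<open>Arithmetic modulo \<open>p\<close> on residues in one-hot code\<close>

text \<open>A residue is carried as \<open>p\<close> Boolean functions, one for each value, so that
  every arithmetic operation has a cost depending on \<open>p\<close> alone.\<close>

definition onehot :: "nat \<Rightarrow> (bool list \<Rightarrow> int) \<Rightarrow> (bool list \<Rightarrow> bool) set" where
  "onehot p g = (\<Union>y\<in>{0..<int p}. {\<lambda>xs. g xs mod int p = y})"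

lemma onehotI: "y \<in> {0..<int p} \<Longrightarrow> (\<lambda>xs. g xs mod int p = y) \<in> onehot p g"
  unfolding onehot_def by (rule UN_I[of y]) simp_all

text \<open>Table lookup for a binary operation: each of the \<open>p\<close> output values is a
  disjunction of at most \<open>p * p\<close> conjunctions of two literals, hence
  \<open>p * (p * p * 3)\<close> gates. The summand 2 makes the same number dominate the depth
  \<open>p * p + 2\<close>.\<close>

definition gate_cost :: "nat \<Rightarrow> nat" where "gate_cost p = 3 * p ^ 3 + 2"

lemma gate_cost_ge: "p \<le> gate_cost p" "p * p + 2 \<le> gate_cost p"
proof -
  have "p \<le> p ^ 3" "p * p \<le> p ^ 3" by (cases p; simp add: power3_eq_cube)+
  then show "p \<le> gate_cost p" "p * p + 2 \<le> gate_cost p" by (auto simp: gate_cost_def)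
qed

lemma bext_onehot_binop:
  fixes opr :: "int \<Rightarrow> int \<Rightarrow> int"
  assumes p: "p > 0" and "onehot p f \<subseteq> F" "onehot p g \<subseteq> F"
    and opr: "\<And>a b. opr (a mod int p) (b mod int p) mod int p = opr a b mod int p"
  shows "bext mo n (gate_cost p) (gate_cost p) F (onehot p (\<lambda>xs. opr (f xs) (g xs)))"
proof -
  have "bext mo n (p * p * 3) (p * p + 2) F {\<lambda>xs. opr (f xs) (g xs) mod int p = y}"
    if "y \<in> {0..<int p}" for y
  proof -
    define I where "I = {(a, b). a \<in> {0..<int p} \<and> b \<in> {0..<int p} \<and> opr a b mod int p = y}"
    have sub: "I \<subseteq> {0..<int p} \<times> {0..<int p}" by (auto simp: I_def)
    then have fin: "finite I" by (rule finite_subset) simp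
    have "card I \<le> card ({0..<int p} \<times> {0..<int p})" using sub by (intro card_mono) auto
    then have card: "card I \<le> p * p" by (simp add: card_cartesian_product)
    \<comment> \<open>The Boolean index \<open>j\<close> selects the operand, so the conjunction
      over \<open>UNIV\<close> has exactly two literals.\<close>
    let ?h = "\<lambda>i j xs. if j then f xs mod int p = fst i else g xs mod int p = snd i"
    have b1: "bext mo n (card I * (2 + 1)) (card I + 2) F {\<lambda>xs. \<exists>i\<in>I. \<forall>j\<in>UNIV. ?h i j xs}"
    proof (rule bext_Bex_Ball[OF fin, where J = "\<lambda>_. UNIV" and f = ?h])
      fix i and j :: bool assume "i \<in> I"
      then have "fst i \<in> {0..<int p}" "snd i \<in> {0..<int p}" by (auto simp: I_def)
      then have "(\<lambda>xs. f xs mod int p = fst i) \<in> onehot p f"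
        "(\<lambda>xs. g xs mod int p = snd i) \<in> onehot p g" by (simp_all only: onehotI)
      then show "?h i j \<in> F" using assms(2,3) by (cases j) auto
    qed (simp add: card_UNIV_bool)
    have "(\<exists>i\<in>I. \<forall>j\<in>UNIV. ?h i j xs) = (opr (f xs) (g xs) mod int p = y)" for xs
    proof -
      have "(\<exists>i\<in>I. \<forall>j\<in>UNIV. ?h i j xs) = ((f xs mod int p, g xs mod int p) \<in> I)"
        by (force simp: all_bool_eq)
      then show ?thesis using p by (simp add: I_def opr)
    qed
    with b1 have "bext mo n (card I * (2 + 1)) (card I + 2) F {\<lambda>xs. opr (f xs) (g xs) mod int p = y}"
      by simp
    then show ?thesis by (rule bext_mono) (use card in auto)
  qed
  then have "bext mo n (card {0..<int p} * (p * p * 3)) (p * p + 2) F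
      (\<Union>y\<in>{0..<int p}. {\<lambda>xs. opr (f xs) (g xs) mod int p = y})"
    by (intro bext_UN) auto
  then show ?thesis unfolding onehot_def
    by (rule bext_mono) (use gate_cost_ge in \<open>auto simp: gate_cost_def power3_eq_cube\<close>)
qed

text \<open>Halving the list yields a balanced tree with at most \<open>2 ^ l - 1\<close> additions.
  Its depth, linear in \<open>l\<close>, is one of the two logarithmic factors of the final depth;
  the number of squarings is the other.\<close>

lemma bext_onehot_sum_list:
  assumes p: "p > 0" and "length gs \<le> 2 ^ l" "\<And>g. g \<in> set gs \<Longrightarrow> onehot p g \<subseteq> F"
  shows "bext mo n (gate_cost p * (2 ^ l - 1)) (gate_cost p * l) F
    (onehot p (\<lambda>xs. \<Sum>g\<leftarrow>gs. g xs))"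
  using assms(2,3)
proof (induction l arbitrary: gs)
  case 0
  then consider "gs = []" | g where "gs = [g]" by (cases gs) auto
  then show ?case
  proof cases
    case 1
    have "bext mo n (card {0..<int p} * 0) 0 F (\<Union>y\<in>{0..<int p}. {\<lambda>xs. 0 mod int p = y})"
      by (rule bext_UN) (simp_all add: bext_const)
    with 1 show ?thesis by (simp add: onehot_def)
  next
    case 2
    then show ?thesis using 0 by (auto intro!: bextI_subset)
  qed
next
  case (Suc l)
  let ?s1 = "\<lambda>xs. \<Sum>g\<leftarrow>take (2 ^ l) gs. g xs" and ?s2 = "\<lambda>xs. \<Sum>g\<leftarrow>drop (2 ^ l) gs. g xs"
  let ?K = "gate_cost p"
  have "bext mo n (?K * (2 ^ l - 1)) (?K * l) F (onehot p ?s1)"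
    by (rule Suc.IH) (use Suc.prems in \<open>auto dest: in_set_takeD\<close>)
  moreover have "bext mo n (?K * (2 ^ l - 1)) (?K * l) F (onehot p ?s2)"
    by (rule Suc.IH) (use Suc.prems in \<open>auto dest: in_set_dropD\<close>)
  ultimately have "bext mo n (?K * (2 ^ l - 1) + ?K * (2 ^ l - 1)) (?K * l) F
      (onehot p ?s1 \<union> onehot p ?s2)" by (rule bext_Un)
  moreover have "bext mo n ?K ?K (onehot p ?s1 \<union> onehot p ?s2)
      (onehot p (\<lambda>xs. ?s1 xs + ?s2 xs))"
    by (rule bext_onehot_binop[OF p]) (auto simp: mod_add_eq)
  ultimately have "bext mo n (?K * (2 ^ l - 1) + ?K * (2 ^ l - 1) + ?K) (?K * l + ?K) F
      (onehot p (\<lambda>xs. ?s1 xs + ?s2 xs))" by (rule bext_trans)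
  moreover have "?s1 xs + ?s2 xs = (\<Sum>g\<leftarrow>gs. g xs)" for xs
    by (metis append_take_drop_id map_append sum_list_append)
  moreover have "?K * (2 ^ l - 1) + ?K * (2 ^ l - 1) + ?K = ?K * (2 ^ Suc l - 1)"
  proof -
    have "(1::nat) \<le> 2 ^ l" by simp
    then have "(2::nat) ^ Suc l - 1 = (2 ^ l - 1) + (2 ^ l - 1) + 1"
      unfolding power_Suc by linarith
    then show ?thesis by (simp only: distrib_left mult_1_right)
  qed
  ultimately show ?case by (simp add: algebra_simps)
qed

lemma bext_onehot_label:
  assumes "set fs \<subseteq> F" and "case l of LV i \<Rightarrow> i < length fs | LC c \<Rightarrow> True"
  shows "bext False n p 1 F (onehot p (\<lambda>xs. label_val (map (\<lambda>f. f xs) fs) l))"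
proof -
  have "bext False n 1 1 F {\<lambda>xs. label_val (map (\<lambda>f. f xs) fs) l mod int p = y}" for y
  proof (cases l)
    case (LC c)
    then show ?thesis using bext_const[of False n 1 1 F "c mod int p = y"] by simp
  next
    case (LV i)
    with assms have i: "fs ! i \<in> F" "i < length fs" by auto
    have eq: "(\<lambda>xs. label_val (map (\<lambda>f. f xs) fs) l mod int p = y) =
       (\<lambda>xs. if (fs ! i) xs then 1 mod int p = y else 0 = y)"
      using LV i by auto
    \<comment> \<open>A bit takes the residues 0 and \<open>1 mod int p\<close>. Either
      \<open>y\<close> does not distinguish them, or it matches 0 only and the bit has to be
      negated, or it matches 1 only and the bit itself is the answer.\<close>
    consider "(1 mod int p = y) = (0 = y)" | "0 = y" "1 mod int p \<noteq> y" | "0 \<noteq> y" "1 mod int p = y"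
      by blast
    then show ?thesis unfolding eq
    proof cases
      case 1
      then show "bext False n 1 1 F {\<lambda>xs. if (fs ! i) xs then 1 mod int p = y else 0 = y}"
        using bext_const[of False n 1 1 F "0 = y"] by simp
    next
      case 2
      then show "bext False n 1 1 F {\<lambda>xs. if (fs ! i) xs then 1 mod int p = y else 0 = y}"
        using bext_not[OF i(1), of n] by simp
    next
      case 3
      then show "bext False n 1 1 F {\<lambda>xs. if (fs ! i) xs then 1 mod int p = y else 0 = y}"
        using bextI_subset[of "{fs ! i}" F False n 1 1] i by simp
    qed
  qed
  then have "bext False n (card {0..<int p} * 1) 1 F
     (\<Union>y\<in>{0..<int p}. {\<lambda>xs. label_val (map (\<lambda>f. f xs) fs) l mod int p = y})"
    by (intro bext_UN) auto
  then show ?thesis by (simp add: onehot_def)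
qed

lemma bext_onehot_const: "bext mo n 0 0 F (onehot p (\<lambda>xs. c))"
proof -
  have "bext mo n (card {0..<int p} * 0) 0 F (\<Union>y\<in>{0..<int p}. {\<lambda>xs. c mod int p = y})"
    by (rule bext_UN) (simp_all add: bext_const)
  then show ?thesis by (simp add: onehot_def)
qed

text \<open>With \<open>K = gate_cost p\<close> and \<open>N = 2 ^ L\<close> there are at most
  \<open>N * N\<close> matrix entries. Building an entry from labels costs \<open>4 * K * N\<close>
  and one squaring \<open>2 * K * N\<close> per entry; since \<open>L + 1 \<le> N\<close>, this
  stays below \<open>4 * K * N ^ 4\<close>, and the last \<open>K * N ^ 4\<close> pays for the
  membership test in \<open>T\<close>. The depth is quadratic in \<open>L\<close>: there are
  \<open>L\<close> squarings of depth \<open>K * (L + 1)\<close>.\<close>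

lemma bext_babp:
  assumes p: "p > 0" and wf: "babp_wf p (length fs) (m, E, T)" and fs: "set fs \<subseteq> F"
    and mL: "m \<le> 2 ^ L" and EL: "length E \<le> 2 ^ L"
  shows "bext False n (5 * gate_cost p * (2 ^ L) ^ 4) (3 * gate_cost p * (L + 1)\<^sup>2) F
    {\<lambda>xs. babp_eval p (m, E, T) (map (\<lambda>f. f xs) fs)}"
proof -
  define K where "K = gate_cost p"
  define N :: nat where "N = 2 ^ L"
  have pK: "p \<le> K" using gate_cost_ge by (simp add: K_def)
  have N1: "N \<ge> 1" "L + 1 \<le> N" unfolding N_def using less_exp[of L] by (simp_all add: Suc_leI)
  define B where "B xs = abp_mat m E (map (\<lambda>f. f xs) fs)" for xs
  define Q where "Q l = (\<Union>uv\<in>{..<m} \<times> {..<m}.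
    onehot p (\<lambda>xs. mat_sq m (B xs) l (fst uv) (snd uv)))" for l
  have card: "card ({..<m} \<times> {..<m}) \<le> N * N"
    using mL by (simp add: card_cartesian_product N_def mult_le_mono)
  have entry0: "bext False n (4 * K * N) (K * (L + 2)) F (onehot p (\<lambda>xs. mat_sq m (B xs) 0 u v))" for u v
  proof -
    define gs where "gs = map (\<lambda>(a, b, l) xs. if a = u \<and> b = v
        then label_val (map (\<lambda>f. f xs) fs) l else 0) E @ [\<lambda>xs. of_bool (u = m - 1 \<and> v = m - 1)]"
    \<comment> \<open>The loop at the sink adds one summand to at most \<open>2 ^ L\<close> edges,
      which costs one more level of the adder tree.\<close>
    have len: "length gs \<le> 2 ^ Suc L" "length gs \<le> N + 1"
      using EL N1 by (simp_all add: gs_def N_def)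
    have one: "bext False n p 1 F (onehot p g)" if "g \<in> set gs" for g
    proof -
      from that consider "g = (\<lambda>xs. of_bool (u = m - 1 \<and> v = m - 1))"
        | a b l where "(a, b, l) \<in> set E"
          "g = (\<lambda>xs. if a = u \<and> b = v then label_val (map (\<lambda>f. f xs) fs) l else 0)"
        unfolding gs_def by auto
      then consider c where "g = (\<lambda>xs. c)"
        | a b l where "(a, b, l) \<in> set E" "g = (\<lambda>xs. label_val (map (\<lambda>f. f xs) fs) l)"
      proof cases
        case (2 a b l)
        then show thesis by (cases "a = u \<and> b = v") (simp_all add: that)
      qed (use that in blast)
      then show ?thesis
      proof cases
        case 1
        show ?thesis unfolding 1 by (rule bext_mono[OF bext_onehot_const[of False n F p c]]) simp_all
      next
        case 2
        then have "case l of LV i \<Rightarrow> i < length fs | LC c \<Rightarrow> True"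
          using wf by (auto simp: babp_wf_def split: ablabel.splits)
        then show ?thesis using 2 bext_onehot_label[OF fs] by simp
      qed
    qed
    have "bext False n (card (set gs) * p) 1 F (\<Union>g\<in>set gs. onehot p g)"
      by (rule bext_UN[OF finite_set one])
    moreover have "bext False n (K * (2 ^ Suc L - 1)) (K * Suc L) (\<Union>g\<in>set gs. onehot p g)
        (onehot p (\<lambda>xs. \<Sum>g\<leftarrow>gs. g xs))"
      unfolding K_def by (rule bext_onehot_sum_list[OF p len(1)]) blast
    ultimately have "bext False n (card (set gs) * p + K * (2 ^ Suc L - 1)) (1 + K * Suc L) F
        (onehot p (\<lambda>xs. \<Sum>g\<leftarrow>gs. g xs))" by (rule bext_trans)
    moreover have "(\<Sum>g\<leftarrow>gs. g xs) = mat_sq m (B xs) 0 u v" for xs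
      by (simp add: gs_def B_def abp_mat_def case_prod_unfold comp_def if_distrib[of "\<lambda>f. f _"])
    ultimately have "bext False n (card (set gs) * p + K * (2 ^ Suc L - 1)) (1 + K * Suc L) F
        (onehot p (\<lambda>xs. mat_sq m (B xs) 0 u v))" by simp
    then show ?thesis
    proof (rule bext_mono)
      have "card (set gs) * p \<le> (2 * N) * K"
        using card_length[of gs] len N1 pK by (intro mult_le_mono) auto
      moreover have "K * (2 ^ Suc L - 1) \<le> K * (2 * N)" by (simp add: N_def)
      ultimately have "card (set gs) * p + K * (2 ^ Suc L - 1) \<le> 2 * N * K + K * (2 * N)"
        by (rule add_mono)
      also have "2 * N * K + K * (2 * N) = 4 * K * N" by simp
      finally show "card (set gs) * p + K * (2 ^ Suc L - 1) \<le> 4 * K * N" .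
      have "K \<ge> 1" using pK p by simp
      then show "1 + K * Suc L \<le> K * (L + 2)" by simp
    qed simp_all
  qed
  have Q0: "bext False n (N * N * (4 * K * N)) (K * (L + 2)) F (Q 0)"
  proof -
    have "bext False n (card ({..<m} \<times> {..<m}) * (4 * K * N)) (K * (L + 2)) F (Q 0)"
      unfolding Q_def by (rule bext_UN) (simp_all only: entry0 finite_cartesian_product finite_lessThan)
    then show ?thesis by (rule bext_mono) (use card in \<open>simp_all add: mult_le_mono1\<close>)
  qed
  have entryS: "bext False n (2 * K * N) (K * (L + 1)) (Q l)
      (onehot p (\<lambda>xs. mat_sq m (B xs) (Suc l) u v))" if uv: "u < m" "v < m" for u v l
  proof -
    let ?g = "\<lambda>x xs. mat_sq m (B xs) l u x * mat_sq m (B xs) l x v"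
    have in_Q: "onehot p (\<lambda>xs. mat_sq m (B xs) l a b) \<subseteq> Q l" if "a < m" "b < m" for a b
    proof
      fix h assume "h \<in> onehot p (\<lambda>xs. mat_sq m (B xs) l a b)"
      then show "h \<in> Q l" unfolding Q_def using that by (intro UN_I[of "(a, b)"]) auto
    qed
    have "bext False n (card {..<m} * K) K (Q l) (\<Union>x\<in>{..<m}. onehot p (?g x))"
    proof (rule bext_UN)
      fix x assume x: "x \<in> {..<m}"
      show "bext False n K K (Q l) (onehot p (?g x))"
        unfolding K_def by (rule bext_onehot_binop[OF p])
          (use x uv in_Q in \<open>simp_all add: mod_mult_eq\<close>)
    qed simp
    moreover have "bext False n (K * (2 ^ L - 1)) (K * L) (\<Union>x\<in>{..<m}. onehot p (?g x))
        (onehot p (\<lambda>xs. \<Sum>g\<leftarrow>map ?g [0..<m]. g xs))"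
      unfolding K_def by (rule bext_onehot_sum_list[OF p]) (use mL in auto)
    ultimately have "bext False n (card {..<m} * K + K * (2 ^ L - 1)) (K + K * L) (Q l)
        (onehot p (\<lambda>xs. \<Sum>g\<leftarrow>map ?g [0..<m]. g xs))" by (rule bext_trans)
    moreover have "(\<Sum>g\<leftarrow>map ?g [0..<m]. g xs) = mat_sq m (B xs) (Suc l) u v" for xs
      by (simp add: comp_def interv_sum_list_conv_sum_set_nat atLeast0LessThan)
    ultimately have "bext False n (card {..<m} * K + K * (2 ^ L - 1)) (K + K * L) (Q l)
        (onehot p (\<lambda>xs. mat_sq m (B xs) (Suc l) u v))" by simp
    then show ?thesis
    proof (rule bext_mono)
      have "m * K \<le> N * K" using mL by (simp add: N_def)
      moreover have "K * (2 ^ L - 1) \<le> K * N" by (simp add: N_def)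
      ultimately have "m * K + K * (2 ^ L - 1) \<le> N * K + K * N" by (rule add_mono)
      then show "card {..<m} * K + K * (2 ^ L - 1) \<le> 2 * K * N"
        by (simp only: card_lessThan mult.commute[of N K] mult_2 distrib_right)
    qed simp_all
  qed
  have QS: "bext False n (N * N * (2 * K * N)) (K * (L + 1)) (Q l) (Q (Suc l))" for l
  proof -
    have "bext False n (card ({..<m} \<times> {..<m}) * (2 * K * N)) (K * (L + 1)) (Q l)
      (\<Union>uv\<in>{..<m} \<times> {..<m}. onehot p (\<lambda>xs. mat_sq m (B xs) (Suc l) (fst uv) (snd uv)))"
    proof (rule bext_UN)
      fix uv assume "uv \<in> {..<m} \<times> {..<m}"
      then have "fst uv < m" "snd uv < m" by auto
      then show "bext False n (2 * K * N) (K * (L + 1)) (Q l)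
        (onehot p (\<lambda>xs. mat_sq m (B xs) (Suc l) (fst uv) (snd uv)))" by (rule entryS)
    qed simp
    then show ?thesis unfolding Q_def[of "Suc l"]
      by (rule bext_mono) (use card in \<open>simp_all add: mult_le_mono1\<close>)
  qed
  have Ql: "bext False n (N * N * (4 * K * N) + l * (N * N * (2 * K * N)))
      (K * (L + 2) + l * (K * (L + 1))) F (Q l)" for l
  proof (induction l)
    case (Suc l)
    then show ?case using bext_trans[OF Suc QS] by (simp add: algebra_simps)
  qed (use Q0 in simp)
  have fT: "finite T" and Tp: "T \<subseteq> {0..<int p}" and m1: "m \<ge> 1"
    using wf finite_subset[of T "{0..<int p}"] by (auto simp: babp_wf_def)
  have cT: "card T \<le> p" using card_mono[OF _ Tp] by simp
  let ?o = "\<lambda>y xs. mat_sq m (B xs) L 0 (m - 1) mod int p = y"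
  have "bext False n (card T) (card T) (Q L) {\<lambda>xs. \<exists>y\<in>T. ?o y xs}"
  proof (rule bext_Bex[OF fT])
    fix y assume "y \<in> T"
    then have "?o y \<in> onehot p (\<lambda>xs. mat_sq m (B xs) L (fst (0, m - 1)) (snd (0, m - 1)))"
      using Tp by (auto intro: onehotI)
    then show "?o y \<in> Q L" unfolding Q_def using m1 by (intro UN_I[of "(0, m - 1)"]) auto
  qed
  note bext_trans[OF Ql[of L] this]
  moreover have "(\<exists>y\<in>T. ?o y xs) = babp_eval p (m, E, T) (map (\<lambda>f. f xs) fs)" for xs
    using abp_value_mat_sq[OF wf mL] by (simp add: babp_eval_def B_def)
  ultimately have "bext False n (N * N * (4 * K * N) + L * (N * N * (2 * K * N)) + card T)
      (K * (L + 2) + L * (K * (L + 1)) + card T) F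
      {\<lambda>xs. babp_eval p (m, E, T) (map (\<lambda>f. f xs) fs)}" by simp
  then show ?thesis
  proof (rule bext_mono)
    define X where "X = N * N * (2 * K * N)"
    have "X + L * X \<le> N * X" using mult_le_mono1[OF N1(2), of X] by simp
    moreover have "X \<le> N * X" using mult_le_mono1[OF N1(1), of X] by simp
    moreover have "N * N * (4 * K * N) = 2 * X" by (simp add: X_def)
    moreover have "2 * (N * X) = 4 * K * N ^ 4" by (simp add: X_def power4_eq_xxxx)
    ultimately have "N * N * (4 * K * N) + L * (N * N * (2 * K * N)) \<le> 4 * K * N ^ 4"
      unfolding X_def[symmetric] by linarith
    moreover have "card T \<le> K * N ^ 4"
    proof -
      have "1 \<le> N ^ 4" using N1 by simp
      then have "K * 1 \<le> K * N ^ 4" by (rule mult_le_mono2)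
      then show ?thesis using cT pK by linarith
    qed
    ultimately have "N * N * (4 * K * N) + L * (N * N * (2 * K * N)) + card T \<le>
        4 * K * N ^ 4 + K * N ^ 4" by (rule add_mono)
    also have "4 * K * N ^ 4 + K * N ^ 4 = 5 * K * N ^ 4" by simp
    finally show "N * N * (4 * K * N) + L * (N * N * (2 * K * N)) + card T
        \<le> 5 * gate_cost p * (2 ^ L) ^ 4" unfolding K_def N_def .
    have "card T \<le> K" using cT pK by simp
    then have "K * (L + 2) + L * (K * (L + 1)) + card T \<le> K * ((L + 2) + L * (L + 1) + 1)"
      by (simp add: algebra_simps)
    also have "\<dots> \<le> K * (3 * (L + 1)\<^sup>2)"
      by (rule mult_le_mono2) (simp add: power2_eq_square)
    finally show "K * (L + 2) + L * (K * (L + 1)) + card T \<le> 3 * gate_cost p * (L + 1)\<^sup>2"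
      by (simp add: K_def algebra_simps)
  qed simp_all
qed

section \<open>Iterated layers of branching program gates\<close>

definition layers_eval :: "nat list \<Rightarrow> babp list list \<Rightarrow> bool list \<Rightarrow> bool list" where
  "layers_eval ps Ls xs = foldr (\<lambda>(layer, p) inp. map (\<lambda>G. babp_eval p G inp) layer) (zip Ls ps) xs"

lemma layers_eval_Nil [simp]: "layers_eval [] [] xs = xs"
  by (simp add: layers_eval_def)

lemma layers_eval_Cons [simp]:
  "layers_eval (p # ps) (layer # Ls) xs = map (\<lambda>G. babp_eval p G (layers_eval ps Ls xs)) layer"
  by (simp add: layers_eval_def)

definition out_length :: "nat \<Rightarrow> babp list list \<Rightarrow> nat" where
  "out_length k Ls = (if Ls = [] then k else length (hd Ls))"

lemma length_layers_eval:
  "length Ls = length ps \<Longrightarrow> length (layers_eval ps Ls xs) = out_length (length xs) Ls"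
  by (cases Ls; cases ps) (auto simp: out_length_def)

text \<open>The indexed condition inside \<open>itdet_wf\<close>, recast along the list so that
  induction on the layers applies.\<close>

fun layers_wf :: "nat \<Rightarrow> nat list \<Rightarrow> babp list list \<Rightarrow> bool" where
  "layers_wf k [] [] = True"
| "layers_wf k (p # ps) (layer # Ls) =
    ((\<forall>G\<in>set layer. babp_wf p (out_length k Ls) G) \<and> layers_wf k ps Ls)"
| "layers_wf k _ _ = False"

lemma layers_wf_length: "layers_wf k ps Ls \<Longrightarrow> length Ls = length ps"
  by (induction k ps Ls rule: layers_wf.induct) auto

lemma layers_wf_iff:
  "layers_wf k ps Ls \<longleftrightarrow> length Ls = length ps \<and> (\<forall>i < length Ls. \<forall>G \<in> set (Ls ! i).
     babp_wf (ps ! i) (if Suc i < length Ls then length (Ls ! Suc i) else k) G)"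
proof (induction k ps Ls rule: layers_wf.induct)
  case (2 k p ps layer Ls)
  have "out_length k Ls = (if Suc 0 < length (layer # Ls) then length ((layer # Ls) ! Suc 0) else k)"
    by (cases Ls) (auto simp: out_length_def)
  then show ?case using 2 by (simp add: All_less_Suc2 conj_ac)
qed auto

definition layers_size :: "babp list list \<Rightarrow> nat" where
  "layers_size Ls = sum_list (map (\<lambda>layer. sum_list (map babp_size layer)) Ls)"

text \<open>As \<open>ps\<close> is fixed, the depths of the layers add up to a constant multiple of
  \<open>(L + 1)\<^sup>2\<close>. The exponent 5 is the 4 of \<open>bext_babp\<close> plus one for
  the up to \<open>2 ^ L\<close> gates of a layer.\<close>

lemma bext_layers:
  assumes "\<forall>p\<in>set ps. prime p"
  shows "\<exists>K. \<forall>Ls L n. layers_wf n ps Ls \<and> layers_size Ls \<le> 2 ^ L \<longrightarrow>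
    bext False n (K * (2 ^ L) ^ 5) (K * (L + 1)\<^sup>2) ((\<lambda>i xs. xs ! i) ` {..<n})
      ((\<lambda>j xs. layers_eval ps Ls xs ! j) ` {..<out_length n Ls})"
  using assms
proof (induction ps)
  case Nil
  have "bext False n (0 * (2 ^ L) ^ 5) (0 * (L + 1)\<^sup>2) ((\<lambda>i xs. xs ! i) ` {..<n})
      ((\<lambda>j xs. layers_eval [] Ls xs ! j) ` {..<out_length n Ls})"
    if "layers_wf n [] Ls" for Ls L n
    using that by (cases Ls) (auto simp: out_length_def intro!: bextI_subset)
  then show ?case by blast
next
  case (Cons p ps)
  then obtain K where K: "\<And>Ls L n. layers_wf n ps Ls \<Longrightarrow> layers_size Ls \<le> 2 ^ L \<Longrightarrow>
    bext False n (K * (2 ^ L) ^ 5) (K * (L + 1)\<^sup>2) ((\<lambda>i xs. xs ! i) ` {..<n})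
      ((\<lambda>j xs. layers_eval ps Ls xs ! j) ` {..<out_length n Ls})" by auto
  have p: "p > 0" using Cons.prems by (simp add: prime_gt_0_nat)
  define K1 where "K1 = 5 * gate_cost p"
  have "bext False n ((K + K1) * (2 ^ L) ^ 5) ((K + K1) * (L + 1)\<^sup>2) ((\<lambda>i xs. xs ! i) ` {..<n})
      ((\<lambda>j xs. layers_eval (p # ps) Ls' xs ! j) ` {..<out_length n Ls'})"
    if wf: "layers_wf n (p # ps) Ls'" and sz: "layers_size Ls' \<le> 2 ^ L" for Ls' L n
  proof -
    obtain layer Ls where Ls': "Ls' = layer # Ls" using wf by (cases Ls') auto
    have wf1: "\<forall>G\<in>set layer. babp_wf p (out_length n Ls) G" and wf2: "layers_wf n ps Ls"
      using wf by (auto simp: Ls')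
    have sz1: "sum_list (map babp_size layer) \<le> 2 ^ L" and sz2: "layers_size Ls \<le> 2 ^ L"
      using sz by (auto simp: Ls' layers_size_def)
    have szG: "babp_size G \<le> 2 ^ L" if "G \<in> set layer" for G
      using member_le_sum_list[of "babp_size G" "map babp_size layer"] that sz1 by auto
    have len: "length layer \<le> 2 ^ L"
    proof -
      have "sum_list (map (\<lambda>_. 1) layer) \<le> sum_list (map babp_size layer)"
        using wf1 by (intro sum_list_mono) (auto simp: babp_wf_def babp_size_def)
      then show ?thesis using sz1 by (simp add: sum_list_triv)
    qed
    define F where "F = (\<lambda>j xs. layers_eval ps Ls xs ! j) ` {..<out_length n Ls}"
    define fs where "fs = map (\<lambda>j xs. layers_eval ps Ls xs ! j) [0..<out_length n Ls]"
    have "bext False n (card {..<length layer} * (K1 * (2 ^ L) ^ 4)) (K1 * (L + 1)\<^sup>2) F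
        (\<Union>j\<in>{..<length layer}. {\<lambda>xs. babp_eval p (layer ! j) (map (\<lambda>f. f xs) fs)})"
    proof (rule bext_UN)
      fix j assume "j \<in> {..<length layer}"
      then have j: "layer ! j \<in> set layer" by simp
      obtain m E T where G: "layer ! j = (m, E, T)" by (cases "layer ! j") auto
      have "bext False n (5 * gate_cost p * (2 ^ L) ^ 4) (3 * gate_cost p * (L + 1)\<^sup>2) F
        {\<lambda>xs. babp_eval p (layer ! j) (map (\<lambda>f. f xs) fs)}"
        unfolding G
      proof (rule bext_babp[OF p])
        show "babp_wf p (length fs) (m, E, T)" using wf1 j G by (auto simp: fs_def)
        show "set fs \<subseteq> F" by (auto simp: fs_def F_def)
        show "m \<le> 2 ^ L" "length E \<le> 2 ^ L" using szG[OF j] by (auto simp: G babp_size_def)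
      qed
      then show "bext False n (K1 * (2 ^ L) ^ 4) (K1 * (L + 1)\<^sup>2) F
        {\<lambda>xs. babp_eval p (layer ! j) (map (\<lambda>f. f xs) fs)}"
        by (rule bext_mono) (simp_all add: K1_def)
    qed simp
    then have "bext False n (card {..<length layer} * (K1 * (2 ^ L) ^ 4)) (K1 * (L + 1)\<^sup>2) F
        ((\<lambda>j xs. layers_eval (p # ps) Ls' xs ! j) ` {..<out_length n Ls'})"
    proof (rule bext_cong)
      fix h assume "h \<in> (\<lambda>j xs. layers_eval (p # ps) Ls' xs ! j) ` {..<out_length n Ls'}"
      then obtain j where j: "j < length layer" and h: "h = (\<lambda>xs. layers_eval (p # ps) Ls' xs ! j)"
        by (auto simp: out_length_def Ls')
      have "map (\<lambda>f. f xs) fs = layers_eval ps Ls xs" if "length xs = n" for xs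
        using that length_layers_eval[OF layers_wf_length[OF wf2], of xs]
        by (intro nth_equalityI) (auto simp: fs_def)
      then have "\<forall>xs. length xs = n \<longrightarrow> babp_eval p (layer ! j) (map (\<lambda>f. f xs) fs) = h xs"
        using j by (simp add: h Ls')
      then show "\<exists>g\<in>(\<Union>j\<in>{..<length layer}. {\<lambda>xs. babp_eval p (layer ! j) (map (\<lambda>f. f xs) fs)}).
          \<forall>xs. length xs = n \<longrightarrow> g xs = h xs"
        using j by auto
    qed
    note bext_trans[OF K[OF wf2 sz2, folded F_def] this]
    then show ?thesis
    proof (rule bext_mono)
      have "length layer * (K1 * (2 ^ L) ^ 4) \<le> 2 ^ L * (K1 * (2 ^ L) ^ 4)"
        using len by (rule mult_le_mono1)
      also have "\<dots> = K1 * (2 ^ L) ^ 5" by (simp add: eval_nat_numeral)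
      finally show "K * (2 ^ L) ^ 5 + card {..<length layer} * (K1 * (2 ^ L) ^ 4)
          \<le> (K + K1) * (2 ^ L) ^ 5" by (simp add: distrib_right)
    qed (simp_all add: distrib_right)
  qed
  then show ?case by blast
qed

section \<open>From extensions to circuits: the inclusion in \<open>NC2_MON\<close>\<close>

lemma bext_from_inputs:
  assumes ext: "bext mo n s d ((\<lambda>i xs. xs ! i) ` {..<n}) G"
  shows "\<exists>gs. bgates_wf mo n gs \<and> length gs \<le> n + s \<and> (\<forall>g\<in>G. bprov n gs d g)"
proof -
  have vals: "bvals xs (map BIn [0..<k]) = map (\<lambda>i. xs ! i) [0..<k]" for xs k
    by (induction k) (simp_all add: bvals_snoc)
  have deps: "bdeps (map BIn [0..<k]) = replicate k 0" for k
    by (induction k) (simp_all add: bdeps_snoc replicate_append_same)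
  define gs where "gs = map BIn [0..<n]"
  have "bgates_wf mo n gs" by (simp add: bgates_wf_def gs_def)
  moreover have "bprov n gs 0 f" if "f \<in> (\<lambda>i xs. xs ! i) ` {..<n}" for f
  proof -
    from that obtain i where "i < n" "f = (\<lambda>xs. xs ! i)" by auto
    then show ?thesis unfolding bprov_def gs_def
      by (intro disjI2 exI[of _ i]) (simp add: vals deps)
  qed
  ultimately obtain gs' where gs': "bgates_wf mo n (gs @ gs')" "length gs' \<le> s"
    "\<forall>g\<in>G. bprov n (gs @ gs') (0 + d) g"
    using ext unfolding bext_def by blast
  then show ?thesis by (intro exI[of _ "gs @ gs'"]) (simp add: gs_def)
qed

text \<open>For a constant function \<open>bprov\<close> promises no gate at all, hence the second
  assumption; the constant case falls to \<open>constant_circuit\<close>.\<close>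

lemma top_circuit_exists:
  assumes ext: "bext False N s d ((\<lambda>i xs. xs ! i) ` {..<N}) {f}"
    and nonconst: "\<not> (\<exists>b. \<forall>xs. length xs = N \<longrightarrow> f xs = b)"
  shows "\<exists>gs. bcirc_wf False N gs \<and> length gs \<le> N + s \<and> bcirc_depth gs \<le> d \<and>
    (\<forall>xs. length xs = N \<longrightarrow> bcirc_eval xs gs = f xs)"
proof -
  obtain gs where gs: "bgates_wf False N gs" "length gs \<le> N + s" "bprov N gs d f"
    using bext_from_inputs[OF ext] by blast
  then obtain j where j: "j < length gs" "bdeps gs ! j \<le> d"
    "\<forall>xs. length xs = N \<longrightarrow> bvals xs gs ! j = f xs"
    using nonconst unfolding bprov_def by auto
  show ?thesis
  proof (intro exI[of _ "take (Suc j) gs"] conjI allI impI)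
    show "bcirc_wf False N (take (Suc j) gs)"
      using gs j unfolding bcirc_wf_alt by (intro conjI bgates_wf_take) auto
    show "length (take (Suc j) gs) \<le> N + s" using gs(2) by simp
    show "bcirc_depth (take (Suc j) gs) \<le> d" using j by (simp only: bcirc_depth_take)
    show "bcirc_eval xs (take (Suc j) gs) = f xs" if "length xs = N" for xs
      using j that by (simp only: bcirc_eval_take)
  qed
qed

text \<open>In the absence of constant gates, a bit is joined with its own negation by disjunction
  or conjunction.\<close>

lemma constant_circuit:
  "\<exists>gs. bcirc_wf False 1 gs \<and> bcirc_size gs \<le> 9 \<and> bcirc_depth gs \<le> 2 \<and>
    (\<forall>xs. bcirc_eval xs gs = b)"
proof -
  let ?gs = "[BIn 0, BNot 0, if b then BOr 0 1 else BAnd 0 1]"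
  have "bcirc_wf False 1 ?gs" by (simp add: bcirc_wf_def All_less_Suc)
  moreover have "bcirc_size ?gs \<le> 9" using bcirc_size_le[of ?gs] by simp
  moreover have "bcirc_depth ?gs \<le> 2" by (simp add: bcirc_depth_def)
  moreover have "\<forall>xs. bcirc_eval xs ?gs = b" by (simp add: bcirc_eval_def)
  ultimately show ?thesis by blast
qed

lemma nuItDet_MON_subset_NC2_MON: "nuItDet_MON \<subseteq> NC2_MON"
proof
  fix La assume "La \<in> nuItDet_MON"
  then obtain ps c k where ne: "ps \<noteq> []" and pr: "\<forall>p\<in>set ps. prime p"
    and circ: "\<And>n. n \<ge> 1 \<Longrightarrow> \<exists>Ls Ms. itdet_wf ps n Ls Ms \<and> itdet_size Ls Ms \<le> c * n ^ k + c \<and>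
        (\<forall>w. length w = n \<longrightarrow> (w \<in> La \<longleftrightarrow> itdet_eval ps Ls Ms w))"
    unfolding nuItDet_MON_def by auto
  obtain K where K: "\<And>Ls L n. layers_wf n ps Ls \<Longrightarrow> layers_size Ls \<le> 2 ^ L \<Longrightarrow>
    bext False n (K * (2 ^ L) ^ 5) (K * (L + 1)\<^sup>2) ((\<lambda>i xs. xs ! i) ` {..<n})
      ((\<lambda>j xs. layers_eval ps Ls xs ! j) ` {..<out_length n Ls})"
    using bext_layers[OF pr] by blast
  \<comment> \<open>The increment keeps the size bound \<open>S\<close> below positive, so that its
    logarithm is not negative.\<close>
  define c' where "c' = c + 1"
  \<comment> \<open>The top circuit has at most \<open>S + K * (2 * S) ^ 5\<close> gates. Passing
    from gates to size triples this and the monotone circuits add \<open>S\<close>, in total at most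
    \<open>(4 + 96 * K) * S ^ 5\<close>, where \<open>S \<le> 2 * c' * n ^ k\<close>. The 10 covers
    the constant circuit with its dummy input.\<close>
  define C1 where "C1 = 10 + (4 + 96 * K) * (2 * c') ^ 5"
  \<comment> \<open>\<open>L\<close> will be the logarithm of \<open>S\<close> rounded up. The 2
    pays for the rounding and for the increment in \<open>L + 1\<close>, so that
    \<open>L + 1 \<le> a + k * log 2 n\<close>. Squaring this by
    \<open>(x + y)^2 \<le> 2 * x^2 + 2 * y^2\<close> leads to the two terms of
    \<open>C2\<close>.\<close>
  define a where "a = log 2 (2 * real c') + 2"
  define C2 where "C2 = nat \<lceil>2 * real K * a\<^sup>2 + 2 * real K * (real k)\<^sup>2\<rceil> + 2"
  have c'1: "c' \<ge> 1" by (simp add: c'_def)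
  have a0: "a \<ge> 0" using c'1 by (simp add: a_def)
  have "\<exists>Ms top. (\<forall>M \<in> set Ms. bcirc_wf True n M) \<and> bcirc_wf False (length Ms) top \<and>
      bcirc_size top + sum_list (map bcirc_size Ms) \<le> (C1 + C2) * n ^ (5 * k) + (C1 + C2) \<and>
      real (bcirc_depth top) \<le> real (C1 + C2) * (log 2 (real n))\<^sup>2 + real (C1 + C2) \<and>
      (\<forall>w. length w = n \<longrightarrow> (w \<in> La \<longleftrightarrow> bcirc_eval (map (\<lambda>M. bcirc_eval w M) Ms) top))"
    if n1: "n \<ge> 1" for n
  proof -
    obtain Ls Ms where wf: "itdet_wf ps n Ls Ms" and sz: "itdet_size Ls Ms \<le> c * n ^ k + c"
      and ev: "\<And>w. length w = n \<Longrightarrow> (w \<in> La \<longleftrightarrow> itdet_eval ps Ls Ms w)"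
      using circ[OF n1] by auto
    define f where "f xs = hd (layers_eval ps Ls xs)" for xs
    have ev': "itdet_eval ps Ls Ms w = f (map (bcirc_eval w) Ms)" for w
      by (simp add: itdet_eval_def f_def layers_eval_def)
    have wfM: "\<forall>M\<in>set Ms. bcirc_wf True n M" and lwf: "layers_wf (length Ms) ps Ls"
      and l1: "length (hd Ls) = 1" using wf unfolding itdet_wf_def layers_wf_iff by blast+
    have Lsne: "Ls \<noteq> []" using ne layers_wf_length[OF lwf] by auto
    show ?thesis
    proof (cases "\<exists>b. \<forall>xs. length xs = length Ms \<longrightarrow> f xs = b")
      case True
      then obtain b where b: "\<And>xs. length xs = length Ms \<Longrightarrow> f xs = b" by blast
      obtain gs where gs: "bcirc_wf False 1 gs" "bcirc_size gs \<le> 9" "bcirc_depth gs \<le> 2"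
        "\<And>xs. bcirc_eval xs gs = b" using constant_circuit by blast
      \<comment> \<open>The circuit for a constant still reads one input; bit 0 exists because
        \<open>n \<ge> 1\<close> and counts as a monotone circuit.\<close>
      show ?thesis
      proof (intro exI[of _ "[[BIn 0]]"] exI[of _ gs] conjI)
        show "\<forall>M\<in>set [[BIn 0]]. bcirc_wf True n M" using n1 by (simp add: bcirc_wf_def)
        show "bcirc_wf False (length [[BIn 0]]) gs" using gs by simp
        show "bcirc_size gs + sum_list (map bcirc_size [[BIn 0]]) \<le> (C1 + C2) * n ^ (5 * k) + (C1 + C2)"
          using gs(2) by (simp add: bcirc_size_def C1_def trans_le_add2)
        have "bcirc_depth gs \<le> C1 + C2" using gs(3) by (simp add: C1_def)
        then have "real (bcirc_depth gs) \<le> real (C1 + C2)" by (simp only: of_nat_le_iff)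
        moreover have "0 \<le> real (C1 + C2) * (log 2 (real n))\<^sup>2" by simp
        ultimately show "real (bcirc_depth gs) \<le> real (C1 + C2) * (log 2 (real n))\<^sup>2 + real (C1 + C2)"
          by linarith
        show "\<forall>w. length w = n \<longrightarrow> (w \<in> La) = bcirc_eval (map (bcirc_eval w) [[BIn 0]]) gs"
          using ev ev' b gs(4) by simp
      qed
    next
      case False
      define S where "S = c' * n ^ k + c'"
      have S1: "S \<ge> 1" using c'1 by (simp add: S_def)
      have szS: "itdet_size Ls Ms \<le> S"
        using sz by (simp add: S_def c'_def)
      define L where "L = nat \<lceil>log 2 (real S)\<rceil>"
      have logS: "log 2 (real S) \<ge> 0" using S1 by simp
      have L_ge: "log 2 (real S) \<le> real L" and L_le: "real L \<le> log 2 (real S) + 1"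
        using logS unfolding L_def by linarith+
      have SL: "S \<le> 2 ^ L"
      proof -
        have "real S = 2 powr log 2 (real S)" using S1 by simp
        also have "\<dots> \<le> 2 powr real L" using L_ge by simp
        finally have "real S \<le> real (2 ^ L)" by (simp add: powr_realpow)
        then show ?thesis by (simp only: of_nat_le_iff)
      qed
      have LS: "2 ^ L \<le> 2 * S"
      proof -
        have "2 powr real L \<le> 2 powr (log 2 (real S) + 1)" using L_le by simp
        also have "\<dots> = 2 * real S" using S1 by (simp add: powr_add)
        finally have "real (2 ^ L) \<le> real (2 * S)" by (simp add: powr_realpow)
        then show ?thesis by (simp only: of_nat_le_iff)
      qed
      have lsz: "layers_size Ls \<le> 2 ^ L" and Msz: "sum_list (map bcirc_size Ms) \<le> S"
        using szS SL by (auto simp: itdet_size_def layers_size_def)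
      have lenM: "length Ms \<le> S"
      proof -
        have "sum_list (map (\<lambda>_. 1) Ms) \<le> sum_list (map bcirc_size Ms)"
          using wfM by (intro sum_list_mono) (auto simp: bcirc_wf_def bcirc_size_def Suc_le_eq)
        then show ?thesis using Msz by (simp add: sum_list_triv)
      qed
      have fe: "bext False (length Ms) (K * (2 ^ L) ^ 5) (K * (L + 1)\<^sup>2)
          ((\<lambda>i xs. xs ! i) ` {..<length Ms}) {f}"
      proof (rule bext_cong[OF K[OF lwf lsz]])
        fix h assume h: "h \<in> {f}"
        have "layers_eval ps Ls xs ! 0 = h xs" if "length xs = length Ms" for xs
        proof -
          have "length (layers_eval ps Ls xs) = 1"
            using length_layers_eval[OF layers_wf_length[OF lwf]] Lsne l1 by (simp add: out_length_def)
          then have "layers_eval ps Ls xs \<noteq> []" by auto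
          then show ?thesis using h by (simp add: f_def hd_conv_nth)
        qed
        then show "\<exists>g\<in>(\<lambda>j xs. layers_eval ps Ls xs ! j) ` {..<out_length (length Ms) Ls}.
            \<forall>xs. length xs = length Ms \<longrightarrow> g xs = h xs"
          using Lsne l1 by (auto simp: out_length_def)
      qed
      obtain gs where gs: "bcirc_wf False (length Ms) gs"
        "length gs \<le> length Ms + K * (2 ^ L) ^ 5" "bcirc_depth gs \<le> K * (L + 1)\<^sup>2"
        "\<And>xs. length xs = length Ms \<Longrightarrow> bcirc_eval xs gs = f xs"
        using top_circuit_exists[OF fe False] by blast
      show ?thesis
      proof (intro exI[of _ Ms] exI[of _ gs] conjI)
        show "\<forall>M\<in>set Ms. bcirc_wf True n M" by (rule wfM)
        show "bcirc_wf False (length Ms) gs" by (rule gs)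
        have nk: "1 \<le> n ^ k" using n1 by simp
        have S5: "S ^ 5 \<le> (2 * c') ^ 5 * n ^ (5 * k)"
        proof -
          have "S \<le> 2 * c' * n ^ k" using nk c'1 by (simp add: S_def)
          then have "S ^ 5 \<le> (2 * c' * n ^ k) ^ 5" by (rule power_mono) simp
          moreover have "(n ^ k) ^ 5 = n ^ (5 * k)" unfolding power_mult[symmetric] mult.commute[of 5] ..
          ultimately show ?thesis by (simp only: power_mult_distrib)
        qed
        have "S * 1 \<le> S * S ^ 4" using S1 by (intro mult_le_mono2) simp
        then have SS: "S \<le> S ^ 5" by (simp add: eval_nat_numeral)
        have "(2 ^ L) ^ 5 \<le> (2 * S) ^ 5" using LS by (rule power_mono) simp
        then have "K * (2 ^ L) ^ 5 \<le> K * (32 * S ^ 5)"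
          by (intro mult_le_mono2) (simp add: power_mult_distrib)
        with lenM have "length Ms + K * (2 ^ L) ^ 5 \<le> S + K * (32 * S ^ 5)" by (rule add_mono)
        with gs(2) have "length gs \<le> S + K * (32 * S ^ 5)" by (rule le_trans)
        then have "3 * length gs \<le> 3 * (S + K * (32 * S ^ 5))" by (rule mult_le_mono2)
        with bcirc_size_le[of gs] have "bcirc_size gs \<le> 3 * (S + K * (32 * S ^ 5))"
          by (rule le_trans)
        then have "bcirc_size gs + sum_list (map bcirc_size Ms) \<le> (4 + 96 * K) * S ^ 5"
          using Msz SS by (simp add: algebra_simps)
        also have "\<dots> \<le> (4 + 96 * K) * ((2 * c') ^ 5 * n ^ (5 * k))"
          using S5 by (rule mult_le_mono2)
        also have "\<dots> = (4 + 96 * K) * (2 * c') ^ 5 * n ^ (5 * k)" by (simp only: mult.assoc)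
        also have "\<dots> \<le> (C1 + C2) * n ^ (5 * k)"
          by (rule mult_le_mono1) (simp add: C1_def)
        finally show "bcirc_size gs + sum_list (map bcirc_size Ms) \<le> (C1 + C2) * n ^ (5 * k) + (C1 + C2)"
          by simp
        define x where "x = log 2 (real n)"
        have x0: "x \<ge> 0" using n1 by (simp add: x_def)
        have "real S \<le> 2 * real c' * real n ^ k"
        proof -
          have "S \<le> 2 * c' * n ^ k" using nk c'1 by (simp add: S_def)
          then have "real S \<le> real (2 * c' * n ^ k)" by (simp only: of_nat_le_iff)
          then show ?thesis by simp
        qed
        then have "log 2 (real S) \<le> log 2 (2 * real c' * real n ^ k)"
          using S1 by (intro log_mono) auto
        also have "\<dots> = log 2 (2 * real c') + real k * x"
          using c'1 n1 by (subst log_mult) (auto simp: log_nat_power x_def)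
        finally have "real (L + 1) \<le> a + real k * x" using L_le by (simp add: a_def)
        then have "(real (L + 1))\<^sup>2 \<le> (a + real k * x)\<^sup>2" by (rule power_mono) simp
        also have "\<dots> \<le> 2 * a\<^sup>2 + 2 * (real k * x)\<^sup>2"
          using sum_squares_bound[of a "real k * x"] by (simp add: power2_sum)
        finally have L2: "(real (L + 1))\<^sup>2 \<le> 2 * a\<^sup>2 + 2 * (real k * x)\<^sup>2" .
        have "real (bcirc_depth gs) \<le> real (K * (L + 1)\<^sup>2)" using gs(3) by (simp only: of_nat_le_iff)
        also have "\<dots> = real K * (real (L + 1))\<^sup>2" by simp
        also have "\<dots> \<le> real K * (2 * a\<^sup>2 + 2 * (real k * x)\<^sup>2)"
          using L2 by (rule mult_left_mono) simp
        also have "\<dots> = 2 * real K * (real k)\<^sup>2 * x\<^sup>2 + 2 * real K * a\<^sup>2"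
          by (simp add: algebra_simps power_mult_distrib)
        also have "\<dots> \<le> real C2 * x\<^sup>2 + real C2"
        proof -
          have "2 * real K * a\<^sup>2 + 2 * real K * (real k)\<^sup>2 \<le> real C2"
            unfolding C2_def by linarith
          moreover have "0 \<le> 2 * real K * a\<^sup>2" "0 \<le> 2 * real K * (real k)\<^sup>2" by simp_all
          ultimately have "2 * real K * a\<^sup>2 \<le> real C2" "2 * real K * (real k)\<^sup>2 \<le> real C2"
            by linarith+
          then show ?thesis by (intro add_mono mult_right_mono) auto
        qed
        also have "\<dots> \<le> real (C1 + C2) * x\<^sup>2 + real (C1 + C2)"
          by (intro add_mono mult_right_mono) auto
        finally show "real (bcirc_depth gs) \<le> real (C1 + C2) * (log 2 (real n))\<^sup>2 + real (C1 + C2)"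
          by (simp add: x_def)
        show "\<forall>w. length w = n \<longrightarrow> (w \<in> La) = bcirc_eval (map (bcirc_eval w) Ms) gs"
          using ev ev' gs(4) by simp
      qed
    qed
  qed
  then show "La \<in> NC2_MON" unfolding NC2_MON_def by blast
qed

section \<open>Extending branching programs\<close>

text \<open>An old vertex is entered by old edges only, so by \<open>pv_rec\<close> its value cannot
  change.\<close>

lemma pv_append:
  assumes "forward (E @ E')" "\<forall>a b l. (a, b, l) \<in> set E' \<longrightarrow> m \<le> b" "v < m"
  shows "pv (E @ E') z v = pv E z v"
  using assms(3)
proof (induction v rule: less_induct)
  case (less v)
  have fE: "forward E" using assms(1) by (auto simp: forward_def)
  have 1: "(\<Sum>(a, b, l) \<leftarrow> E. if b = v then pv (E @ E') z a * label_val z l else 0) =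
     (\<Sum>(a, b, l) \<leftarrow> E. if b = v then pv E z a * label_val z l else 0)"
  proof (intro arg_cong[of _ _ sum_list] map_cong refl, clarify)
    fix a b l assume "(a, b, l) \<in> set E"
    then have "a < b" using fE forwardD by blast
    then show "(if b = v then pv (E @ E') z a * label_val z l else 0) =
      (if b = v then pv E z a * label_val z l else 0)" using less by auto
  qed
  have "map (\<lambda>(a, b, l). if b = v then pv (E @ E') z a * label_val z l else 0) E' = map (\<lambda>_. 0) E'"
    using assms(2) less.prems by (intro map_cong) fastforce+
  then have 2: "(\<Sum>(a, b, l) \<leftarrow> E'. if b = v then pv (E @ E') z a * label_val z l else 0) =
     sum_list (map (\<lambda>_. 0) E')" by (rule arg_cong)
  show ?case unfolding pv_rec[OF assms(1), of z v] pv_rec[OF fE, of z v] map_append sum_list_append 1 2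
    by simp
qed

definition abp_wf :: "nat \<Rightarrow> nat \<Rightarrow> nat \<Rightarrow> (nat \<times> nat \<times> ablabel) list \<Rightarrow> bool" where
  "abp_wf p k m E \<longleftrightarrow> babp_wf p k (m, E, {})"

lemma abp_wf_forward: "abp_wf p k m E \<Longrightarrow> forward E"
  by (auto simp: abp_wf_def babp_wf_def forward_def)

text \<open>The inputs of the program are the values of the Boolean functions \<open>fs\<close> (the outputs of
  the layer below) at a word \<open>w \<in> D\<close>.\<close>
definition aprov :: "nat \<Rightarrow> 'w set \<Rightarrow> ('w \<Rightarrow> bool) list \<Rightarrow> nat \<Rightarrow> (nat \<times> nat \<times> ablabel) list \<Rightarrow>
    ('w \<Rightarrow> int) \<Rightarrow> bool" where
  "aprov p D fs m E \<psi> \<longleftrightarrow> (\<exists>v<m. \<forall>w\<in>D. [pv E (map (\<lambda>f. f w) fs) v = \<psi> w] (mod int p))"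

definition aext :: "nat \<Rightarrow> nat \<Rightarrow> nat \<Rightarrow> nat \<Rightarrow> (nat \<times> nat \<times> ablabel) list \<Rightarrow>
    nat \<Rightarrow> (nat \<times> nat \<times> ablabel) list \<Rightarrow> bool" where
  "aext p k s m E m' E' \<longleftrightarrow> m \<le> m' \<and> abp_wf p k m' (E @ E') \<and>
     (\<forall>a b l. (a, b, l) \<in> set E' \<longrightarrow> m \<le> b) \<and> (m' - m) + length E' \<le> s"

lemma aprov_aext:
  assumes "aprov p D fs m E \<psi>" "aext p k s m E m' E'"
  shows "aprov p D fs m' (E @ E') \<psi>"
proof -
  from assms(1) obtain v where v: "v < m" "\<forall>w\<in>D. [pv E (map (\<lambda>f. f w) fs) v = \<psi> w] (mod int p)"
    unfolding aprov_def by blast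
  have e: "m \<le> m'" "forward (E @ E')" "\<forall>a b l. (a, b, l) \<in> set E' \<longrightarrow> m \<le> b"
    using assms(2) abp_wf_forward unfolding aext_def by blast+
  show ?thesis unfolding aprov_def
    using v e pv_append[OF e(2,3) v(1)] by (intro exI[of _ v]) auto
qed

lemma aext_trans:
  assumes "aext p k s m E m' E'" "aext p k s' m' (E @ E') m'' E''"
  shows "aext p k (s + s') m E m'' (E' @ E'')"
  using assms unfolding aext_def by (auto, blast intro: order.trans)

text \<open>Branching programs are linear in the value of the source, so a computation of \<open>\<Psi>\<close>
  may be started at any vertex; this makes products sequential compositions.\<close>
definition acomp :: "nat \<Rightarrow> 'w set \<Rightarrow> ('w \<Rightarrow> bool) list \<Rightarrow> nat \<Rightarrow> ('w \<Rightarrow> int) set \<Rightarrow> bool" where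
  "acomp p D fs s \<Psi> \<longleftrightarrow> (\<forall>m E \<phi>. abp_wf p (length fs) m E \<and> aprov p D fs m E \<phi> \<longrightarrow>
     (\<exists>m' E'. aext p (length fs) s m E m' E' \<and>
       (\<forall>\<psi>\<in>\<Psi>. aprov p D fs m' (E @ E') (\<lambda>w. \<phi> w * \<psi> w))))"

lemma acompD:
  assumes "acomp p D fs s \<Psi>" "abp_wf p (length fs) m E" "aprov p D fs m E \<phi>"
  obtains m' E' where "aext p (length fs) s m E m' E'" "abp_wf p (length fs) m' (E @ E')"
    "\<And>\<psi>. \<psi> \<in> \<Psi> \<Longrightarrow> aprov p D fs m' (E @ E') (\<lambda>w. \<phi> w * \<psi> w)"
  using assms unfolding acomp_def aext_def by meson

lemma acomp_mono: "acomp p D fs s \<Psi> \<Longrightarrow> s \<le> s' \<Longrightarrow> \<Psi>' \<subseteq> \<Psi> \<Longrightarrow> acomp p D fs s' \<Psi>'"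
  unfolding acomp_def aext_def by (meson le_trans subsetD)

lemma aprov_cong:
  "aprov p D fs m E \<psi> \<Longrightarrow> (\<And>w. w \<in> D \<Longrightarrow> [\<psi> w = \<psi>' w] (mod int p)) \<Longrightarrow> aprov p D fs m E \<psi>'"
  unfolding aprov_def by (meson cong_trans)

lemma acomp_cong:
  assumes "acomp p D fs s \<Psi>" "\<And>\<psi>'. \<psi>' \<in> \<Psi>' \<Longrightarrow> \<exists>\<psi>\<in>\<Psi>. \<forall>w\<in>D. [\<psi> w = \<psi>' w] (mod int p)"
  shows "acomp p D fs s \<Psi>'"
  unfolding acomp_def
proof (intro allI impI)
  fix m E \<phi> assume "abp_wf p (length fs) m E \<and> aprov p D fs m E \<phi>"
  then obtain m' E' where e: "aext p (length fs) s m E m' E'"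
    "\<And>\<psi>. \<psi> \<in> \<Psi> \<Longrightarrow> aprov p D fs m' (E @ E') (\<lambda>w. \<phi> w * \<psi> w)" using acompD[OF assms(1)] by metis
  have "aprov p D fs m' (E @ E') (\<lambda>w. \<phi> w * \<psi>' w)" if psi': "\<psi>' \<in> \<Psi>'" for \<psi>'
  proof -
    obtain \<psi> where "\<psi> \<in> \<Psi>" "\<forall>w\<in>D. [\<psi> w = \<psi>' w] (mod int p)" using assms(2)[OF psi'] by blast
    then show ?thesis using aprov_cong[OF e(2)] by (meson cong_scalar_left)
  qed
  with e(1) show "\<exists>m' E'. aext p (length fs) s m E m' E' \<and>
       (\<forall>\<psi>\<in>\<Psi>'. aprov p D fs m' (E @ E') (\<lambda>w. \<phi> w * \<psi> w))" by blast
qed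

lemma acomp_one: "acomp p D fs 0 {\<lambda>w. 1}"
  unfolding acomp_def aext_def by (auto intro!: exI[of _ "[]"])

text \<open>The elementary construction step: a fresh vertex receives a linear combination of old
  values with labels as coefficients. Products of computed values cannot be formed this way; they
  come from \<open>acomp_seq\<close>.\<close>

lemma aext_vertex:
  assumes wf: "abp_wf p k m E" and vs: "\<forall>(v, l)\<in>set vs. v < m \<and>
      (case l of LV i \<Rightarrow> i < k | LC c \<Rightarrow> 0 \<le> c \<and> c < int p)"
  defines "E' \<equiv> map (\<lambda>(v, l). (v, m, l)) vs"
  shows "aext p k (1 + length vs) m E (Suc m) E'"
    and "pv (E @ E') z m = (\<Sum>(v, l)\<leftarrow>vs. pv E z v * label_val z l)"
proof -
  have wf': "abp_wf p k (Suc m) (E @ E')"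
    using wf vs by (force simp: abp_wf_def babp_wf_def E'_def)
  then show "aext p k (1 + length vs) m E (Suc m) E'"
    by (auto simp: aext_def E'_def)
  have fwd: "forward (E @ E')" using abp_wf_forward[OF wf'] .
  have m0: "m > 0" using wf by (auto simp: abp_wf_def babp_wf_def)
  have "map (\<lambda>(a, b, l). if b = m then pv (E @ E') z a * label_val z l else 0) E = map (\<lambda>_. 0) E"
    using wf by (intro map_cong) (fastforce simp: abp_wf_def babp_wf_def)+
  then have 1: "(\<Sum>(a, b, l) \<leftarrow> E. if b = m then pv (E @ E') z a * label_val z l else 0) =
     sum_list (map (\<lambda>_. 0) E)" by (rule arg_cong)
  have bd: "\<forall>a b l. (a, b, l) \<in> set E' \<longrightarrow> m \<le> b" by (auto simp: E'_def)
  have 2: "(\<Sum>(a, b, l) \<leftarrow> E'. if b = m then pv (E @ E') z a * label_val z l else 0) =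
     (\<Sum>(v, l)\<leftarrow>vs. pv E z v * label_val z l)"
    unfolding E'_def map_map
  proof (intro arg_cong[of _ _ sum_list] map_cong refl, clarify)
    fix v l assume "(v, l) \<in> set vs"
    then have "v < m" using vs by auto
    then show "((\<lambda>(a, b, l). if b = m then pv (E @ map (\<lambda>(v, l). (v, m, l)) vs) z a * label_val z l
       else 0) \<circ> (\<lambda>(v, l). (v, m, l))) (v, l) = pv E z v * label_val z l"
      using pv_append[OF fwd bd, of v z] by (simp add: E'_def)
  qed
  show "pv (E @ E') z m = (\<Sum>(v, l)\<leftarrow>vs. pv E z v * label_val z l)"
    unfolding pv_rec[OF fwd, of z m] map_append sum_list_append 1 2 using m0 by simp
qed

lemma acomp_label:
  assumes "case l of LV i \<Rightarrow> i < length fs | LC c \<Rightarrow> 0 \<le> c \<and> c < int p"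
  shows "acomp p D fs 2 {\<lambda>w. label_val (map (\<lambda>f. f w) fs) l}"
  unfolding acomp_def
proof (intro allI impI)
  fix m E \<phi> assume a: "abp_wf p (length fs) m E \<and> aprov p D fs m E \<phi>"
  then obtain v where v: "v < m" "\<forall>w\<in>D. [pv E (map (\<lambda>f. f w) fs) v = \<phi> w] (mod int p)"
    unfolding aprov_def by blast
  have vs: "\<forall>(v, l)\<in>set [(v, l)]. v < m \<and>
      (case l of LV i \<Rightarrow> i < length fs | LC c \<Rightarrow> 0 \<le> c \<and> c < int p)" using v assms by simp
  note e = aext_vertex[OF conjunct1[OF a] vs]
  have "aprov p D fs (Suc m) (E @ [(v, m, l)]) (\<lambda>w. \<phi> w * label_val (map (\<lambda>f. f w) fs) l)"
    unfolding aprov_def using v e(2) by (intro exI[of _ m]) (simp add: cong_scalar_right)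
  then show "\<exists>m' E'. aext p (length fs) 2 m E m' E' \<and>
       (\<forall>\<psi>\<in>{\<lambda>w. label_val (map (\<lambda>f. f w) fs) l}. aprov p D fs m' (E @ E') (\<lambda>w. \<phi> w * \<psi> w))"
    using e(1) by (intro exI[of _ "Suc m"] exI[of _ "[(v, m, l)]"]) (simp add: numeral_2_eq_2)
qed

text \<open>The second computation is started at the vertex holding the first factor.
  \<open>\<Psi>\<close> is kept besides the products, because later terms of a recurrence branch off
  from the same stored values.\<close>

lemma acomp_seq:
  assumes "acomp p D fs s \<Psi>" "\<psi> \<in> \<Psi>" "acomp p D fs s' \<Psi>'"
  shows "acomp p D fs (s + s') (\<Psi> \<union> (\<lambda>\<psi>' w. \<psi> w * \<psi>' w) ` \<Psi>')"
  unfolding acomp_def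
proof (intro allI impI)
  fix m E \<phi> assume a: "abp_wf p (length fs) m E \<and> aprov p D fs m E \<phi>"
  then obtain m' E' where e: "aext p (length fs) s m E m' E'"
    "abp_wf p (length fs) m' (E @ E')"
    "\<And>\<psi>. \<psi> \<in> \<Psi> \<Longrightarrow> aprov p D fs m' (E @ E') (\<lambda>w. \<phi> w * \<psi> w)" using acompD[OF assms(1)] by metis
  obtain m'' E'' where e': "aext p (length fs) s' m' (E @ E') m'' E''"
    "\<And>\<psi>'. \<psi>' \<in> \<Psi>' \<Longrightarrow> aprov p D fs m'' ((E @ E') @ E'') (\<lambda>w. \<phi> w * \<psi> w * \<psi>' w)"
    using acompD[OF assms(3) e(2) e(3)[OF assms(2)]] by metis
  have "aprov p D fs m'' (E @ (E' @ E'')) (\<lambda>w. \<phi> w * \<chi> w)"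
    if "\<chi> \<in> \<Psi> \<union> (\<lambda>\<psi>' w. \<psi> w * \<psi>' w) ` \<Psi>'" for \<chi>
    using that e' aprov_aext[OF e(3) e'(1)] by (auto simp: mult.assoc)
  then show "\<exists>m' E'. aext p (length fs) (s + s') m E m' E' \<and>
       (\<forall>\<chi>\<in>\<Psi> \<union> (\<lambda>\<psi>' w. \<psi> w * \<psi>' w) ` \<Psi>'. aprov p D fs m' (E @ E') (\<lambda>w. \<phi> w * \<chi> w))"
    using aext_trans[OF e(1) e'(1)] by blast
qed

text \<open>One vertex and two edges labelled 1 account for the cost 3; \<open>p > 1\<close> makes 1
  an admissible label.\<close>

lemma acomp_add:
  assumes "acomp p D fs s \<Psi>" "\<psi>1 \<in> \<Psi>" "\<psi>2 \<in> \<Psi>" "p > 1"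
  shows "acomp p D fs (s + 3) (insert (\<lambda>w. \<psi>1 w + \<psi>2 w) \<Psi>)"
  unfolding acomp_def
proof (intro allI impI)
  fix m0 E0 \<phi> assume "abp_wf p (length fs) m0 E0 \<and> aprov p D fs m0 E0 \<phi>"
  then obtain m E' where e: "aext p (length fs) s m0 E0 m E'"
    "abp_wf p (length fs) m (E0 @ E')"
    "\<And>\<psi>. \<psi> \<in> \<Psi> \<Longrightarrow> aprov p D fs m (E0 @ E') (\<lambda>w. \<phi> w * \<psi> w)" using acompD[OF assms(1)] by metis
  define E where "E = E0 @ E'"
  obtain u v where u: "u < m" "\<forall>w\<in>D. [pv E (map (\<lambda>f. f w) fs) u = \<phi> w * \<psi>1 w] (mod int p)"
    and v: "v < m" "\<forall>w\<in>D. [pv E (map (\<lambda>f. f w) fs) v = \<phi> w * \<psi>2 w] (mod int p)"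
    using e(3)[OF assms(2)] e(3)[OF assms(3)] unfolding aprov_def E_def by blast
  let ?vs = "[(u, LC 1), (v, LC 1)]"
  have vs: "\<forall>(v, l)\<in>set ?vs. v < m \<and>
      (case l of LV i \<Rightarrow> i < length fs | LC c \<Rightarrow> 0 \<le> c \<and> c < int p)" using u v assms(4) by simp
  note x = aext_vertex[OF e(2)[folded E_def] vs]
  let ?E'' = "[(u, m, LC 1), (v, m, LC 1)]"
  have x1: "aext p (length fs) 3 m E (Suc m) ?E''" using x(1) by (simp add: eval_nat_numeral)
  have "aprov p D fs (Suc m) (E @ ?E'') (\<lambda>w. \<phi> w * (\<psi>1 w + \<psi>2 w))"
    unfolding aprov_def using u v x(2) by (intro exI[of _ m]) (simp add: cong_add distrib_left)
  moreover have "aprov p D fs (Suc m) (E @ ?E'') (\<lambda>w. \<phi> w * \<psi> w)" if "\<psi> \<in> \<Psi>" for \<psi>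
    using aprov_aext[OF e(3)[OF that, folded E_def] x1] .
  ultimately show "\<exists>m' E'. aext p (length fs) (s + 3) m0 E0 m' E' \<and>
       (\<forall>\<chi>\<in>insert (\<lambda>w. \<psi>1 w + \<psi>2 w) \<Psi>. aprov p D fs m' (E0 @ E') (\<lambda>w. \<phi> w * \<chi> w))"
    using aext_trans[OF e(1) x1[unfolded E_def]]
    by (intro exI[of _ "Suc m"] exI[of _ "E' @ ?E''"]) (auto simp: E_def)
qed

lemma acomp_mult:
  assumes "acomp p D fs s {\<psi>}" "acomp p D fs s' {\<psi>'}"
  shows "acomp p D fs (s + s') {\<lambda>w. \<psi> w * \<psi>' w}"
  by (rule acomp_mono[OF acomp_seq[OF assms(1) singletonI assms(2)]]) auto

text \<open>Both computations are attached to the vertex that holds the constant function 1, so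
  neither multiplies the other.\<close>

lemma acomp_Un:
  assumes "acomp p D fs s \<Psi>" "acomp p D fs s' \<Psi>'"
  shows "acomp p D fs (s + s') (\<Psi> \<union> \<Psi>')"
proof -
  have 1: "acomp p D fs (0 + s) ({\<lambda>w. 1} \<union> (\<lambda>\<psi>' w. 1 * \<psi>' w) ` \<Psi>)"
    by (rule acomp_seq[OF acomp_one singletonI assms(1)])
  have "acomp p D fs (0 + s + s') (({\<lambda>w. 1} \<union> (\<lambda>\<psi>' w. 1 * \<psi>' w) ` \<Psi>) \<union> (\<lambda>\<psi>' w. 1 * \<psi>' w) ` \<Psi>')"
    by (rule acomp_seq[OF 1 _ assms(2)]) simp
  then show ?thesis by (rule acomp_mono) auto
qed

lemma acomp_plus:
  assumes "acomp p D fs s {\<psi>}" "acomp p D fs s' {\<psi>'}" "p > 1"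
  shows "acomp p D fs (s + s' + 3) {\<lambda>w. \<psi> w + \<psi>' w}"
  by (rule acomp_mono[OF acomp_add[OF acomp_Un[OF assms(1,2)] _ _ assms(3), of \<psi> \<psi>']]) auto

lemma acomp_const:
  assumes "p > 1"
  shows "acomp p D fs 2 {\<lambda>w. c}"
proof -
  have "acomp p D fs 2 {\<lambda>w. label_val (map (\<lambda>f. f w) fs) (LC (c mod int p))}"
    using assms by (intro acomp_label) simp
  then show ?thesis by (rule acomp_cong) (simp add: cong_def)
qed

lemma acomp_var:
  assumes "f \<in> set fs"
  shows "acomp p D fs 2 {\<lambda>w. of_bool (f w)}"
proof -
  from assms obtain i where i: "i < length fs" "fs ! i = f" by (auto simp: in_set_conv_nth)
  have "acomp p D fs 2 {\<lambda>w. label_val (map (\<lambda>f. f w) fs) (LV i)}"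
    using i by (intro acomp_label) simp
  with i show ?thesis by simp
qed

lemma acomp_sum:
  assumes "finite I" "\<And>i. i \<in> I \<Longrightarrow> acomp p D fs s {\<psi> i}" "p > 1"
  shows "acomp p D fs (card I * (s + 3) + 2) {\<lambda>w. \<Sum>i\<in>I. \<psi> i w}"
  using assms(1,2)
proof (induction I rule: finite_induct)
  case empty
  then show ?case using acomp_const[OF assms(3), of D fs 0] by (simp add: numeral_2_eq_2)
next
  case (insert i I)
  have "acomp p D fs (s + (card I * (s + 3) + 2) + 3) {\<lambda>w. \<psi> i w + (\<Sum>i\<in>I. \<psi> i w)}"
    by (rule acomp_plus[OF insert.prems insert.IH assms(3)], simp, rule insert.prems, simp)
  then show ?case using insert(1,2) by (simp add: algebra_simps)
qed

lemma acomp_prod: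
  assumes "finite I" "\<And>i. i \<in> I \<Longrightarrow> acomp p D fs s {\<psi> i}"
  shows "acomp p D fs (card I * s) {\<lambda>w. \<Prod>i\<in>I. \<psi> i w}"
  using assms(1,2)
proof (induction I rule: finite_induct)
  case empty
  then show ?case using acomp_one[of p D fs] by simp
next
  case (insert i I)
  have "acomp p D fs (s + card I * s) {\<lambda>w. \<psi> i w * (\<Prod>i\<in>I. \<psi> i w)}"
    by (rule acomp_mult) (simp_all add: insert)
  then show ?case using insert(1,2) by simp
qed

text \<open>The sink has to be the last vertex, so an edge labelled 1 copies the wanted value to a
  fresh one. The 3 extra units are the source, this vertex and this edge.\<close>

lemma acomp_babp:
  assumes "acomp p D fs s {\<psi>}" "p > 1" "T \<subseteq> {0..<int p}"
  shows "\<exists>G. babp_wf p (length fs) G \<and> babp_size G \<le> s + 3 \<and>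
    (\<forall>w\<in>D. babp_eval p G (map (\<lambda>f. f w) fs) = (\<psi> w mod int p \<in> T))"
proof -
  have 0: "abp_wf p (length fs) 1 []" by (simp add: abp_wf_def babp_wf_def)
  have "pv [] z 0 = 1" for z using pv_rec[of "[]" z 0] by (simp add: forward_def)
  then have "aprov p D fs 1 [] (\<lambda>w. 1)" unfolding aprov_def by simp
  then obtain m E where e: "aext p (length fs) s 1 [] m E" "abp_wf p (length fs) m E"
    "aprov p D fs m E \<psi>"
    using acompD[OF assms(1) 0] by (metis (no_types, lifting) append_Nil aprov_cong cong_refl mult_1 singletonI)
  then obtain v where v: "v < m" "\<forall>w\<in>D. [pv E (map (\<lambda>f. f w) fs) v = \<psi> w] (mod int p)"
    unfolding aprov_def by blast
  have vs: "\<forall>(v, l)\<in>set [(v, LC 1)]. v < m \<and>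
      (case l of LV i \<Rightarrow> i < length fs | LC c \<Rightarrow> 0 \<le> c \<and> c < int p)" using v assms by simp
  note x = aext_vertex[OF e(2) vs]
  let ?E = "E @ [(v, m, LC 1)]"
  have wf: "abp_wf p (length fs) (Suc m) ?E" using x(1) by (simp add: aext_def)
  show ?thesis
  proof (intro exI[of _ "(Suc m, ?E, T)"] conjI ballI)
    show "babp_wf p (length fs) (Suc m, ?E, T)"
      using wf assms(3) by (auto simp: abp_wf_def babp_wf_def)
    show "babp_size (Suc m, ?E, T) \<le> s + 3" using e(1) by (auto simp: aext_def babp_size_def)
    fix w assume w: "w \<in> D"
    show "babp_eval p (Suc m, ?E, T) (map (\<lambda>f. f w) fs) = (\<psi> w mod int p \<in> T)"
      using x(2) v w abp_value_pv[OF abp_wf_forward[OF wf], of p "Suc m" T]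
      by (simp add: babp_eval_def cong_def)
  qed
qed

section \<open>Characters of elementary abelian groups\<close>

text \<open>Linear algebra without bases: a subgroup \<open>H\<close> maximal among those avoiding
  \<open>x\<close> complements the line through \<open>x\<close>. Every element is then
  \<open>h \<otimes> x [^] k\<close> with \<open>h \<in> H\<close> and \<open>k\<close> unique
  modulo \<open>p\<close>, and the exponent \<open>k\<close> is the character.\<close>

lemma (in comm_group) elementary_abelian_separating_character:
  assumes fin: "finite (carrier G)" and p: "prime p"
    and exp: "\<And>y. y \<in> carrier G \<Longrightarrow> y [^] p = \<one>"
    and x: "x \<in> carrier G" "x \<noteq> \<one>"
  shows "\<exists>\<chi> :: 'a \<Rightarrow> int. (\<forall>a\<in>carrier G. \<forall>b\<in>carrier G. [\<chi> (a \<otimes> b) = \<chi> a + \<chi> b] (mod int p)) \<and>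
    \<not> [\<chi> x = 0] (mod int p)"
proof -
  have p1: "p > 1" using p prime_gt_1_nat by blast
  \<comment> \<open>With natural exponents, \<open>y [^] (k * (p - 1))\<close> takes the place of
    the inverse of \<open>y [^] k\<close>.\<close>
  have kp: "k + k * (p - 1) = k * p" for k :: nat using p1 by (cases p) auto
  have pow_mod: "y [^] (a * p + b) = y [^] b" if y: "y \<in> carrier G" for y and a b :: nat
  proof -
    have "y [^] (a * p + b) = (y [^] p) [^] a \<otimes> y [^] b"
      using y by (simp add: nat_pow_mult[symmetric] nat_pow_pow mult.commute)
    then show ?thesis using y exp by simp
  qed
  have pow_cong: "y [^] a = y [^] b" if "y \<in> carrier G" "[a = b] (mod p)" for y and a b :: nat
    using pow_mod[OF that(1), of "a div p" "a mod p"] pow_mod[OF that(1), of "b div p" "b mod p"]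
      that(2) unfolding cong_def div_mult_mod_eq by metis
  have inverse_exp: "\<exists>a'. [a * a' = 1] (mod p)" if "\<not> p dvd a" for a :: nat
    using that p by (metis cong_solve_coprime_nat coprime_commute prime_imp_coprime One_nat_def)
  have subgroup_pow: "y [^] a \<in> H" if "subgroup H G" "y \<in> H" for H y and a :: nat
    using that by (induction a) (auto simp: subgroup.one_closed subgroup.m_closed)
  define S where "S = {H. subgroup H G \<and> x \<notin> H}"
  have "finite S" by (rule finite_subset[of _ "Pow (carrier G)"]) (auto simp: S_def fin dest: subgroup.subset)
  moreover have "{\<one>} \<in> S" using x triv_subgroup by (auto simp: S_def)
  ultimately obtain H where H: "H \<in> S" and max: "\<And>H'. H' \<in> S \<Longrightarrow> H \<subseteq> H' \<Longrightarrow> H = H'"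
    using finite_has_maximal[of S] by blast
  have sH: "subgroup H G" and xH: "x \<notin> H" using H by (auto simp: S_def)
  have Hc: "\<And>h. h \<in> H \<Longrightarrow> h \<in> carrier G" using subgroup.subset[OF sH] by auto
  have powH: "p dvd a" if "x [^] a \<in> H" for a :: nat
  proof (rule ccontr)
    assume "\<not> p dvd a"
    then obtain a' where "[a * a' = 1] (mod p)" using inverse_exp by blast
    then have "x [^] (a * a') = x" using pow_cong[OF x(1), of "a * a'" 1] x(1) by simp
    moreover have "x [^] (a * a') \<in> H" using subgroup_pow[OF sH that, of a'] x(1) by (simp add: nat_pow_pow)
    ultimately show False using xH by simp
  qed
  have ex: "\<exists>k::nat. \<exists>h\<in>H. y = h \<otimes> x [^] k" if y: "y \<in> carrier G" for y
  proof (cases "y \<in> H")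
    case True
    then show ?thesis using y by (intro exI[of _ 0] bexI[of _ y]) auto
  next
    case False
    \<comment> \<open>The subgroup generated by \<open>H\<close> and \<open>y\<close> is larger than
      \<open>H\<close>, so by maximality it contains \<open>x\<close>. The exponent of
      \<open>y\<close> in the resulting equation is invertible modulo \<open>p\<close>, and the
      equation can be solved for \<open>y\<close>.\<close>
    define H' where "H' = {h \<otimes> y [^] (k::nat) | h k. h \<in> H}"
    have sH': "subgroup H' G"
    proof (rule subgroupI)
      show "H' \<subseteq> carrier G" using y Hc by (auto simp: H'_def)
      show "H' \<noteq> {}" using subgroup.one_closed[OF sH] by (auto simp: H'_def)
    next
      fix a assume "a \<in> H'"
      then obtain h and k :: nat where a: "a = h \<otimes> y [^] k" "h \<in> H" by (auto simp: H'_def)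
      have "y [^] k \<otimes> y [^] (k * (p - 1)) = y [^] (k * p + 0)"
        using y kp[of k] by (simp add: nat_pow_mult)
      then have "y [^] k \<otimes> y [^] (k * (p - 1)) = \<one>" using pow_mod[OF y, of k 0] by simp
      then have "inv (y [^] k) = y [^] (k * (p - 1))" using y by (metis inv_equality m_comm nat_pow_closed)
      then have "inv a = inv h \<otimes> y [^] (k * (p - 1))"
        using a y Hc by (simp add: inv_mult)
      then show "inv a \<in> H'" using a subgroup.m_inv_closed[OF sH] by (auto simp: H'_def)
    next
      fix a b assume "a \<in> H'" "b \<in> H'"
      then obtain h h' and k k' :: nat where ab: "a = h \<otimes> y [^] k" "h \<in> H" "b = h' \<otimes> y [^] k'" "h' \<in> H"
        by (auto simp: H'_def)
      have "a \<otimes> b = (h \<otimes> h') \<otimes> y [^] (k + k')"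
        using ab y Hc by (simp add: nat_pow_mult[symmetric] m_ac)
      then show "a \<otimes> b \<in> H'" using ab subgroup.m_closed[OF sH] by (auto simp: H'_def)
    qed
    have "H \<subseteq> H'"
    proof
      fix h assume "h \<in> H"
      then have "h = h \<otimes> y [^] (0::nat)" using Hc by simp
      with \<open>h \<in> H\<close> show "h \<in> H'" unfolding H'_def by blast
    qed
    moreover have "y \<in> H'"
    proof -
      have "y = \<one> \<otimes> y [^] (1::nat)" using y by simp
      then show ?thesis using subgroup.one_closed[OF sH] unfolding H'_def by blast
    qed
    ultimately have "H' \<notin> S" using max False by blast
    then obtain h and k :: nat where hk: "x = h \<otimes> y [^] k" "h \<in> H" using sH' by (auto simp: S_def H'_def)
    have "\<not> p dvd k"
    proof
      assume "p dvd k"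
      then have "y [^] k = \<one>" using pow_cong[OF y, of k 0] by (simp add: cong_0_iff)
      then show False using hk xH Hc by simp
    qed
    then obtain k' where k': "[k * k' = 1] (mod p)" using inverse_exp by blast
    have "x [^] k' = h [^] k' \<otimes> y [^] (k * k')"
      using hk y Hc by (simp add: pow_mult_distrib m_comm nat_pow_pow)
    also have "y [^] (k * k') = y" using pow_cong[OF y k'] y by simp
    finally have "y = inv (h [^] k') \<otimes> x [^] k'"
      using hk y Hc by (simp add: m_assoc[symmetric])
    moreover have "inv (h [^] k') \<in> H"
      using subgroup_pow[OF sH hk(2)] subgroup.m_inv_closed[OF sH] by blast
    ultimately show ?thesis by blast
  qed
  have uniq: "[k = k'] (mod p)" if eq: "h \<otimes> x [^] k = h' \<otimes> x [^] k'" "h \<in> H" "h' \<in> H" for h h' and k k' :: nat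
  proof -
    have "x [^] (k + k' * (p - 1)) = inv h \<otimes> (h \<otimes> x [^] k) \<otimes> x [^] (k' * (p - 1))"
      using eq(2) Hc x by (simp add: nat_pow_mult[symmetric] m_assoc[symmetric])
    also have "\<dots> = (inv h \<otimes> h') \<otimes> (x [^] k' \<otimes> x [^] (k' * (p - 1)))"
      unfolding eq(1) using eq(2,3) Hc x by (simp add: m_assoc)
    also have "x [^] k' \<otimes> x [^] (k' * (p - 1)) = x [^] (k' * p + 0)"
      using x kp[of k'] by (simp add: nat_pow_mult)
    also have "\<dots> = \<one>" using pow_mod[OF x(1), of k' 0] by simp
    finally have "x [^] (k + k' * (p - 1)) = inv h \<otimes> h'" using eq(2,3) Hc by simp
    then have "p dvd k + k' * (p - 1)"
      using eq(2,3) powH subgroup.m_closed[OF sH] subgroup.m_inv_closed[OF sH] by simp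
    then have "[k + k' * (p - 1) = 0] (mod p)" by (simp add: cong_0_iff)
    then have "[k + k' * (p - 1) + k' = 0 + k'] (mod p)" by (rule cong_add[OF _ cong_refl])
    moreover have "k + k' * (p - 1) + k' = k + k' * p" using kp[of k'] by simp
    ultimately have "[k + k' * p = k'] (mod p)" by (metis add_0)
    then show ?thesis by (simp add: cong_def)
  qed
  define \<kappa> where "\<kappa> y = (SOME k. \<exists>h\<in>H. y = h \<otimes> x [^] (k::nat))" for y
  have \<kappa>: "\<exists>h\<in>H. y = h \<otimes> x [^] \<kappa> y" if "y \<in> carrier G" for y
    unfolding \<kappa>_def using someI_ex[OF ex[OF that]] .
  have "[int (\<kappa> (a \<otimes> b)) = int (\<kappa> a) + int (\<kappa> b)] (mod int p)"
    if ab: "a \<in> carrier G" "b \<in> carrier G" for a b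
  proof -
    obtain h h' h'' where h: "h \<in> H" "a = h \<otimes> x [^] \<kappa> a" "h' \<in> H" "b = h' \<otimes> x [^] \<kappa> b"
      "h'' \<in> H" "a \<otimes> b = h'' \<otimes> x [^] \<kappa> (a \<otimes> b)" using \<kappa> ab by (metis m_closed)
    have "(h \<otimes> h') \<otimes> x [^] (\<kappa> a + \<kappa> b) = (h \<otimes> x [^] \<kappa> a) \<otimes> (h' \<otimes> x [^] \<kappa> b)"
      using h(1,3) Hc x by (simp add: nat_pow_mult[symmetric] m_ac)
    then have "h'' \<otimes> x [^] \<kappa> (a \<otimes> b) = (h \<otimes> h') \<otimes> x [^] (\<kappa> a + \<kappa> b)" using h by metis
    then have "[\<kappa> (a \<otimes> b) = \<kappa> a + \<kappa> b] (mod p)"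
      using uniq h subgroup.m_closed[OF sH] by blast
    then show ?thesis by (metis cong_int_iff of_nat_add)
  qed
  moreover have "\<not> [int (\<kappa> x) = 0] (mod int p)"
  proof
    assume "[int (\<kappa> x) = 0] (mod int p)"
    then have k0: "[\<kappa> x = 0] (mod p)" by (metis cong_int_iff of_nat_0)
    obtain h where "h \<in> H" "x = h \<otimes> x [^] \<kappa> x" using \<kappa>[OF x(1)] by blast
    moreover have "x [^] \<kappa> x = \<one>" using pow_cong[OF x(1) k0] by simp
    ultimately show False using xH Hc by simp
  qed
  ultimately show ?thesis by (intro exI[of _ "\<lambda>y. int (\<kappa> y)"]) blast
qed

section \<open>Polynomials and congruences\<close>

lemma op_closed:
  assumes "finite_alg A" "j < length (ops A)" "length xs = fst (ops A ! j)" "set xs \<subseteq> car A"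
  shows "snd (ops A ! j) xs \<in> car A"
proof -
  have "(fst (ops A ! j), snd (ops A ! j)) \<in> set (ops A)" using assms(2) by simp
  then show ?thesis using assms unfolding finite_alg_def by fastforce
qed

lemma Con_equiv: "\<theta> \<in> Con A \<Longrightarrow> equiv (car A) \<theta>"
  by (simp add: Con_def is_cong_def)

lemma equivD:
  assumes "equiv S \<theta>"
  shows "(x, y) \<in> \<theta> \<Longrightarrow> x \<in> S \<and> y \<in> S" "x \<in> S \<Longrightarrow> (x, x) \<in> \<theta>" "(x, y) \<in> \<theta> \<Longrightarrow> (y, x) \<in> \<theta>"
    "(x, y) \<in> \<theta> \<Longrightarrow> (y, z) \<in> \<theta> \<Longrightarrow> (x, z) \<in> \<theta>"
  using assms unfolding equiv_def refl_on_def sym_def trans_def by blast+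

lemma Con_op:
  assumes "\<theta> \<in> Con A" "j < length (ops A)" "length xs = fst (ops A ! j)" "length ys = fst (ops A ! j)"
    "\<And>i. i < length xs \<Longrightarrow> (xs ! i, ys ! i) \<in> \<theta>"
  shows "(snd (ops A ! j) xs, snd (ops A ! j) ys) \<in> \<theta>"
proof -
  have "(fst (ops A ! j), snd (ops A ! j)) \<in> set (ops A)" using assms(2) by simp
  moreover have "set xs \<subseteq> car A" "set ys \<subseteq> car A"
    using assms equivD(1)[OF Con_equiv[OF assms(1)]] by (metis in_set_conv_nth subsetI)+
  moreover have "list_all2 (\<lambda>x y. (x, y) \<in> \<theta>) xs ys"
    using assms by (simp add: list_all2_conv_all_nth)
  ultimately show ?thesis using assms unfolding Con_def is_cong_def by fastforce
qed

lemma in_cube_iff: "xs \<in> cube M n \<longleftrightarrow> length xs = n \<and> (\<forall>i<n. xs ! i \<in> M)"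
  by (auto simp: cube_def set_conv_nth)

lemma tm_eval_closed:
  assumes "finite_alg A" "xs \<in> cube (car A) n"
  shows "tm_wf A n t \<Longrightarrow> tm_eval (ops A) xs t \<in> car A"
proof (induction t)
  case (Ap j ts)
  then show ?case using op_closed[OF assms(1), of j "map (tm_eval (ops A) xs) ts"] by auto
qed (use assms in \<open>auto simp: in_cube_iff\<close>)

lemma tm_eval_Con:
  assumes "\<theta> \<in> Con A" "length xs = n" "length ys = n" "\<And>i. i < n \<Longrightarrow> (xs ! i, ys ! i) \<in> \<theta>"
  shows "tm_wf A n t \<Longrightarrow> (tm_eval (ops A) xs t, tm_eval (ops A) ys t) \<in> \<theta>"
proof (induction t)
  case (Ap j ts)
  then show ?case
    using Con_op[OF assms(1), of j "map (tm_eval (ops A) xs) ts" "map (tm_eval (ops A) ys) ts"] by auto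
qed (use assms equivD(2)[OF Con_equiv[OF assms(1)]] in auto)

fun tm_subst :: "'a tm list \<Rightarrow> 'a tm \<Rightarrow> 'a tm" where
  "tm_subst ss (V i) = ss ! i"
| "tm_subst ss (K a) = K a"
| "tm_subst ss (Ap j ts) = Ap j (map (tm_subst ss) ts)"

lemma tm_subst_wf:
  assumes "length ss = k" "\<forall>s\<in>set ss. tm_wf A n s"
  shows "tm_wf A k t \<Longrightarrow> tm_wf A n (tm_subst ss t)"
  using assms by (induction t) auto

lemma tm_subst_eval:
  assumes "length ss = k"
  shows "tm_wf A k t \<Longrightarrow> tm_eval (ops A) xs (tm_subst ss t) =
    tm_eval (ops A) (map (tm_eval (ops A) xs) ss) t"
proof (induction t)
  case (Ap j ts)
  then have "map (tm_eval (ops A) xs \<circ> tm_subst ss) ts =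
      map (tm_eval (ops A) (map (tm_eval (ops A) xs) ss)) ts" by auto
  then show ?case unfolding tm_subst.simps tm_eval.simps map_map by (rule arg_cong)
qed (use assms in auto)

text \<open>Agreement is asked for on the carrier only, so that compositions written as lambda terms
  count as polynomials without being normalised to terms.\<close>

definition pol :: "'a alg \<Rightarrow> nat \<Rightarrow> ('a list \<Rightarrow> 'a) \<Rightarrow> bool" where
  "pol A n F \<longleftrightarrow> (\<exists>t. tm_wf A n t \<and> (\<forall>xs\<in>cube (car A) n. F xs = tm_eval (ops A) xs t))"

lemma pol_closed: "finite_alg A \<Longrightarrow> pol A n F \<Longrightarrow> xs \<in> cube (car A) n \<Longrightarrow> F xs \<in> car A"
  unfolding pol_def using tm_eval_closed by metis

lemma pol_Con:
  assumes "\<theta> \<in> Con A" "pol A n F" "length xs = n" "length ys = n"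
    "\<And>i. i < n \<Longrightarrow> (xs ! i, ys ! i) \<in> \<theta>"
  shows "(F xs, F ys) \<in> \<theta>"
proof -
  obtain t where t: "tm_wf A n t" "\<And>xs. xs \<in> cube (car A) n \<Longrightarrow> F xs = tm_eval (ops A) xs t"
    using assms(2) unfolding pol_def by blast
  have "xs \<in> cube (car A) n" "ys \<in> cube (car A) n"
    using assms equivD(1)[OF Con_equiv[OF assms(1)]] unfolding in_cube_iff by blast+
  then show ?thesis using t tm_eval_Con[OF assms(1,3,4,5) t(1)] by simp
qed

lemma pol_var: "i < n \<Longrightarrow> pol A n (\<lambda>xs. xs ! i)"
  unfolding pol_def by (intro exI[of _ "V i"]) simp

lemma pol_const: "a \<in> car A \<Longrightarrow> pol A n (\<lambda>xs. a)"
  unfolding pol_def by (intro exI[of _ "K a"]) simp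

lemma pol_comp:
  assumes fin: "finite_alg A" and F: "pol A k F" and Gs: "length Gs = k" "\<And>G. G \<in> set Gs \<Longrightarrow> pol A n G"
  shows "pol A n (\<lambda>xs. F (map (\<lambda>G. G xs) Gs))"
proof -
  obtain t where t: "tm_wf A k t" "\<And>xs. xs \<in> cube (car A) k \<Longrightarrow> F xs = tm_eval (ops A) xs t"
    using F unfolding pol_def by blast
  obtain s where s: "\<And>G. G \<in> set Gs \<Longrightarrow> tm_wf A n (s G) \<and>
      (\<forall>xs\<in>cube (car A) n. G xs = tm_eval (ops A) xs (s G))"
    using Gs(2) unfolding pol_def by metis
  have "F (map (\<lambda>G. G xs) Gs) = tm_eval (ops A) xs (tm_subst (map s Gs) t)"
    if xs: "xs \<in> cube (car A) n" for xs
  proof -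
    have eq: "map (\<lambda>G. G xs) Gs = map (tm_eval (ops A) xs) (map s Gs)" using s xs by simp
    have "map (\<lambda>G. G xs) Gs \<in> cube (car A) k"
      using Gs pol_closed[OF fin _ xs] by (auto simp: cube_def)
    then have "F (map (\<lambda>G. G xs) Gs) = tm_eval (ops A) (map (\<lambda>G. G xs) Gs) t" by (rule t(2))
    also have "\<dots> = tm_eval (ops A) xs (tm_subst (map s Gs) t)"
      unfolding eq using Gs(1) t(1) by (intro tm_subst_eval[symmetric]) auto
    finally show ?thesis .
  qed
  moreover have "tm_wf A n (tm_subst (map s Gs) t)"
    using tm_subst_wf[of "map s Gs" k A n t] Gs(1) s t(1) by simp
  ultimately show ?thesis unfolding pol_def by blast
qed

lemma pol_op:
  assumes "j < length (ops A)"
  shows "pol A (fst (ops A ! j)) (snd (ops A ! j))"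
proof -
  let ?k = "fst (ops A ! j)"
  have "map ((!) xs) [0..<?k] = xs" if "length xs = ?k" for xs :: "'a list"
    using that map_nth[of xs] by simp
  then show ?thesis unfolding pol_def using assms
    by (intro exI[of _ "Ap j (map V [0..<?k])"]) (auto simp: cube_def comp_def)
qed

lemma pol_unary_iff: "pol_unary A f \<longleftrightarrow> pol A 1 (\<lambda>xs. f (xs ! 0))"
proof -
  have "cube (car A) 1 = (\<lambda>x. [x]) ` car A"
    by (auto simp: cube_def length_Suc_conv)
  then show ?thesis unfolding pol_unary_def pol_def by simp
qed

lemma pol_unary_closed: "finite_alg A \<Longrightarrow> pol_unary A f \<Longrightarrow> x \<in> car A \<Longrightarrow> f x \<in> car A"
  using pol_closed[of A 1 "\<lambda>xs. f (xs ! 0)" "[x]"] by (simp add: pol_unary_iff cube_def)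

lemma pol_unary_Con: "\<theta> \<in> Con A \<Longrightarrow> pol_unary A f \<Longrightarrow> (x, y) \<in> \<theta> \<Longrightarrow> (f x, f y) \<in> \<theta>"
  using pol_Con[of \<theta> A 1 "\<lambda>xs. f (xs ! 0)" "[x]" "[y]"] by (simp add: pol_unary_iff)

lemma pol_unary_id: "pol_unary A (\<lambda>x. x)"
  using pol_var[of 0 1] by (simp add: pol_unary_iff)

lemma pol_comp_unary:
  assumes "finite_alg A" "pol_unary A f" "pol A n F"
  shows "pol A n (\<lambda>xs. f (F xs))"
  using pol_comp[OF assms(1), of 1 "\<lambda>xs. f (xs ! 0)" "[F]" n] assms(2,3) by (simp add: pol_unary_iff)

lemma pol_unary_comp: "finite_alg A \<Longrightarrow> pol_unary A f \<Longrightarrow> pol_unary A g \<Longrightarrow> pol_unary A (\<lambda>x. f (g x))"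
  using pol_comp_unary[of A f 1 "\<lambda>xs. g (xs ! 0)"] by (simp add: pol_unary_iff)

text \<open>Freezing all but two arguments produces the binary polynomials on which affinity is
  tested. The case \<open>i = j\<close> is allowed and gives the unary version.\<close>

lemma pol_update2:
  assumes fin: "finite_alg A" and F: "pol A k F" and y: "y \<in> cube (car A) k"
    and g: "pol A n g" and h: "pol A n h"
  shows "pol A n (\<lambda>xs. F (y[i := g xs, j := h xs]))"
proof -
  let ?Gs = "map (\<lambda>l xs. y[i := g xs, j := h xs] ! l) [0..<k]"
  have len: "length y = k" using y by (simp add: cube_def)
  have "pol A n (\<lambda>xs. y[i := g xs, j := h xs] ! l)" if "l < k" for l
  proof -
    consider "l = j" | "l \<noteq> j" "l = i" | "l \<noteq> j" "l \<noteq> i" by blast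
    then show ?thesis
    proof cases
      case 3
      have "y ! l \<in> car A" using y that by (simp add: in_cube_iff)
      from pol_const[OF this] show ?thesis using 3 by simp
    qed (use that len g h in auto)
  qed
  then have "pol A n (\<lambda>xs. F (map (\<lambda>G. G xs) ?Gs))"
    by (intro pol_comp[OF fin F]) auto
  moreover have "map (\<lambda>G. G xs) ?Gs = y[i := g xs, j := h xs]" for xs
    using len by (intro nth_equalityI) auto
  ultimately show ?thesis by simp
qed

lemma pol_unary_update:
  assumes "finite_alg A" "pol A k F" "y \<in> cube (car A) k"
  shows "pol_unary A (\<lambda>x. F (y[i := x]))"
proof -
  have "pol A 1 (\<lambda>xs. F (y[i := xs ! 0, i := xs ! 0]))"
    using assms pol_var[of 0 1 A] by (intro pol_update2) auto
  then show ?thesis by (simp add: pol_unary_iff)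
qed

text \<open>Pass from \<open>xs\<close> to \<open>ys\<close> through the hybrids
  \<open>take m ys @ drop m xs\<close>, which differ in one coordinate at a time; transitivity joins
  the steps.\<close>

lemma change_coordinatewise:
  assumes len: "length xs = k" "length ys = k" and tr: "trans R" and rf: "(F xs, F xs) \<in> R"
    and step: "\<And>m. m < k \<Longrightarrow> (let z = take m ys @ drop m xs in
        (F (z[m := xs ! m]), F (z[m := ys ! m])) \<in> R)"
  shows "(F xs, F ys) \<in> R"
proof -
  have "(F xs, F (take m ys @ drop m xs)) \<in> R" if "m \<le> k" for m
    using that
  proof (induction m)
    case (Suc m)
    let ?z = "take m ys @ drop m xs"
    have m: "m < k" using Suc by simp
    have "?z[m := xs ! m] = ?z" using m len by (auto simp: list_update_append nth_append list_eq_iff_nth_eq nth_list_update)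
    moreover have "?z[m := ys ! m] = take (Suc m) ys @ drop (Suc m) xs"
      using m len by (auto simp: list_eq_iff_nth_eq nth_append nth_list_update less_Suc_eq)
    ultimately have "(F ?z, F (take (Suc m) ys @ drop (Suc m) xs)) \<in> R"
      using step[OF m] by (simp add: Let_def)
    then show ?case using Suc tr m by (meson less_imp_le_nat transD)
  qed (simp add: rf)
  from this[of k] show ?thesis using len by simp
qed

lemma nth_take_drop_append:
  "length xs = k \<Longrightarrow> length ys = k \<Longrightarrow> i < k \<Longrightarrow> (take m ys @ drop m xs) ! i = (if i < m then ys ! i else xs ! i)"
  by (cases "m \<le> k") (auto simp: nth_append)

text \<open>The pairs all of whose polynomial images lie in \<open>T\<close> form a congruence, so a prime
  quotient is generated by any pair in \<open>\<delta> - \<gamma>\<close>.\<close>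
lemma prime_quot_generated:
  assumes fin: "finite_alg A" and pq: "prime_quot A \<gamma> \<delta>" and uv: "(u, v) \<in> \<delta>" "(u, v) \<notin> \<gamma>"
    and T: "equiv (car A) T" "\<gamma> \<subseteq> T" and gen: "\<And>h. pol_unary A h \<Longrightarrow> (h u, h v) \<in> T"
  shows "\<delta> \<subseteq> T"
proof -
  have \<gamma>: "\<gamma> \<in> Con A" and \<delta>: "\<delta> \<in> Con A" and sub: "\<gamma> \<subset> \<delta>"
    and cov: "\<And>\<theta>. \<theta> \<in> Con A \<Longrightarrow> \<gamma> \<subset> \<theta> \<Longrightarrow> \<not> \<theta> \<subset> \<delta>"
    using pq unfolding prime_quot_def by auto
  note eT = equivD[OF T(1)] and e\<delta> = equivD[OF Con_equiv[OF \<delta>]]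
  define T0 where "T0 = {(x, y). (x, y) \<in> \<delta> \<and> (\<forall>h. pol_unary A h \<longrightarrow> (h x, h y) \<in> T)}"
  have "equiv (car A) T0"
  proof (rule equivI)
    show "T0 \<subseteq> car A \<times> car A" unfolding T0_def using e\<delta>(1) by auto
    show "refl_on (car A) T0" unfolding T0_def refl_on_def
      using e\<delta>(2) eT(2) pol_unary_closed[OF fin] by blast
    show "sym T0" unfolding T0_def sym_def using e\<delta>(3) eT(3) by blast
    show "trans T0" unfolding T0_def trans_def using e\<delta>(4) eT(4) by blast
  qed
  moreover have "(f xs, f ys) \<in> T0" if kf: "(k, f) \<in> set (ops A)" and len: "length xs = k" "length ys = k"
    and "set xs \<subseteq> car A" "set ys \<subseteq> car A" and r: "list_all2 (\<lambda>x y. (x, y) \<in> T0) xs ys" for k f xs ys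
  proof -
    obtain j where j: "j < length (ops A)" "ops A ! j = (k, f)"
      using kf by (auto simp: in_set_conv_nth)
    have polf: "pol A k f" using pol_op[OF j(1)] j(2) by simp
    have ri: "(xs ! i, ys ! i) \<in> T0" if "i < k" for i
      using r that len by (simp add: list_all2_conv_all_nth)
    have "(f xs, f ys) \<in> \<delta>"
    proof (rule pol_Con[OF \<delta> polf len])
      show "(xs ! i, ys ! i) \<in> \<delta>" if "i < k" for i using ri[OF that] by (simp add: T0_def)
    qed
    moreover have "(h (f xs), h (f ys)) \<in> T" if h: "pol_unary A h" for h
    proof (rule change_coordinatewise[where F = "\<lambda>xs. h (f xs)", OF len])
      have xsc: "xs \<in> cube (car A) k" using that len \<open>set xs \<subseteq> car A\<close> by (simp add: cube_def)
      show "trans T" using T(1) by (simp add: equiv_def)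
      show "(h (f xs), h (f xs)) \<in> T"
        using eT(2) pol_unary_closed[OF fin h] pol_closed[OF fin polf xsc] by blast
      fix m assume m: "m < k"
      define z where "z = take m ys @ drop m xs"
      have "set z \<subseteq> car A" unfolding z_def
        using \<open>set xs \<subseteq> car A\<close> \<open>set ys \<subseteq> car A\<close> by (auto dest: in_set_takeD in_set_dropD)
      then have "z \<in> cube (car A) k" using len m by (simp add: cube_def z_def)
      then have "pol_unary A (\<lambda>x. h (f (z[m := x])))"
        by (intro pol_unary_update[OF fin pol_comp_unary[OF fin h polf]])
      then show "let z = take m ys @ drop m xs in
          (h (f (z[m := xs ! m])), h (f (z[m := ys ! m]))) \<in> T"
        using ri[OF m] unfolding T0_def z_def Let_def by blast
    qed
    ultimately show ?thesis by (simp add: T0_def)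
  qed
  ultimately have "T0 \<in> Con A" unfolding Con_def is_cong_def by blast
  moreover have "\<gamma> \<subset> T0"
  proof -
    have "\<gamma> \<subseteq> T0" unfolding T0_def using sub T(2) pol_unary_Con[OF \<gamma>] by blast
    moreover have "(u, v) \<in> T0" unfolding T0_def using uv gen by blast
    ultimately show ?thesis using uv by blast
  qed
  moreover have "T0 \<subseteq> \<delta>" by (auto simp: T0_def)
  ultimately have "T0 = \<delta>" using cov by blast
  then show ?thesis using pol_unary_id unfolding T0_def by fast
qed

section \<open>Idempotent polynomials onto minimal sets\<close>

text \<open>Pigeonhole: two powers of \<open>g\<close> agree on the finite set \<open>U\<close>, and
  injectivity cancels the smaller one.\<close>

lemma finite_perm_power_id:
  assumes "finite U" "inj_on g U" "g ` U \<subseteq> U"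
  shows "\<exists>m>0. \<forall>x\<in>U. (g ^^ m) x = x"
proof -
  have inU: "(g ^^ m) x \<in> U" if "x \<in> U" for m x using that assms(3) by (induction m) auto
  have inj: "inj_on (g ^^ m) U" for m
  proof (induction m)
    case (Suc m)
    then show ?case using assms(2) inU by (auto simp: inj_on_def)
  qed simp
  have "finite (range (\<lambda>m. restrict (g ^^ m) U))"
    by (rule finite_subset[of _ "U \<rightarrow>\<^sub>E U"]) (use inU assms(1) in \<open>auto intro: finite_PiE\<close>)
  then have "\<not> inj (\<lambda>m. restrict (g ^^ m) U)" using finite_imageD infinite_UNIV_nat by blast
  then obtain a b where "a \<noteq> b" and eq: "restrict (g ^^ a) U = restrict (g ^^ b) U"
    by (auto simp: inj_def)
  have *: "\<exists>m>0. \<forall>x\<in>U. (g ^^ m) x = x"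
    if "a < b" and eq: "\<forall>x\<in>U. (g ^^ a) x = (g ^^ b) x" for a b :: nat
  proof (intro exI[of _ "b - a"] conjI ballI)
    show "b - a > 0" using that by simp
    fix x assume x: "x \<in> U"
    have "(g ^^ a) ((g ^^ (b - a)) x) = (g ^^ b) x"
      using that(1) by (metis comp_apply funpow_add le_add_diff_inverse less_imp_le_nat)
    also have "\<dots> = (g ^^ a) x" using eq x by simp
    finally show "(g ^^ (b - a)) x = x" using inj[of a] inU x by (auto simp: inj_on_def)
  qed
  have "\<forall>x\<in>U. (g ^^ a) x = (g ^^ b) x" using eq by (metis restrict_apply')
  then show ?thesis using *[of a b] *[of b a] \<open>a \<noteq> b\<close> by (metis linorder_neqE_nat)
qed

text \<open>Let \<open>U\<close> be the image of \<open>f\<close>, where \<open>f\<close> separates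
  \<open>(x, y)\<close> modulo \<open>\<gamma>\<close>. If no \<open>f \<circ> h\<close> separated
  \<open>(f x, f y)\<close>, the pullback of \<open>\<gamma>\<close> along \<open>f\<close> would
  contain all of \<open>\<delta>\<close>, as \<open>(f x, f y)\<close> generates it, and so would
  contain \<open>(x, y)\<close>. For a separating \<open>g = f \<circ> h\<close>, minimality forces
  \<open>g\<close> to permute \<open>U\<close>, and some power of \<open>g\<close> is the identity
  there.\<close>

lemma min_set_idempotent:
  assumes fin: "finite_alg A" and pq: "prime_quot A \<gamma> \<delta>" and U: "min_set A \<gamma> \<delta> U"
  shows "\<exists>e. pol_unary A e \<and> e ` car A \<subseteq> U \<and> (\<forall>x\<in>U. e x = x)"
proof -
  have \<gamma>: "\<gamma> \<in> Con A" and \<delta>: "\<delta> \<in> Con A" and sub: "\<gamma> \<subset> \<delta>"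
    using pq unfolding prime_quot_def by auto
  note e\<gamma> = equivD[OF Con_equiv[OF \<gamma>]] and e\<delta> = equivD[OF Con_equiv[OF \<delta>]]
  obtain f x y where f: "pol_unary A f" "U = f ` car A" and xy: "(x, y) \<in> \<delta>" "(f x, f y) \<notin> \<gamma>"
    using U unfolding min_set_def nbhds_def by blast
  have min: "\<And>W. W \<in> nbhds A \<gamma> \<delta> \<Longrightarrow> W \<subseteq> U \<Longrightarrow> W = U"
    using U unfolding min_set_def by blast
  have Uc: "U \<subseteq> car A" using f pol_unary_closed[OF fin] by blast
  define T where "T = {(a, b). a \<in> car A \<and> b \<in> car A \<and> (f a, f b) \<in> \<gamma>}"
  have "\<exists>h. pol_unary A h \<and> (h (f x), h (f y)) \<notin> T"
  proof (rule ccontr)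
    assume "\<not> ?thesis"
    then have gen: "\<And>h. pol_unary A h \<Longrightarrow> (h (f x), h (f y)) \<in> T" by blast
    have eqT: "equiv (car A) T"
    proof (rule equivI)
      show "T \<subseteq> car A \<times> car A" by (auto simp: T_def)
      show "refl_on (car A) T" unfolding T_def refl_on_def
        using e\<gamma>(2) pol_unary_closed[OF fin f(1)] by blast
      show "sym T" unfolding T_def sym_def using e\<gamma>(3) by blast
      show "trans T" unfolding T_def trans_def using e\<gamma>(4) by blast
    qed
    have "\<gamma> \<subseteq> T" unfolding T_def using e\<gamma>(1) pol_unary_Con[OF \<gamma> f(1)] by blast
    then have "\<delta> \<subseteq> T"
      using prime_quot_generated[OF fin pq _ xy(2) eqT _ gen] pol_unary_Con[OF \<delta> f(1) xy(1)] by blast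
    then show False using xy by (auto simp: T_def)
  qed
  then obtain h where h: "pol_unary A h" "(h (f x), h (f y)) \<notin> T" by blast
  define g where "g a = f (h a)" for a
  have g: "pol_unary A g" unfolding g_def using pol_unary_comp[OF fin f(1) h(1)] .
  have gU: "g ` car A \<subseteq> U" unfolding g_def f(2) using pol_unary_closed[OF fin h(1)] by blast
  have fx: "f x \<in> car A" "f y \<in> car A" using e\<delta>(1)[OF xy(1)] pol_unary_closed[OF fin f(1)] by auto
  have ngf: "(g (f x), g (f y)) \<notin> \<gamma>"
    using h(2) fx pol_unary_closed[OF fin h(1)] by (auto simp: T_def g_def)
  have "(\<lambda>a. g (f a)) ` car A \<in> nbhds A \<gamma> \<delta>"
    unfolding nbhds_def using pol_unary_comp[OF fin g f(1)] xy(1) ngf by blast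
  moreover have "(\<lambda>a. g (f a)) ` car A = g ` U" unfolding f(2) by (simp add: image_image)
  moreover have "g ` U \<subseteq> U" using gU Uc by blast
  ultimately have gUU: "g ` U = U" using min by simp
  have finU: "finite U" using finite_subset[OF Uc] fin by (simp add: finite_alg_def)
  have "inj_on g U" using finU gUU by (simp add: eq_card_imp_inj_on)
  then obtain m where m: "m > 0" "\<forall>x\<in>U. (g ^^ m) x = x"
    using finite_perm_power_id[OF finU] gUU by blast
  \<comment> \<open>Only positive powers are considered: the zeroth one need not map the carrier
    into \<open>U\<close>.\<close>
  have "pol_unary A (g ^^ Suc k) \<and> (g ^^ Suc k) ` car A \<subseteq> U" for k
  proof (induction k)
    case 0
    then show ?case using g gU by simp
  next
    case (Suc k)
    have "pol_unary A (\<lambda>x. g ((g ^^ Suc k) x))" using pol_unary_comp[OF fin g] Suc by blast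
    moreover have "(\<lambda>x. g ((g ^^ Suc k) x)) ` car A \<subseteq> U" using Suc gUU by blast
    moreover have "g ^^ Suc (Suc k) = (\<lambda>x. g ((g ^^ Suc k) x))" by (simp add: fun_eq_iff)
    ultimately show ?case by metis
  qed
  from this[of "m - 1"] m show ?thesis by (intro exI[of _ "g ^^ m"]) simp
qed

section \<open>Affine coordinates for prime quotients of type 2\<close>

text \<open>Raising to an integer power is a scalar, hence zero or injective. Let \<open>p\<close>
  be the exponent of the group and \<open>a\<close> its gcd with \<open>b\<close>. If
  \<open>a\<close> annihilates the group, then \<open>a = p\<close> divides \<open>b\<close>; if it
  acts injectively, then \<open>p\<close> divided by \<open>a\<close> already annihilates the group,
  so \<open>a = 1\<close> and \<open>p\<close> is coprime to \<open>b\<close>.\<close>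

lemma division_ring_prime_exponent:
  fixes G (structure)
  assumes G: "comm_group G" and fin: "finite (carrier G)" and nontriv: "carrier G \<noteq> {\<one>}"
    and id: "\<exists>r\<in>R. \<forall>x\<in>carrier G. r x = x" and zero: "\<exists>r\<in>R. \<forall>x\<in>carrier G. r x = \<one>"
    and add: "\<And>r s. r \<in> R \<Longrightarrow> s \<in> R \<Longrightarrow> \<exists>u\<in>R. \<forall>x\<in>carrier G. u x = r x \<otimes> s x"
    and inj: "\<And>r. r \<in> R \<Longrightarrow> \<exists>x\<in>carrier G. r x \<noteq> \<one> \<Longrightarrow> inj_on r (carrier G)"
  shows "\<exists>p::nat. prime p \<and> (\<forall>x\<in>carrier G. x [^] p = \<one>)"
proof -
  interpret comm_group G by (rule G)
  have pow_in_R: "\<exists>r\<in>R. \<forall>x\<in>carrier G. r x = x [^] a" for a :: nat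
  proof (induction a)
    case 0
    then show ?case using zero by simp
  next
    case (Suc a)
    then obtain r where "r \<in> R" "\<forall>x\<in>carrier G. r x = x [^] a" by blast
    moreover obtain s where "s \<in> R" "\<forall>x\<in>carrier G. s x = x" using id by blast
    ultimately show ?case using add[of r s] by auto
  qed
  define P where "P a \<longleftrightarrow> a > 0 \<and> (\<forall>x\<in>carrier G. x [^] a = \<one>)" for a :: nat
  define p where "p = (LEAST a. P a)"
  have "P (order G)" using fin pow_order_eq_1 order_gt_0_iff_finite by (auto simp: P_def)
  then have Pp: "P p" unfolding p_def by (rule LeastI)
  have min: "\<And>a. P a \<Longrightarrow> p \<le> a" unfolding p_def by (rule Least_le)
  have "prime p"
  proof (rule prime_natI)
    show "p \<ge> 2"
    proof (rule ccontr)
      assume "\<not> p \<ge> 2"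
      then have "p = 1" using Pp by (auto simp: P_def)
      then have "\<forall>x\<in>carrier G. x = \<one>" using Pp by (auto simp: P_def)
      then show False using nontriv one_closed by blast
    qed
  next
    fix b c assume bc: "p dvd b * c"
    define a where "a = gcd p b"
    have a_p: "a dvd p" "a dvd b" by (simp_all add: a_def)
    have a0: "a > 0" using Pp by (simp add: a_def P_def)
    obtain d where d: "p = a * d" using a_p by blast
    have d0: "d > 0" using d Pp by (auto simp: P_def)
    show "p dvd b \<or> p dvd c"
    proof (cases "\<forall>x\<in>carrier G. x [^] a = \<one>")
      case True
      then have "p \<le> a" using min a0 by (simp add: P_def)
      then have "a = p" using a_p(1) Pp by (auto simp: P_def dest: dvd_imp_le)
      then show ?thesis using a_p by simp
    next
      case False
      obtain r where r: "r \<in> R" "\<forall>x\<in>carrier G. r x = x [^] a" using pow_in_R by blast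
      have inj_r: "inj_on r (carrier G)" using inj[OF r(1)] False r(2) by auto
      have "x [^] d = \<one>" if x: "x \<in> carrier G" for x
      proof -
        have "r (x [^] d) = x [^] p" using r(2) x d by (simp add: nat_pow_pow mult.commute)
        also have "\<dots> = r \<one>" using Pp x r(2) by (simp add: P_def)
        finally show ?thesis using inj_r x by (simp add: inj_on_eq_iff)
      qed
      then have "p \<le> d" using min d0 by (simp add: P_def)
      then have "a * d \<le> 1 * d" using d by simp
      then have "a = 1" using d0 a0 unfolding mult_le_cancel2 by simp
      then have "coprime p b" by (simp add: a_def coprime_iff_gcd_eq_1)
      then show ?thesis using bc by (simp add: coprime_dvd_mult_right_iff)
    qed
  qed
  then show ?thesis using Pp by (auto simp: P_def)
qed

text \<open>\<open>e\<close> is the idempotent polynomial of a minimal set, and \<open>e_N\<close>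
  says that it sends a \<open>\<delta>\<close>-class either into the trace or entirely outside it.
  Affinity enters through binary polynomials; \<open>polynomial_affine\<close> reaches higher
  arities by varying two coordinates at a time.\<close>

locale affine_trace =
  fixes A :: "'a alg" and \<gamma> \<delta> N e plus and R :: "('a set \<Rightarrow> 'a set) set" and p :: nat
  assumes fin: "finite_alg A" and pq: "prime_quot A \<gamma> \<delta>"
    and N_sub: "N \<subseteq> car A" and N_\<delta>: "N \<times> N \<subseteq> \<delta>" and N_\<gamma>: "\<not> N \<times> N \<subseteq> \<gamma>"
    and e: "pol_unary A e" and e_id: "\<And>x. x \<in> N \<Longrightarrow> e x = x"
    and e_N: "\<And>x y. (x, y) \<in> \<delta> \<Longrightarrow> e x \<in> N \<Longrightarrow> e y \<in> N"
    and plus_closed: "\<And>X Y. X \<in> N // (\<gamma> \<inter> N \<times> N) \<Longrightarrow> Y \<in> N // (\<gamma> \<inter> N \<times> N) \<Longrightarrow>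
      plus X Y \<in> N // (\<gamma> \<inter> N \<times> N)"
    and R_closed: "\<And>r X. r \<in> R \<Longrightarrow> X \<in> N // (\<gamma> \<inter> N \<times> N) \<Longrightarrow> r X \<in> N // (\<gamma> \<inter> N \<times> N)"
    and affine: "\<And>g. ind_pol A \<gamma> N 2 g \<Longrightarrow>
      \<exists>rs c. length rs = 2 \<and> set rs \<subseteq> R \<and> c \<in> N // (\<gamma> \<inter> N \<times> N) \<and>
        (\<forall>Xs \<in> cube (N // (\<gamma> \<inter> N \<times> N)) 2. g Xs = foldr plus (map2 (\<lambda>r X. r X) rs Xs) c)"
    and p: "prime p"
begin

abbreviation "M \<equiv> N // (\<gamma> \<inter> N \<times> N)"

definition cl :: "'a \<Rightarrow> 'a set" where "cl x = (\<gamma> \<inter> N \<times> N) `` {x}"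

text \<open>Additive maps into the prime field. A scalar of \<open>R\<close> followed by a character
  is just another function of one class, so no compatibility with \<open>R\<close> has to be
  imposed.\<close>

definition character :: "('a set \<Rightarrow> int) \<Rightarrow> bool" where
  "character \<chi> \<longleftrightarrow> (\<forall>X\<in>M. \<forall>Y\<in>M. [\<chi> (plus X Y) = \<chi> X + \<chi> Y] (mod int p))"

lemma \<gamma>: "\<gamma> \<in> Con A" and \<delta>: "\<delta> \<in> Con A" and \<gamma>_sub_\<delta>: "\<gamma> \<subseteq> \<delta>"
  using pq unfolding prime_quot_def by auto

lemmas e\<gamma> = equivD[OF Con_equiv[OF \<gamma>]] and e\<delta> = equivD[OF Con_equiv[OF \<delta>]]

lemma equiv_N: "equiv N (\<gamma> \<inter> N \<times> N)"
proof (rule equivI)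
  show "refl_on N (\<gamma> \<inter> N \<times> N)" unfolding refl_on_def using e\<gamma>(2) N_sub by blast
  show "sym (\<gamma> \<inter> N \<times> N)" unfolding sym_def using e\<gamma>(3) by blast
  show "trans (\<gamma> \<inter> N \<times> N)" unfolding trans_def using e\<gamma>(4) by blast
qed blast

lemma cl_eq_iff: "x \<in> N \<Longrightarrow> y \<in> N \<Longrightarrow> cl x = cl y \<longleftrightarrow> (x, y) \<in> \<gamma>"
  unfolding cl_def using eq_equiv_class_iff[OF equiv_N] by auto

lemma cl_in_M: "x \<in> N \<Longrightarrow> cl x \<in> M"
  unfolding cl_def by (rule quotientI)

text \<open>On classes \<open>G\<close> is a scalar multiple of the first argument plus one of the
  second plus a constant. After a character it is a sum of two functions of one argument each, so
  its mixed second difference vanishes.\<close>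

lemma trace_additive:
  assumes G: "pol A 2 G" and GN: "\<And>s t. s \<in> N \<Longrightarrow> t \<in> N \<Longrightarrow> G [s, t] \<in> N" and \<chi>: "character \<chi>"
    and st: "s \<in> N" "s' \<in> N" "t \<in> N" "t' \<in> N"
  shows "[\<chi> (cl (G [s, t])) + \<chi> (cl (G [s', t'])) = \<chi> (cl (G [s, t'])) + \<chi> (cl (G [s', t]))] (mod int p)"
proof -
  obtain tm where tm: "tm_wf A 2 tm" "\<And>xs. xs \<in> cube (car A) 2 \<Longrightarrow> G xs = tm_eval (ops A) xs tm"
    using G unfolding pol_def by blast
  have list2: "\<exists>a b. xs = [a, b]" if "length xs = 2" for xs :: "'a list"
    using that by (auto simp: numeral_2_eq_2 length_Suc_conv)
  \<comment> \<open>\<open>ind_pol\<close> speaks of functions on lists of classes, so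
    \<open>G\<close> is transported by choosing representatives; compatibility with
    \<open>\<gamma>\<close> makes the choice immaterial.\<close>
  define g where "g Xs = cl (tm_eval (ops A) (map (\<lambda>X. SOME x. x \<in> X) Xs) tm)" for Xs
  have tmG: "tm_eval (ops A) [a, b] tm = G [a, b]" if "a \<in> N" "b \<in> N" for a b
    by (rule tm(2)[symmetric]) (use that N_sub in \<open>auto simp: cube_def\<close>)
  have rep: "(SOME y. y \<in> cl x) \<in> N \<and> (x, SOME y. y \<in> cl x) \<in> \<gamma>" if "x \<in> N" for x
  proof -
    have "x \<in> cl x" using that e\<gamma>(2) N_sub by (auto simp: cl_def)
    then have "(SOME y. y \<in> cl x) \<in> cl x" by (rule someI)
    then show ?thesis by (auto simp: cl_def)
  qed
  have g_cl: "g [cl a, cl b] = cl (G [a, b])" if ab: "a \<in> N" "b \<in> N" for a b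
  proof -
    let ?a = "SOME x. x \<in> cl a" and ?b = "SOME x. x \<in> cl b"
    have "(G [a, b], G [?a, ?b]) \<in> \<gamma>"
      by (rule pol_Con[OF \<gamma> G]) (use rep ab in \<open>auto simp: less_Suc_eq numeral_2_eq_2\<close>)
    then have "cl (G [a, b]) = cl (G [?a, ?b])" using cl_eq_iff GN rep ab by simp
    then show ?thesis using tmG rep ab by (simp add: g_def)
  qed
  have "ind_pol A \<gamma> N 2 g"
    unfolding ind_pol_def
  proof (intro exI[of _ tm] conjI allI impI)
    show "tm_wf A 2 tm" by (rule tm(1))
  next
    fix xs :: "'a list" assume a: "length xs = 2 \<and> set xs \<subseteq> N"
    then obtain a b where "xs = [a, b]" using list2 by blast
    then show "tm_eval (ops A) xs tm \<in> N" using a tmG GN by simp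
  next
    fix xs :: "'a list" assume a: "length xs = 2 \<and> set xs \<subseteq> N"
    then obtain a b where "xs = [a, b]" using list2 by blast
    then show "g (map (\<lambda>x. (\<gamma> \<inter> N \<times> N) `` {x}) xs) = (\<gamma> \<inter> N \<times> N) `` {tm_eval (ops A) xs tm}"
      using a g_cl[of a b] tmG[of a b] by (simp add: cl_def)
  qed
  then obtain rs c where rs: "length rs = 2" "set rs \<subseteq> R" "c \<in> M"
    "\<And>Xs. Xs \<in> cube M 2 \<Longrightarrow> g Xs = foldr plus (map2 (\<lambda>r X. r X) rs Xs) c"
    using affine by blast
  obtain r1 r2 where r12: "rs = [r1, r2]" using rs(1) by (auto simp: numeral_2_eq_2 length_Suc_conv)
  have val: "[\<chi> (cl (G [a, b])) = \<chi> (r1 (cl a)) + (\<chi> (r2 (cl b)) + \<chi> c)] (mod int p)"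
    if ab: "a \<in> N" "b \<in> N" for a b
  proof -
    have eq: "cl (G [a, b]) = plus (r1 (cl a)) (plus (r2 (cl b)) c)"
      using g_cl[OF ab] rs(4)[of "[cl a, cl b]"] cl_in_M ab by (simp add: r12 cube_def)
    have M: "r1 (cl a) \<in> M" "r2 (cl b) \<in> M" using R_closed rs(2) r12 cl_in_M ab by auto
    then have M': "plus (r2 (cl b)) c \<in> M" using rs(3) plus_closed by blast
    have inner: "[\<chi> (plus (r2 (cl b)) c) = \<chi> (r2 (cl b)) + \<chi> c] (mod int p)"
      using \<chi> M(2) rs(3) unfolding character_def by blast
    have "[\<chi> (plus (r1 (cl a)) (plus (r2 (cl b)) c)) =
        \<chi> (r1 (cl a)) + \<chi> (plus (r2 (cl b)) c)] (mod int p)"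
      using \<chi> M(1) M' unfolding character_def by blast
    from cong_trans[OF this cong_add[OF cong_refl inner]] show ?thesis unfolding eq .
  qed
  have "[\<chi> (cl (G [s, t])) + \<chi> (cl (G [s', t'])) =
     (\<chi> (r1 (cl s)) + (\<chi> (r2 (cl t)) + \<chi> c)) + (\<chi> (r1 (cl s')) + (\<chi> (r2 (cl t')) + \<chi> c))] (mod int p)"
    by (rule cong_add[OF val[OF st(1,3)] val[OF st(2,4)]])
  also have "(\<chi> (r1 (cl s)) + (\<chi> (r2 (cl t)) + \<chi> c)) + (\<chi> (r1 (cl s')) + (\<chi> (r2 (cl t')) + \<chi> c)) =
     (\<chi> (r1 (cl s)) + (\<chi> (r2 (cl t')) + \<chi> c)) + (\<chi> (r1 (cl s')) + (\<chi> (r2 (cl t)) + \<chi> c))" by simp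
  finally have "[\<chi> (cl (G [s, t])) + \<chi> (cl (G [s', t'])) =
     (\<chi> (r1 (cl s)) + (\<chi> (r2 (cl t')) + \<chi> c)) + (\<chi> (r1 (cl s')) + (\<chi> (r2 (cl t)) + \<chi> c))] (mod int p)" .
  from cong_trans[OF this cong_sym[OF cong_add[OF val[OF st(1,4)] val[OF st(2,3)]]]] show ?thesis .
qed

lemma class_mem:
  assumes "C \<in> car A // \<delta>" "x \<in> C"
  shows "x \<in> car A" "y \<in> C \<Longrightarrow> (x, y) \<in> \<delta>" "(x, y) \<in> \<delta> \<Longrightarrow> y \<in> C"
proof -
  obtain a where "a \<in> car A" "C = \<delta> `` {a}" using assms(1) by (rule quotientE)
  then show "x \<in> car A" "y \<in> C \<Longrightarrow> (x, y) \<in> \<delta>" "(x, y) \<in> \<delta> \<Longrightarrow> y \<in> C"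
    using assms(2) e\<delta>(1)[of a x] e\<delta>(3)[of a x] e\<delta>(4)[of x a y] e\<delta>(4)[of a x y] by auto
qed

text \<open>The law spreads from the trace to whole \<open>\<delta>\<close>-classes, one argument
  after the other. In each argument the pairs that satisfy it form an equivalence which contains
  \<open>\<gamma>\<close> and all polynomial images of \<open>(u, v)\<close>, and
  \<open>prime_quot_generated\<close> enlarges it to \<open>\<delta>\<close>.\<close>

lemma class_additive:
  assumes G: "pol A 2 G" and C: "C1 \<in> car A // \<delta>" "C2 \<in> car A // \<delta>"
    and GN: "\<And>x y. x \<in> C1 \<Longrightarrow> y \<in> C2 \<Longrightarrow> G [x, y] \<in> N" and \<chi>: "character \<chi>"
    and xy: "x \<in> C1" "x' \<in> C1" "y \<in> C2" "y' \<in> C2"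
  shows "[\<chi> (cl (G [x, y])) + \<chi> (cl (G [x', y'])) = \<chi> (cl (G [x, y'])) + \<chi> (cl (G [x', y]))] (mod int p)"
proof -
  obtain u v where uvN: "u \<in> N" "v \<in> N" and uv: "(u, v) \<notin> \<gamma>" using N_\<gamma> by blast
  have uv\<delta>: "(u, v) \<in> \<delta>" using uvN N_\<delta> by blast
  define D where "D x x' y y' \<longleftrightarrow>
    [\<chi> (cl (G [x, y])) - \<chi> (cl (G [x', y])) = \<chi> (cl (G [x, y'])) - \<chi> (cl (G [x', y']))] (mod int p)"
    for x x' y y'
  have D_iff: "D x x' y y' \<longleftrightarrow> [\<chi> (cl (G [x, y])) + \<chi> (cl (G [x', y'])) =
      \<chi> (cl (G [x, y'])) + \<chi> (cl (G [x', y]))] (mod int p)" for x x' y y'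
    unfolding D_def cong_iff_dvd_diff by (simp add: algebra_simps)
  have D_refl1: "D x x y y'" and D_refl2: "D x x' y y" for x x' y y' by (simp_all add: D_def)
  have D_sym1: "D x x' y y' \<Longrightarrow> D x' x y y'" for x x' y y'
    unfolding D_iff by (simp add: cong_sym_eq add.commute)
  have D_sym2: "D x x' y y' \<Longrightarrow> D x x' y' y" for x x' y y'
    unfolding D_def by (rule cong_sym)
  have D_trans1: "D x x'' y y'" if "D x x' y y'" "D x' x'' y y'" for x x' x'' y y'
    using cong_add[OF that[unfolded D_def]] unfolding D_def by simp
  have D_trans2: "D x x' y y''" if "D x x' y y'" "D x x' y' y''" for x x' y y' y''
    using that unfolding D_def by (rule cong_trans)
  have G\<gamma>: "cl (G [x, y]) = cl (G [x', y'])"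
    if "(x, x') \<in> \<gamma>" "(y, y') \<in> \<gamma>" "x \<in> C1" "x' \<in> C1" "y \<in> C2" "y' \<in> C2" for x x' y y'
  proof -
    have "(G [x, y], G [x', y']) \<in> \<gamma>"
      by (rule pol_Con[OF \<gamma> G]) (use that in \<open>auto simp: less_Suc_eq numeral_2_eq_2\<close>)
    then show ?thesis using cl_eq_iff GN that by simp
  qed
  have base: "D (h u) (h v) (h' u) (h' v)"
    if h: "pol_unary A h" "h u \<in> C1" and h': "pol_unary A h'" "h' u \<in> C2" for h h'
  proof -
    have hN: "h s \<in> C1" "h' s \<in> C2" if "s \<in> N" for s
    proof -
      have us: "(u, s) \<in> \<delta>" using that uvN N_\<delta> by blast
      show "h s \<in> C1" using class_mem(3)[OF C(1) h(2)] pol_unary_Con[OF \<delta> h(1) us] by blast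
      show "h' s \<in> C2" using class_mem(3)[OF C(2) h'(2)] pol_unary_Con[OF \<delta> h'(1) us] by blast
    qed
    have "pol A 2 (\<lambda>xs. G (map (\<lambda>F. F xs) [\<lambda>xs. h (xs ! 0), \<lambda>xs. h' (xs ! 1)]))"
      using pol_comp_unary[OF fin h(1) pol_var[of 0 2]] pol_comp_unary[OF fin h'(1) pol_var[of 1 2]]
      by (intro pol_comp[OF fin G]) auto
    then have "pol A 2 (\<lambda>xs. G [h (xs ! 0), h' (xs ! 1)])" by simp
    from trace_additive[OF this _ \<chi>, of u v u v] show ?thesis
      unfolding D_iff using GN hN uvN by simp
  qed
  have step1: "D x x' (h' u) (h' v)" if h': "pol_unary A h'" "h' u \<in> C2" and x: "x \<in> C1" "x' \<in> C1" for h' x x'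
  proof -
    \<comment> \<open>Outside \<open>C1\<close> nothing is required, which makes \<open>T\<close> an
      equivalence on the whole carrier and leaves polynomial images of \<open>(u, v)\<close> in
      other classes unconstrained.\<close>
    define T where "T = {(x, x'). (x, x') \<in> \<delta> \<and> (x \<in> C1 \<longrightarrow> D x x' (h' u) (h' v))}"
    have h'v: "h' v \<in> C2" using class_mem(3)[OF C(2) h'(2)] pol_unary_Con[OF \<delta> h'(1) uv\<delta>] by blast
    have "equiv (car A) T"
    proof (rule equivI)
      show "T \<subseteq> car A \<times> car A" using e\<delta>(1) by (auto simp: T_def)
      show "refl_on (car A) T" unfolding T_def refl_on_def using e\<delta>(2) D_refl1 by blast
      show "sym T" unfolding T_def sym_def using e\<delta>(3) D_sym1 class_mem(3)[OF C(1)] by blast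
      show "trans T" unfolding T_def trans_def using e\<delta>(4) D_trans1 class_mem(3)[OF C(1)] by blast
    qed
    moreover have "\<gamma> \<subseteq> T"
    proof clarify
      fix a b assume ab: "(a, b) \<in> \<gamma>"
      have "D a b (h' u) (h' v)" if a: "a \<in> C1"
      proof -
        have b: "b \<in> C1" using class_mem(3)[OF C(1) a] ab \<gamma>_sub_\<delta> by blast
        have hc: "h' u \<in> car A" "h' v \<in> car A" using h'(2) h'v class_mem(1)[OF C(2)] by auto
        show ?thesis
          using G\<gamma>[OF ab e\<gamma>(2)[OF hc(1)] a b h'(2) h'(2)] G\<gamma>[OF ab e\<gamma>(2)[OF hc(2)] a b h'v h'v]
          by (simp add: D_def)
      qed
      then show "(a, b) \<in> T" using ab \<gamma>_sub_\<delta> by (auto simp: T_def)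
    qed
    moreover have "(h u, h v) \<in> T" if "pol_unary A h" for h
      using base[OF that _ h'] pol_unary_Con[OF \<delta> that uv\<delta>] by (auto simp: T_def)
    ultimately have "\<delta> \<subseteq> T" by (rule prime_quot_generated[OF fin pq uv\<delta> uv])
    then show ?thesis using x class_mem(2)[OF C(1)] by (auto simp: T_def)
  qed
  \<comment> \<open>The same argument in the second variable, with \<open>step1\<close> now playing
    the role of \<open>base\<close>.\<close>
  define T where "T = {(y, y'). (y, y') \<in> \<delta> \<and> (y \<in> C2 \<longrightarrow> D x x' y y')}"
  have "equiv (car A) T"
  proof (rule equivI)
    show "T \<subseteq> car A \<times> car A" using e\<delta>(1) by (auto simp: T_def)
    show "refl_on (car A) T" unfolding T_def refl_on_def using e\<delta>(2) D_refl2 by blast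
    show "sym T" unfolding T_def sym_def using e\<delta>(3) D_sym2 class_mem(3)[OF C(2)] by blast
    show "trans T" unfolding T_def trans_def using e\<delta>(4) D_trans2 class_mem(3)[OF C(2)] by blast
  qed
  moreover have "\<gamma> \<subseteq> T"
  proof clarify
    fix a b assume ab: "(a, b) \<in> \<gamma>"
    have "D x x' a b" if a: "a \<in> C2"
    proof -
      have b: "b \<in> C2" using class_mem(3)[OF C(2) a] ab \<gamma>_sub_\<delta> by blast
      have xc: "x \<in> car A" "x' \<in> car A" using xy class_mem(1)[OF C(1)] by auto
      show ?thesis
        using G\<gamma>[OF e\<gamma>(2)[OF xc(1)] ab xy(1) xy(1) a b] G\<gamma>[OF e\<gamma>(2)[OF xc(2)] ab xy(2) xy(2) a b]
        by (simp add: D_def)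
    qed
    then show "(a, b) \<in> T" using ab \<gamma>_sub_\<delta> by (auto simp: T_def)
  qed
  moreover have "(h u, h v) \<in> T" if "pol_unary A h" for h
    using step1[OF that _ xy(1,2)] pol_unary_Con[OF \<delta> that uv\<delta>] by (auto simp: T_def)
  ultimately have "\<delta> \<subseteq> T" by (rule prime_quot_generated[OF fin pq uv\<delta> uv])
  then show ?thesis using xy class_mem(2)[OF C(2)] unfolding T_def D_iff by auto
qed

text \<open>By \<open>class_additive\<close> the effect of changing one coordinate does not depend
  on the others. It may therefore be measured at the base point \<open>z\<close>, and the effects
  add up along the hybrids from \<open>z\<close> to \<open>xs\<close>.\<close>

lemma polynomial_affine:
  assumes F: "pol A k F" and Cs: "length Cs = k" "\<And>i. i < k \<Longrightarrow> Cs ! i \<in> car A // \<delta>"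
    and FN: "\<And>xs. length xs = k \<Longrightarrow> (\<And>i. i < k \<Longrightarrow> xs ! i \<in> Cs ! i) \<Longrightarrow> F xs \<in> N"
    and \<chi>: "character \<chi>"
    and z: "length z = k" "\<And>i. i < k \<Longrightarrow> z ! i \<in> Cs ! i"
    and xs: "length xs = k" "\<And>i. i < k \<Longrightarrow> xs ! i \<in> Cs ! i"
  shows "[\<chi> (cl (F xs)) = \<chi> (cl (F z)) + (\<Sum>i<k. \<chi> (cl (F (z[i := xs ! i]))) - \<chi> (cl (F z)))] (mod int p)"
proof -
  define X where "X y = \<chi> (cl (F y))" for y
  have cubeI: "y \<in> cube (car A) k" if "length y = k" "\<And>i. i < k \<Longrightarrow> y ! i \<in> Cs ! i" for y
    using that Cs(2) class_mem(1) unfolding in_cube_iff by blast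
  have mix: "length (take m xs @ drop m z) = k"
    "\<And>i. i < k \<Longrightarrow> (take m xs @ drop m z) ! i \<in> Cs ! i" if "m \<le> k" for m
    using that xs z nth_take_drop_append[OF z(1) xs(1)] by auto
  have step: "[X (y[m := xs ! m]) - X (y[m := z ! m]) = X (z[m := xs ! m]) - X (z[m := z ! m])] (mod int p)"
    if m: "m < k" and y: "length y = k" "\<And>i. i < k \<Longrightarrow> y ! i \<in> Cs ! i" for m y
  proof -
    let ?R = "{(a, b). [a = b] (mod int p)}"
    let ?Df = "\<lambda>y. X (y[m := xs ! m]) - X (y[m := z ! m])"
    have "(?Df z, ?Df y) \<in> ?R"
    proof (rule change_coordinatewise[where F = ?Df, OF z(1) y(1)])
      show "trans ?R" by (auto simp: trans_def intro: cong_trans)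
      fix l assume l: "l < k"
      define q where "q = take l y @ drop l z"
      have q: "length q = k" "\<And>i. i < k \<Longrightarrow> q ! i \<in> Cs ! i"
        unfolding q_def using l y z nth_take_drop_append[OF z(1) y(1)] by auto
      \<comment> \<open>For \<open>l = m\<close> the difference \<open>?Df\<close> overwrites the
        changed coordinate. Otherwise only coordinates \<open>m\<close> and \<open>l\<close> vary,
        which is the situation of \<open>class_additive\<close>.\<close>
      have "[?Df (q[l := z ! l]) = ?Df (q[l := y ! l])] (mod int p)"
      proof (cases "l = m")
        case False
        have G: "pol A 2 (\<lambda>st. F (q[m := st ! 0, l := st ! 1]))"
          by (rule pol_update2[OF fin F cubeI[OF q] pol_var pol_var]) auto
        have "[\<chi> (cl (F (q[m := [a, b] ! 0, l := [a, b] ! 1]))) + \<chi> (cl (F (q[m := [a', b'] ! 0, l := [a', b'] ! 1]))) =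
            \<chi> (cl (F (q[m := [a, b'] ! 0, l := [a, b'] ! 1]))) + \<chi> (cl (F (q[m := [a', b] ! 0, l := [a', b] ! 1])))] (mod int p)"
          if "a \<in> Cs ! m" "a' \<in> Cs ! m" "b \<in> Cs ! l" "b' \<in> Cs ! l" for a a' b b'
        proof (rule class_additive[OF G Cs(2)[OF m] Cs(2)[OF l] _ \<chi> that])
          fix x y assume "x \<in> Cs ! m" "y \<in> Cs ! l"
          then show "F (q[m := [x, y] ! 0, l := [x, y] ! 1]) \<in> N"
            using q m l by (intro FN) (auto simp: nth_list_update)
        qed
        from this[of "xs ! m" "z ! m" "z ! l" "y ! l"]
        have "[X (q[m := xs ! m, l := z ! l]) + X (q[m := z ! m, l := y ! l]) =
            X (q[m := xs ! m, l := y ! l]) + X (q[m := z ! m, l := z ! l])] (mod int p)"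
          using xs z y m l by (simp add: X_def)
        then show ?thesis unfolding cong_iff_dvd_diff
          by (simp add: list_update_swap[OF False] algebra_simps)
      qed simp
      then show "let q = take l y @ drop l z in (?Df (q[l := z ! l]), ?Df (q[l := y ! l])) \<in> ?R"
        by (simp add: q_def)
    qed simp
    then show ?thesis by (simp add: cong_sym_eq)
  qed
  have "[X (take m xs @ drop m z) = X z + (\<Sum>i<m. X (z[i := xs ! i]) - X z)] (mod int p)" if "m \<le> k" for m
    using that
  proof (induction m)
    case (Suc m)
    let ?q = "take m xs @ drop m z"
    have m: "m < k" using Suc by simp
    have q1: "?q[m := z ! m] = ?q" using m z xs
      by (intro list_update_same_conv[THEN iffD2]) (auto simp: nth_take_drop_append[OF z(1) xs(1)])
    have q2: "?q[m := xs ! m] = take (Suc m) xs @ drop (Suc m) z" using m z xs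
      by (auto simp: list_eq_iff_nth_eq nth_append nth_list_update less_Suc_eq)
    have "[X (take (Suc m) xs @ drop (Suc m) z) - X ?q = X (z[m := xs ! m]) - X z] (mod int p)"
      using step[OF m, of ?q] mix[of m] m q1 q2 by simp
    from cong_add[OF this Suc.IH] m show ?case by (simp add: algebra_simps)
  qed simp
  from this[of k] show ?thesis using xs z by (simp add: X_def)
qed

text \<open>Reduction modulo \<open>p\<close> makes the set finite. The value zero outside
  \<open>C\<close> allows a coordinate to be evaluated at a gate whose class is not known to be
  \<open>C\<close>.\<close>

definition coords :: "'a set \<Rightarrow> ('a \<Rightarrow> int) set" where
  "coords C = {\<phi>. (\<forall>x. x \<notin> C \<longrightarrow> \<phi> x = 0) \<and> (\<exists>f \<chi>. pol_unary A f \<and> f ` C \<subseteq> N \<and> character \<chi> \<and>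
     (\<forall>x\<in>C. \<phi> x = \<chi> (cl (f x)) mod int p))}"

lemma finite_coords: "C \<in> car A // \<delta> \<Longrightarrow> finite (coords C)"
proof -
  assume C: "C \<in> car A // \<delta>"
  then have "C \<subseteq> car A" using class_mem(1) by blast
  then have "finite C" using fin finite_subset by (auto simp: finite_alg_def)
  then have "finite {\<phi> :: 'a \<Rightarrow> int. \<forall>x. (x \<in> C \<longrightarrow> \<phi> x \<in> {0..<int p}) \<and> (x \<notin> C \<longrightarrow> \<phi> x = 0)}"
    by (rule finite_set_of_finite_funs) simp
  moreover have "coords C \<subseteq> {\<phi>. \<forall>x. (x \<in> C \<longrightarrow> \<phi> x \<in> {0..<int p}) \<and> (x \<notin> C \<longrightarrow> \<phi> x = 0)}"
    using p prime_gt_0_nat by (auto simp: coords_def)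
  ultimately show ?thesis by (rule finite_subset[rotated])
qed

lemma coords_\<gamma>:
  assumes "C \<in> car A // \<delta>" "\<phi> \<in> coords C" "x \<in> C" "(x, y) \<in> \<gamma>"
  shows "\<phi> x = \<phi> y"
proof -
  obtain f \<chi> where f: "pol_unary A f" "f ` C \<subseteq> N" "\<forall>x\<in>C. \<phi> x = \<chi> (cl (f x)) mod int p"
    using assms(2) by (auto simp: coords_def)
  have y: "y \<in> C" using class_mem(3)[OF assms(1,3)] assms(4) \<gamma>_sub_\<delta> by blast
  have "cl (f x) = cl (f y)"
    using cl_eq_iff f(2) assms(3) y pol_unary_Con[OF \<gamma> f(1) assms(4)] by auto
  then show ?thesis using f(3) assms(3) y by simp
qed

text \<open>Otherwise every polynomial sending \<open>C\<close> into \<open>N\<close> identifies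
  \<open>x\<close> and \<open>y\<close> modulo \<open>\<gamma>\<close>, in particular each
  \<open>e \<circ> h\<close> that meets \<open>N\<close> on \<open>C\<close>. Since
  \<open>(x, y)\<close> generates \<open>\<delta>\<close>, the map \<open>e\<close> would then
  collapse \<open>N\<close> modulo \<open>\<gamma>\<close>, although it is the identity
  there.\<close>

lemma coords_separate:
  assumes sep: "\<And>X Y. X \<in> M \<Longrightarrow> Y \<in> M \<Longrightarrow> X \<noteq> Y \<Longrightarrow> \<exists>\<chi>. character \<chi> \<and> \<not> [\<chi> X = \<chi> Y] (mod int p)"
    and C: "C \<in> car A // \<delta>" and xy: "x \<in> C" "y \<in> C" and eq: "\<And>\<phi>. \<phi> \<in> coords C \<Longrightarrow> \<phi> x = \<phi> y"
  shows "(x, y) \<in> \<gamma>"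
proof (rule ccontr)
  assume n: "(x, y) \<notin> \<gamma>"
  have xy\<delta>: "(x, y) \<in> \<delta>" using class_mem(2)[OF C xy] .
  have same: "(f x, f y) \<in> \<gamma>" if f: "pol_unary A f" "f ` C \<subseteq> N" for f
  proof (rule ccontr)
    assume "(f x, f y) \<notin> \<gamma>"
    then have "cl (f x) \<noteq> cl (f y)" using cl_eq_iff f(2) xy by auto
    then obtain \<chi> where \<chi>: "character \<chi>" "\<not> [\<chi> (cl (f x)) = \<chi> (cl (f y))] (mod int p)"
      using sep[of "cl (f x)" "cl (f y)"] cl_in_M f(2) xy by blast
    define \<phi> where "\<phi> a = (if a \<in> C then \<chi> (cl (f a)) mod int p else 0)" for a
    have "\<phi> \<in> coords C" using f \<chi>(1) by (auto simp: coords_def \<phi>_def)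
    then have "\<phi> x = \<phi> y" by (rule eq)
    then show False using xy \<chi>(2) by (simp add: \<phi>_def cong_def)
  qed
  define T where "T = {(a, b). (a, b) \<in> \<delta> \<and> (e a \<in> N \<longrightarrow> (e a, e b) \<in> \<gamma>)}"
  have "equiv (car A) T"
  proof (rule equivI)
    show "T \<subseteq> car A \<times> car A" using e\<delta>(1) by (auto simp: T_def)
    show "refl_on (car A) T" unfolding T_def refl_on_def
      using e\<delta>(2) e\<gamma>(2) N_sub by blast
    show "sym T" unfolding T_def sym_def using e\<delta>(3) e\<gamma>(3) e_N by blast
    show "trans T" unfolding T_def trans_def using e\<delta>(4) e\<gamma>(4) e_N by blast
  qed
  moreover have "\<gamma> \<subseteq> T" unfolding T_def using \<gamma>_sub_\<delta> pol_unary_Con[OF \<gamma> e] by blast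
  moreover have "(h x, h y) \<in> T" if h: "pol_unary A h" for h
  proof -
    have "(e (h x), e (h y)) \<in> \<gamma>" if eN: "e (h x) \<in> N"
    proof (rule same)
      show "pol_unary A (\<lambda>a. e (h a))" by (rule pol_unary_comp[OF fin e h])
      show "(\<lambda>a. e (h a)) ` C \<subseteq> N"
        using e_N[OF pol_unary_Con[OF \<delta> h class_mem(2)[OF C xy(1)]] eN] by blast
    qed
    then show ?thesis using pol_unary_Con[OF \<delta> h xy\<delta>] by (simp add: T_def)
  qed
  ultimately have "\<delta> \<subseteq> T" by (rule prime_quot_generated[OF fin pq xy\<delta> n])
  then have "N \<times> N \<subseteq> T" using N_\<delta> by blast
  then have "N \<times> N \<subseteq> \<gamma>" using e_id by (fastforce simp: T_def)
  then show False using N_\<gamma> by blast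
qed

text \<open>Each summand of \<open>polynomial_affine\<close> is a unary polynomial into
  \<open>N\<close> followed by \<open>\<chi>\<close>, hence again a coordinate. This closure lets
  the coordinates of gates satisfy a recurrence among themselves; the values at the base point go
  into \<open>c\<close>.\<close>

lemma coords_affine:
  assumes j: "j < length (ops A)" and k: "k = fst (ops A ! j)" and Cs: "length Cs = k"
    and CsQ: "\<And>i. i < k \<Longrightarrow> Cs ! i \<in> car A // \<delta>" and \<phi>: "\<phi> \<in> coords C"
    and fC: "\<And>xs. length xs = k \<Longrightarrow> (\<And>i. i < k \<Longrightarrow> xs ! i \<in> Cs ! i) \<Longrightarrow> snd (ops A ! j) xs \<in> C"
  shows "\<exists>c \<phi>s. (\<forall>i<k. \<phi>s i \<in> coords (Cs ! i)) \<and>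
    (\<forall>xs. length xs = k \<and> (\<forall>i<k. xs ! i \<in> Cs ! i) \<longrightarrow>
       [\<phi> (snd (ops A ! j) xs) = c + (\<Sum>i<k. \<phi>s i (xs ! i))] (mod int p))"
proof -
  obtain f \<chi> where f: "pol_unary A f" "f ` C \<subseteq> N" "character \<chi>" "\<forall>x\<in>C. \<phi> x = \<chi> (cl (f x)) mod int p"
    using \<phi> by (auto simp: coords_def)
  define F where "F xs = f (snd (ops A ! j) xs)" for xs
  have F: "pol A k F" unfolding F_def k by (rule pol_comp_unary[OF fin f(1) pol_op[OF j]])
  have FN: "F xs \<in> N" if "length xs = k" "\<And>i. i < k \<Longrightarrow> xs ! i \<in> Cs ! i" for xs
    using fC[OF that] f(2) by (auto simp: F_def)
  have "\<exists>x. x \<in> Cs ! i" if "i < k" for i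
    using CsQ[OF that] e\<delta>(2) by (auto elim!: quotientE)
  then obtain zf where zf: "\<And>i. i < k \<Longrightarrow> zf i \<in> Cs ! i" by metis
  define z where "z = map zf [0..<k]"
  have z: "length z = k" "\<And>i. i < k \<Longrightarrow> z ! i \<in> Cs ! i" using zf by (auto simp: z_def)
  have zc: "z \<in> cube (car A) k" using z CsQ class_mem(1) unfolding in_cube_iff by blast
  define \<phi>s where "\<phi>s i x = (if x \<in> Cs ! i then \<chi> (cl (F (z[i := x]))) mod int p else 0)" for i x
  show ?thesis
  proof (intro exI[of _ "\<chi> (cl (F z)) - (\<Sum>i<k. \<chi> (cl (F z)))"] exI[of _ \<phi>s] conjI allI impI)
    fix i assume i: "i < k"
    have "(\<lambda>x. F (z[i := x])) ` (Cs ! i) \<subseteq> N"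
      using z i by (auto intro!: FN simp: nth_list_update)
    then show "\<phi>s i \<in> coords (Cs ! i)"
      unfolding coords_def using pol_unary_update[OF fin F zc, of i] f(3)
      by (auto simp: \<phi>s_def intro!: exI[of _ "\<lambda>x. F (z[i := x])"] exI[of _ \<chi>])
  next
    fix xs assume xs: "length xs = k \<and> (\<forall>i<k. xs ! i \<in> Cs ! i)"
    have "\<phi> (snd (ops A ! j) xs) = \<chi> (cl (F xs)) mod int p"
      using f(4) fC xs by (simp add: F_def)
    moreover have "[\<chi> (cl (F xs)) = \<chi> (cl (F z)) + (\<Sum>i<k. \<chi> (cl (F (z[i := xs ! i]))) - \<chi> (cl (F z)))] (mod int p)"
      by (rule polynomial_affine[OF F Cs CsQ FN f(3) z]) (use xs in auto)
    moreover have "[\<chi> (cl (F z)) - (\<Sum>i<k. \<chi> (cl (F z))) + (\<Sum>i<k. \<chi> (cl (F (z[i := xs ! i])))) =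
        \<chi> (cl (F z)) - (\<Sum>i<k. \<chi> (cl (F z))) + (\<Sum>i<k. \<phi>s i (xs ! i))] (mod int p)"
      using xs by (intro cong_add cong_refl cong_sum) (auto simp: \<phi>s_def cong_def)
    ultimately show "[\<phi> (snd (ops A ! j) xs) =
       \<chi> (cl (F z)) - (\<Sum>i<k. \<chi> (cl (F z))) + (\<Sum>i<k. \<phi>s i (xs ! i))] (mod int p)"
      unfolding cong_def sum_subtractf by (simp add: algebra_simps)
  qed
qed

end

text \<open>The interface between the algebra and the programs: everything that the construction of
  a layer uses about a quotient of type 2.\<close>

definition affine_coords ::
  "'a alg \<Rightarrow> ('a \<times> 'a) set \<Rightarrow> ('a \<times> 'a) set \<Rightarrow> nat \<Rightarrow> ('a set \<Rightarrow> ('a \<Rightarrow> int) set) \<Rightarrow> bool" where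
  "affine_coords A \<gamma> \<delta> p \<Phi> \<longleftrightarrow> prime p \<and> (\<forall>C \<in> car A // \<delta>. finite (\<Phi> C)) \<and>
     (\<forall>C \<in> car A // \<delta>. \<forall>\<phi> \<in> \<Phi> C. \<forall>x. x \<notin> C \<longrightarrow> \<phi> x = 0) \<and>
     (\<forall>C \<in> car A // \<delta>. \<forall>x \<in> C. \<forall>y \<in> C. (x, y) \<in> \<gamma> \<longleftrightarrow> (\<forall>\<phi> \<in> \<Phi> C. \<phi> x = \<phi> y)) \<and>
     (\<forall>C \<in> car A // \<delta>. \<forall>\<phi> \<in> \<Phi> C. \<forall>x \<in> C. \<phi> x \<in> {0..<int p}) \<and>
     (\<forall>j < length (ops A). \<forall>Cs C \<phi>. length Cs = fst (ops A ! j) \<and> set Cs \<subseteq> car A // \<delta> \<and> \<phi> \<in> \<Phi> C \<and>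
        (\<forall>xs. list_all2 (\<in>) xs Cs \<longrightarrow> snd (ops A ! j) xs \<in> C) \<longrightarrow>
        (\<exists>c \<phi>s. (\<forall>i < length Cs. \<phi>s i \<in> \<Phi> (Cs ! i)) \<and> (\<forall>xs. list_all2 (\<in>) xs Cs \<longrightarrow>
           [\<phi> (snd (ops A ! j) xs) = c + (\<Sum>i<length Cs. \<phi>s i (xs ! i))] (mod int p))))"

lemma has_type2_affine_coords:
  assumes fin: "finite_alg A" and pq: "prime_quot A \<gamma> \<delta>" and t2: "has_type2 A \<gamma> \<delta>"
  shows "\<exists>p \<Phi>. affine_coords A \<gamma> \<delta> p \<Phi>"
proof -
  obtain N where tr: "is_trace A \<gamma> \<delta> N" and ty: "type2_min A \<gamma> N" using t2 by (auto simp: has_type2_def)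
  obtain U b where U: "min_set A \<gamma> \<delta> U" "b \<in> U" "N = U \<inter> \<delta> `` {b}" and N\<gamma>: "\<not> N \<times> N \<subseteq> \<gamma>"
    using tr unfolding is_trace_def by blast
  have \<gamma>: "\<gamma> \<in> Con A" and \<delta>: "\<delta> \<in> Con A" using pq unfolding prime_quot_def by auto
  note e\<delta> = equivD[OF Con_equiv[OF \<delta>]]
  define M where "M = N // (\<gamma> \<inter> N \<times> N)"
  obtain plus zero neg R where
    z: "zero \<in> M" and pc: "\<forall>x \<in> M. \<forall>y \<in> M. plus x y \<in> M" and nc: "\<forall>x \<in> M. neg x \<in> M"
    and as: "\<forall>x \<in> M. \<forall>y \<in> M. \<forall>z \<in> M. plus (plus x y) z = plus x (plus y z)"
    and co: "\<forall>x \<in> M. \<forall>y \<in> M. plus x y = plus y x"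
    and zl: "\<forall>x \<in> M. plus zero x = x" and nl: "\<forall>x \<in> M. plus (neg x) x = zero"
    and Rh: "\<forall>r \<in> R. (\<forall>x \<in> M. r x \<in> M) \<and> (\<forall>x \<in> M. \<forall>y \<in> M. r (plus x y) = plus (r x) (r y))"
    and Rid: "\<exists>r \<in> R. \<forall>x \<in> M. r x = x" and R0: "\<exists>r \<in> R. \<forall>x \<in> M. r x = zero"
    and Rp: "\<forall>r \<in> R. \<forall>s \<in> R. (\<exists>u \<in> R. \<forall>x \<in> M. u x = plus (r x) (s x)) \<and>
                           (\<exists>u \<in> R. \<forall>x \<in> M. u x = r (s x))"
    and Ri: "\<forall>r \<in> R. (\<exists>x \<in> M. r x \<noteq> zero) \<longrightarrow> inj_on r M"
    and aff: "\<forall>n g. ind_pol A \<gamma> N n g \<longleftrightarrow>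
          (\<exists>rs c. length rs = n \<and> set rs \<subseteq> R \<and> c \<in> M \<and>
             (\<forall>Xs \<in> cube M n. g Xs = foldr plus (map2 (\<lambda>r X. r X) rs Xs) c))"
    using ty unfolding type2_min_def Let_def M_def[symmetric]
    by - (elim exE conjE, rule that, assumption+)
  obtain e where e: "pol_unary A e" "e ` car A \<subseteq> U" "\<forall>x\<in>U. e x = x"
    using min_set_idempotent[OF fin pq U(1)] by blast
  have Nc: "N \<subseteq> car A" using U(3) e\<delta>(1) by blast
  have N\<delta>: "N \<times> N \<subseteq> \<delta>" using U(3) e\<delta>(3,4) by blast
  define G where "G = \<lparr>carrier = M, monoid.mult = plus, one = zero\<rparr>"
  have G: "comm_group G"
    by (rule comm_groupI) (use z pc as co zl nl nc in \<open>auto simp: G_def\<close>)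
  have sel: "carrier G = M" "\<one>\<^bsub>G\<^esub> = zero" "\<And>x y. x \<otimes>\<^bsub>G\<^esub> y = plus x y" by (simp_all add: G_def)
  have finN: "finite N" using Nc fin finite_subset by (auto simp: finite_alg_def)
  then have finM: "finite M" unfolding M_def by (rule finite_quotient) auto
  have nontriv: "carrier G \<noteq> {\<one>\<^bsub>G\<^esub>}"
  proof
    assume "carrier G = {\<one>\<^bsub>G\<^esub>}"
    then have M1: "\<And>X. X \<in> M \<Longrightarrow> X = zero" by (simp add: sel)
    have "(x, y) \<in> \<gamma>" if "x \<in> N" "y \<in> N" for x y
    proof -
      have "(\<gamma> \<inter> N \<times> N) `` {x} = (\<gamma> \<inter> N \<times> N) `` {y}"
        using M1[of "(\<gamma> \<inter> N \<times> N) `` {x}"] M1[of "(\<gamma> \<inter> N \<times> N) `` {y}"] that quotientI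
        unfolding M_def by metis
      moreover have "(y, y) \<in> \<gamma>" using equivD(2)[OF Con_equiv[OF \<gamma>]] that Nc by blast
      ultimately show ?thesis using that by blast
    qed
    then show False using N\<gamma> by blast
  qed
  have "\<exists>p::nat. prime p \<and> (\<forall>x\<in>carrier G. x [^]\<^bsub>G\<^esub> p = \<one>\<^bsub>G\<^esub>)"
    by (rule division_ring_prime_exponent[OF G, where R = R]) (use finM nontriv Rid R0 Rp Ri in \<open>auto simp: sel\<close>)
  then obtain p :: nat where pp: "prime p" "\<And>x. x \<in> carrier G \<Longrightarrow> x [^]\<^bsub>G\<^esub> p = \<one>\<^bsub>G\<^esub>" by blast
  interpret affine_trace A \<gamma> \<delta> N e plus R p
  proof
    show "e x = x" if "x \<in> N" for x using that e(3) U(3) by blast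
    show "e y \<in> N" if "(x, y) \<in> \<delta>" "e x \<in> N" for x y
      using that e(2) e\<delta>(1)[OF that(1)] e\<delta>(4) pol_unary_Con[OF \<delta> e(1) that(1)] unfolding U(3) by blast
    show "\<exists>rs c. length rs = 2 \<and> set rs \<subseteq> R \<and> c \<in> N // (\<gamma> \<inter> N \<times> N) \<and>
        (\<forall>Xs \<in> cube (N // (\<gamma> \<inter> N \<times> N)) 2. g Xs = foldr plus (map2 (\<lambda>r X. r X) rs Xs) c)"
      if "ind_pol A \<gamma> N 2 g" for g using that aff unfolding M_def by blast
  qed (use fin pq Nc N\<delta> N\<gamma> e(1) pc Rh pp(1) in \<open>auto simp: M_def\<close>)
  have sep: "\<exists>\<chi>. character \<chi> \<and> \<not> [\<chi> X = \<chi> Y] (mod int p)" if XY: "X \<in> M" "Y \<in> M" "X \<noteq> Y" for X Y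
  proof -
    interpret G: comm_group G by (rule G)
    define Z where "Z = X \<otimes>\<^bsub>G\<^esub> inv\<^bsub>G\<^esub> Y"
    have XYG: "X \<in> carrier G" "Y \<in> carrier G" using XY by (auto simp: sel)
    have Z: "Z \<in> carrier G" "X = Z \<otimes>\<^bsub>G\<^esub> Y"
      using XYG by (auto simp: Z_def G.m_assoc)
    then have "Z \<noteq> \<one>\<^bsub>G\<^esub>" using XYG XY(3) by auto
    then obtain \<chi> :: "'a set \<Rightarrow> int" where \<chi>: "\<forall>a\<in>carrier G. \<forall>b\<in>carrier G. [\<chi> (a \<otimes>\<^bsub>G\<^esub> b) = \<chi> a + \<chi> b] (mod int p)"
      "\<not> [\<chi> Z = 0] (mod int p)"
      using G.elementary_abelian_separating_character[OF _ pp(1) pp(2) Z(1)] finM by (auto simp: sel)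
    have "character \<chi>" using \<chi>(1) by (simp add: character_def sel M_def)
    moreover have "\<not> [\<chi> X = \<chi> Y] (mod int p)"
    proof
      assume "[\<chi> X = \<chi> Y] (mod int p)"
      moreover have "[\<chi> X = \<chi> Z + \<chi> Y] (mod int p)" using \<chi>(1) Z XYG by blast
      ultimately have "[\<chi> Z + \<chi> Y = 0 + \<chi> Y] (mod int p)" by (metis add_0 cong_sym cong_trans)
      then show False using \<chi>(2) by (simp only: cong_add_rcancel)
    qed
    ultimately show ?thesis by blast
  qed
  have "affine_coords A \<gamma> \<delta> p coords"
    unfolding affine_coords_def
  proof (intro conjI ballI allI impI)
    show "prime p" by (rule pp)
    show "finite (coords C)" if "C \<in> car A // \<delta>" for C by (rule finite_coords[OF that])
    show "\<phi> x = 0" if "\<phi> \<in> coords C" "x \<notin> C" for C \<phi> x using that by (auto simp: coords_def)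
    show "\<phi> x \<in> {0..<int p}" if "\<phi> \<in> coords C" "x \<in> C" for C \<phi> x
      using that prime_gt_0_nat[OF pp(1)] by (auto simp: coords_def)
    show "(x, y) \<in> \<gamma> \<longleftrightarrow> (\<forall>\<phi>\<in>coords C. \<phi> x = \<phi> y)" if "C \<in> car A // \<delta>" "x \<in> C" "y \<in> C" for C x y
      using coords_\<gamma>[OF that(1) _ that(2)] coords_separate[OF _ that(1,2,3)] sep unfolding M_def by blast
    fix j Cs C \<phi> assume j: "j < length (ops A)" and a: "length Cs = fst (ops A ! j) \<and> set Cs \<subseteq> car A // \<delta> \<and>
        \<phi> \<in> coords C \<and> (\<forall>xs. list_all2 (\<in>) xs Cs \<longrightarrow> snd (ops A ! j) xs \<in> C)"
    have la: "list_all2 (\<in>) xs Cs \<longleftrightarrow> length xs = length Cs \<and> (\<forall>i<length Cs. xs ! i \<in> Cs ! i)" for xs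
      by (auto simp: list_all2_conv_all_nth)
    show "\<exists>c \<phi>s. (\<forall>i < length Cs. \<phi>s i \<in> coords (Cs ! i)) \<and> (\<forall>xs. list_all2 (\<in>) xs Cs \<longrightarrow>
           [\<phi> (snd (ops A ! j) xs) = c + (\<Sum>i<length Cs. \<phi>s i (xs ! i))] (mod int p))"
      unfolding la by (rule coords_affine[OF j, where C = C]) (use a nth_mem in \<open>auto simp: la\<close>)
  qed
  then show ?thesis by blast
qed

section \<open>Rank functions of the totally ordered quotients\<close>

lemma car_quot: "car (quot A \<theta>) = car A // \<theta>"
  by (simp add: car_def quot_def)

lemma length_ops_quot [simp]: "length (ops (quot A \<theta>)) = length (ops A)"
  by (simp add: ops_def quot_def)

lemma fst_ops_quot [simp]: "j < length (ops A) \<Longrightarrow> fst (ops (quot A \<theta>) ! j) = fst (ops A ! j)"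
  by (simp add: ops_def quot_def case_prod_unfold)

lemma quot_op:
  assumes \<theta>: "\<theta> \<in> Con A" and j: "j < length (ops A)"
    and xs: "length xs = fst (ops A ! j)" "set xs \<subseteq> car A"
  shows "snd (ops (quot A \<theta>) ! j) (map (\<lambda>x. \<theta> `` {x}) xs) = \<theta> `` {snd (ops A ! j) xs}"
proof -
  let ?r = "\<lambda>X. SOME x. x \<in> X"
  let ?ys = "map (\<lambda>x. ?r (\<theta> `` {x})) xs"
  have rep: "(x, ?r (\<theta> `` {x})) \<in> \<theta>" if "x \<in> car A" for x
  proof -
    have "x \<in> \<theta> `` {x}" using equivD(2)[OF Con_equiv[OF \<theta>] that] by blast
    then have "?r (\<theta> `` {x}) \<in> \<theta> `` {x}" by (rule someI)
    then show ?thesis by blast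
  qed
  have "(snd (ops A ! j) xs, snd (ops A ! j) ?ys) \<in> \<theta>"
  proof (rule Con_op[OF \<theta> j xs(1)])
    fix i assume i: "i < length xs"
    then have "xs ! i \<in> car A" using xs(2) nth_mem by blast
    then show "(xs ! i, ?ys ! i) \<in> \<theta>" using rep i by simp
  qed (use xs in simp)
  then have "\<theta> `` {snd (ops A ! j) xs} = \<theta> `` {snd (ops A ! j) ?ys}"
    by (rule equiv_class_eq[OF Con_equiv[OF \<theta>]])
  moreover have "snd (ops (quot A \<theta>) ! j) (map (\<lambda>x. \<theta> `` {x}) xs) = \<theta> `` {snd (ops A ! j) ?ys}"
    using j by (simp add: ops_def quot_def case_prod_unfold comp_def)
  ultimately show ?thesis by simp
qed

text \<open>An invariant linear order of a quotient, pulled back to the carrier as numbers: equal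
  rank means equal class, and numbers supply thresholds.\<close>

definition rank_mono :: "'a alg \<Rightarrow> ('a \<Rightarrow> nat) \<Rightarrow> bool" where
  "rank_mono A r \<longleftrightarrow> (\<forall>j < length (ops A). \<forall>xs \<in> cube (car A) (fst (ops A ! j)).
     \<forall>ys \<in> cube (car A) (fst (ops A ! j)). (\<forall>i < fst (ops A ! j). r (xs ! i) \<le> r (ys ! i)) \<longrightarrow>
       r (snd (ops A ! j) xs) \<le> r (snd (ops A ! j) ys))"

lemma rank_monoD:
  assumes "rank_mono A r" "j < length (ops A)" "xs \<in> cube (car A) (fst (ops A ! j))"
    "ys \<in> cube (car A) (fst (ops A ! j))" "\<And>i. i < fst (ops A ! j) \<Longrightarrow> r (xs ! i) \<le> r (ys ! i)"
  shows "r (snd (ops A ! j) xs) \<le> r (snd (ops A ! j) ys)"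
  using assms unfolding rank_mono_def by blast

text \<open>The rank counts the classes at or below the given one; in a finite linear order this
  number determines the position.\<close>

lemma tot_ordered_quot_rank:
  assumes fin: "finite_alg A" and \<beta>: "\<beta> \<in> Con A" and \<theta>: "\<theta> \<in> Con (quot A \<beta>)"
    and tot: "tot_ordered (quot (quot A \<beta>) \<theta>)"
  shows "\<exists>r. rank_mono A r \<and>
    (\<forall>x\<in>car A. \<forall>y\<in>car A. r x = r y \<longleftrightarrow> (\<beta> `` {x}, \<beta> `` {y}) \<in> \<theta>)"
proof -
  let ?Q = "quot A \<beta>"
  let ?C = "quot ?Q \<theta>"
  define \<pi> where "\<pi> x = \<theta> `` {\<beta> `` {x}}" for x
  obtain le where le: "le \<subseteq> car ?C \<times> car ?C" "linear_order_on (car ?C) le"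
    and mono: "\<forall>(k, f) \<in> set (ops ?C). \<forall>xs ys. length xs = k \<and> length ys = k \<and>
        set xs \<subseteq> car ?C \<and> set ys \<subseteq> car ?C \<and> list_all2 (\<lambda>x y. (x, y) \<in> le) xs ys
        \<longrightarrow> (f xs, f ys) \<in> le"
    using tot unfolding tot_ordered_def by blast
  have lo: "refl_on (car ?C) le" "antisym le" "trans le" "total_on (car ?C) le"
    using le(2) by (auto simp: linear_order_on_def partial_order_on_def preorder_on_def)
  have refl: "(X, X) \<in> le" if "X \<in> car ?C" for X using lo(1) that by (rule refl_onD)
  have antisym: "X = Y" if "(X, Y) \<in> le" "(Y, X) \<in> le" for X Y using lo(2) that by (rule antisymD)
  have trans: "(X, Z) \<in> le" if "(X, Y) \<in> le" "(Y, Z) \<in> le" for X Y Z using lo(3) that by (rule transD)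
  have total: "(X, Y) \<in> le \<or> (Y, X) \<in> le" if "X \<in> car ?C" "Y \<in> car ?C" for X Y
    using lo(4) that refl unfolding total_on_def by (cases "X = Y") auto
  have \<beta>Q: "\<beta> `` {x} \<in> car ?Q" if "x \<in> car A" for x using that by (simp add: car_quot quotientI)
  have \<pi>C: "\<pi> x \<in> car ?C" if "x \<in> car A" for x
    unfolding \<pi>_def car_quot[of ?Q] using \<beta>Q[OF that] by (rule quotientI)
  have finC: "finite (car ?C)"
  proof -
    have "finite (car A)" using fin by (simp add: finite_alg_def)
    then have "finite (car ?Q)" unfolding car_quot
      by (rule finite_quotient) (use equivD(1)[OF Con_equiv[OF \<beta>]] in auto)
    then show ?thesis unfolding car_quot[of ?Q]
      by (rule finite_quotient) (use equivD(1)[OF Con_equiv[OF \<theta>]] in auto)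
  qed
  define r where "r x = card {Z \<in> car ?C. (Z, \<pi> x) \<in> le}" for x
  have r_mono: "r x \<le> r y" if "(\<pi> x, \<pi> y) \<in> le" for x y
    unfolding r_def using finC trans that by (intro card_mono) auto
  have r_iff: "r x \<le> r y \<longleftrightarrow> (\<pi> x, \<pi> y) \<in> le" if xy: "x \<in> car A" "y \<in> car A" for x y
  proof
    assume le_r: "r x \<le> r y"
    show "(\<pi> x, \<pi> y) \<in> le"
    proof (rule ccontr)
      assume n: "(\<pi> x, \<pi> y) \<notin> le"
      then have yx: "(\<pi> y, \<pi> x) \<in> le" using total \<pi>C xy by blast
      have "{Z \<in> car ?C. (Z, \<pi> y) \<in> le} \<subset> {Z \<in> car ?C. (Z, \<pi> x) \<in> le}"
        using trans[OF _ yx] n refl \<pi>C[OF xy(1)] by blast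
      then have "r y < r x" unfolding r_def using finC by (intro psubset_card_mono) auto
      then show False using le_r by simp
    qed
  qed (rule r_mono)
  have r_eq: "r x = r y \<longleftrightarrow> \<pi> x = \<pi> y" if "x \<in> car A" "y \<in> car A" for x y
  proof
    assume "r x = r y"
    then have "(\<pi> x, \<pi> y) \<in> le" "(\<pi> y, \<pi> x) \<in> le"
      using r_iff[OF that] r_iff[OF that(2,1)] by simp_all
    then show "\<pi> x = \<pi> y" by (rule antisym)
  qed (simp add: r_def)
  have "rank_mono A r"
    unfolding rank_mono_def
  proof (intro allI impI ballI)
    fix j xs ys
    assume j: "j < length (ops A)" and xs: "xs \<in> cube (car A) (fst (ops A ! j))"
      and ys: "ys \<in> cube (car A) (fst (ops A ! j))" and h: "\<forall>i < fst (ops A ! j). r (xs ! i) \<le> r (ys ! i)"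
    have hom: "snd (ops ?C ! j) (map \<pi> zs) = \<pi> (snd (ops A ! j) zs)"
      if zs: "zs \<in> cube (car A) (fst (ops A ! j))" for zs
    proof -
      have l: "length zs = fst (ops A ! j)" "set zs \<subseteq> car A" using zs by (auto simp: cube_def)
      have "snd (ops ?C ! j) (map (\<lambda>X. \<theta> `` {X}) (map (\<lambda>x. \<beta> `` {x}) zs)) =
          \<theta> `` {snd (ops ?Q ! j) (map (\<lambda>x. \<beta> `` {x}) zs)}"
        by (rule quot_op[OF \<theta>]) (use j l \<beta>Q in auto)
      moreover have "map \<pi> zs = map (\<lambda>X. \<theta> `` {X}) (map (\<lambda>x. \<beta> `` {x}) zs)" by (simp add: \<pi>_def)
      ultimately show ?thesis unfolding quot_op[OF \<beta> j l] by (simp only: \<pi>_def)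
    qed
    have "(fst (ops ?C ! j), snd (ops ?C ! j)) \<in> set (ops ?C)"
      unfolding prod.collapse using j by (intro nth_mem) simp
    moreover have "length (map \<pi> xs) = fst (ops ?C ! j)" "length (map \<pi> ys) = fst (ops ?C ! j)"
      using j xs ys by (auto simp: cube_def)
    moreover have "set (map \<pi> xs) \<subseteq> car ?C" "set (map \<pi> ys) \<subseteq> car ?C"
      using \<pi>C xs ys by (auto simp: cube_def)
    moreover have "list_all2 (\<lambda>x y. (x, y) \<in> le) (map \<pi> xs) (map \<pi> ys)"
      using h r_iff xs ys by (simp add: list_all2_conv_all_nth in_cube_iff)
    ultimately have "(snd (ops ?C ! j) (map \<pi> xs), snd (ops ?C ! j) (map \<pi> ys)) \<in> le"
      using mono by blast
    then show "r (snd (ops A ! j) xs) \<le> r (snd (ops A ! j) ys)"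
      unfolding hom[OF xs] hom[OF ys] by (rule r_mono)
  qed
  moreover have "r x = r y \<longleftrightarrow> (\<beta> `` {x}, \<beta> `` {y}) \<in> \<theta>" if "x \<in> car A" "y \<in> car A" for x y
    unfolding r_eq[OF that] \<pi>_def
    by (rule eq_equiv_class_iff[OF Con_equiv[OF \<theta>] \<beta>Q[OF that(1)] \<beta>Q[OF that(2)]])
  ultimately show ?thesis by blast
qed

lemma subdirect_tot_ranks:
  assumes fin: "finite_alg A" and \<beta>: "\<beta> \<in> Con A" and sd: "subdirect_tot (quot A \<beta>)"
  shows "\<exists>Rk. finite Rk \<and> (\<forall>r\<in>Rk. rank_mono A r) \<and>
    (\<forall>x\<in>car A. \<forall>y\<in>car A. (x, y) \<in> \<beta> \<longleftrightarrow> (\<forall>r\<in>Rk. r x = r y))"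
proof -
  obtain \<Theta> where \<Theta>: "\<Theta> \<subseteq> Con (quot A \<beta>)" "\<And>\<theta>. \<theta> \<in> \<Theta> \<Longrightarrow> tot_ordered (quot (quot A \<beta>) \<theta>)"
    and triv: "{(x, y). x \<in> car (quot A \<beta>) \<and> y \<in> car (quot A \<beta>) \<and> (\<forall>\<theta> \<in> \<Theta>. (x, y) \<in> \<theta>)} = Id_on (car (quot A \<beta>))"
    using sd unfolding subdirect_tot_def by blast
  have "\<exists>r. rank_mono A r \<and> (\<forall>x\<in>car A. \<forall>y\<in>car A. r x = r y \<longleftrightarrow> (\<beta> `` {x}, \<beta> `` {y}) \<in> \<theta>)"
    if "\<theta> \<in> \<Theta>" for \<theta>
    using tot_ordered_quot_rank[OF fin \<beta> subsetD[OF \<Theta>(1) that] \<Theta>(2)[OF that]] .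
  then obtain rk where rk: "\<And>\<theta>. \<theta> \<in> \<Theta> \<Longrightarrow> rank_mono A (rk \<theta>)"
    "\<And>\<theta> x y. \<theta> \<in> \<Theta> \<Longrightarrow> x \<in> car A \<Longrightarrow> y \<in> car A \<Longrightarrow> rk \<theta> x = rk \<theta> y \<longleftrightarrow> (\<beta> `` {x}, \<beta> `` {y}) \<in> \<theta>"
    by metis
  have "finite (car A)" using fin by (simp add: finite_alg_def)
  then have "finite (car (quot A \<beta>))" unfolding car_quot
    by (rule finite_quotient) (use equivD(1)[OF Con_equiv[OF \<beta>]] in auto)
  then have "finite (Pow (car (quot A \<beta>) \<times> car (quot A \<beta>)))" by simp
  moreover have "\<Theta> \<subseteq> Pow (car (quot A \<beta>) \<times> car (quot A \<beta>))"
  proof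
    fix \<theta> assume "\<theta> \<in> \<Theta>"
    then have "equiv (car (quot A \<beta>)) \<theta>" using \<Theta>(1) Con_equiv by blast
    then show "\<theta> \<in> Pow (car (quot A \<beta>) \<times> car (quot A \<beta>))" by (simp add: equiv_def)
  qed
  ultimately have "finite \<Theta>" by (rule finite_subset[rotated])
  moreover have "(x, y) \<in> \<beta> \<longleftrightarrow> (\<forall>\<theta>\<in>\<Theta>. rk \<theta> x = rk \<theta> y)" if xy: "x \<in> car A" "y \<in> car A" for x y
  proof -
    have Q: "\<beta> `` {x} \<in> car (quot A \<beta>)" "\<beta> `` {y} \<in> car (quot A \<beta>)"
      using xy by (auto simp: car_quot quotientI)
    have "(\<forall>\<theta>\<in>\<Theta>. rk \<theta> x = rk \<theta> y) \<longleftrightarrow> (\<forall>\<theta>\<in>\<Theta>. (\<beta> `` {x}, \<beta> `` {y}) \<in> \<theta>)" using rk(2) xy by blast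
    also have "\<dots> \<longleftrightarrow> (\<beta> `` {x}, \<beta> `` {y}) \<in> Id_on (car (quot A \<beta>))" unfolding triv[symmetric] using Q by simp
    also have "\<dots> \<longleftrightarrow> \<beta> `` {x} = \<beta> `` {y}" using Q by (auto simp: Id_on_iff)
    also have "\<dots> \<longleftrightarrow> (x, y) \<in> \<beta>" by (rule eq_equiv_class_iff[OF Con_equiv[OF \<beta>] xy])
    finally show ?thesis by blast
  qed
  ultimately show ?thesis using rk(1) by (intro exI[of _ "rk ` \<Theta>"]) auto
qed

text \<open>Reversing an order keeps it invariant, so each order can be chosen with
  \<open>a\<close> below \<open>b\<close>; for \<open>a = \<iota> 0\<close>, \<open>b = \<iota> 1\<close> all thresholds become monotone.\<close>
lemma subdirect_tot_oriented_ranks: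
  assumes fin: "finite_alg A" and \<beta>: "\<beta> \<in> Con A" and sd: "subdirect_tot (quot A \<beta>)"
  shows "\<exists>Rk B. finite Rk \<and> (\<forall>r\<in>Rk. rank_mono A r \<and> r a \<le> r b \<and> (\<forall>x\<in>car A. r x \<le> B)) \<and>
    (\<forall>x\<in>car A. \<forall>y\<in>car A. (x, y) \<in> \<beta> \<longleftrightarrow> (\<forall>r\<in>Rk. r x = r y))"
proof -
  obtain Rk where Rk': "finite Rk \<and> (\<forall>r\<in>Rk. rank_mono A r) \<and>
    (\<forall>x\<in>car A. \<forall>y\<in>car A. (x, y) \<in> \<beta> \<longleftrightarrow> (\<forall>r\<in>Rk. r x = r y))"
    using subdirect_tot_ranks[OF fin \<beta> sd] by (elim exE) (rule that)
  then have Rk: "finite Rk" "\<And>r. r \<in> Rk \<Longrightarrow> rank_mono A r"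
    "\<And>x y. x \<in> car A \<Longrightarrow> y \<in> car A \<Longrightarrow> (x, y) \<in> \<beta> \<longleftrightarrow> (\<forall>r\<in>Rk. r x = r y)"
    by simp_all
  have "finite ((\<lambda>(r, x). r x) ` (Rk \<times> car A))" using Rk(1) fin by (simp add: finite_alg_def)
  then obtain B where "\<forall>v \<in> (\<lambda>(r, x). r x) ` (Rk \<times> car A). v \<le> B" using finite_nat_set_iff_bounded_le by blast
  then have B: "r x \<le> B" if "r \<in> Rk" "x \<in> car A" for r x using that by force
  \<comment> \<open>Subtraction on naturals truncates, but \<open>B\<close> bounds all ranks on the
    carrier, so \<open>B - r x\<close> reverses the order faithfully there.\<close>
  define orient where "orient r = (if r a \<le> r b then r else (\<lambda>x. B - r x))" for r :: "'a \<Rightarrow> nat"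
  have eq: "orient r x = orient r y \<longleftrightarrow> r x = r y" if "r \<in> Rk" "x \<in> car A" "y \<in> car A" for r x y
    using B[OF that(1,2)] B[OF that(1,3)] by (auto simp: orient_def)
  have mono: "rank_mono A (orient r)" if r: "r \<in> Rk" for r
  proof (cases "r a \<le> r b")
    case True
    then show ?thesis using Rk(2)[OF r] by (simp add: orient_def)
  next
    case False
    show ?thesis unfolding rank_mono_def
    proof (intro allI impI ballI)
      fix j xs ys
      assume j: "j < length (ops A)" and xs: "xs \<in> cube (car A) (fst (ops A ! j))"
        and ys: "ys \<in> cube (car A) (fst (ops A ! j))"
        and h: "\<forall>i < fst (ops A ! j). orient r (xs ! i) \<le> orient r (ys ! i)"
      have "r (snd (ops A ! j) ys) \<le> r (snd (ops A ! j) xs)"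
      proof (rule rank_monoD[OF Rk(2)[OF r] j ys xs])
        fix i assume i: "i < fst (ops A ! j)"
        then have "xs ! i \<in> car A" "ys ! i \<in> car A" using xs ys by (auto simp: in_cube_iff)
        then show "r (ys ! i) \<le> r (xs ! i)" using h i B[OF r, of "xs ! i"] B[OF r, of "ys ! i"] False
          by (auto simp: orient_def)
      qed
      then show "orient r (snd (ops A ! j) xs) \<le> orient r (snd (ops A ! j) ys)"
        using False by (simp add: orient_def)
    qed
  qed
  have "orient r a \<le> orient r b" for r
    by (cases "r a \<le> r b") (simp_all add: orient_def diff_le_mono2)
  moreover have "orient r x \<le> B" if "r \<in> Rk" "x \<in> car A" for r x using B[OF that] by (simp add: orient_def)
  moreover have "(x, y) \<in> \<beta> \<longleftrightarrow> (\<forall>r\<in>orient ` Rk. r x = r y)" if "x \<in> car A" "y \<in> car A" for x y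
    using Rk(3)[OF that] eq that by auto
  ultimately show ?thesis using Rk(1) mono by (intro exI[of _ "orient ` Rk"] exI[of _ B]) auto
qed

section \<open>Threshold functions of algebra circuits\<close>

definition avals :: "'a alg \<Rightarrow> 'a list \<Rightarrow> 'a agate list \<Rightarrow> 'a list" where
  "avals A xs gs = foldl (\<lambda>vs g. vs @ [agate_val A xs vs g]) [] gs"

lemma avals_Nil [simp]: "avals A xs [] = []"
  by (simp add: avals_def)

lemma avals_snoc: "avals A xs (gs @ [g]) = avals A xs gs @ [agate_val A xs (avals A xs gs) g]"
  by (simp add: avals_def)

lemma length_avals [simp]: "length (avals A xs gs) = length gs"
  by (induction gs rule: rev_induct) (auto simp: avals_snoc)

lemma avals_append_nth: "j < length gs \<Longrightarrow> avals A xs (gs @ gs') ! j = avals A xs gs ! j"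
proof (induction gs' rule: rev_induct)
  case (snoc g gs')
  then show ?case by (simp add: avals_snoc nth_append flip: append_assoc)
qed simp

lemma acirc_eval_avals:
  assumes "gs \<noteq> []"
  shows "acirc_eval A xs gs = avals A xs gs ! (length gs - 1)"
proof -
  have "avals A xs gs \<noteq> []" using assms by (metis length_avals length_0_conv)
  then show ?thesis unfolding acirc_eval_def avals_def[symmetric] by (simp add: last_conv_nth)
qed

lemma avals_nth_prefix:
  assumes "j < length gs"
  shows "avals A xs gs ! j = agate_val A xs (avals A xs (take j gs)) (gs ! j)"
proof -
  have "avals A xs gs ! j = avals A xs (take (Suc j) gs) ! j"
    using avals_append_nth[of j "take (Suc j) gs" A xs "drop (Suc j) gs"] assms by simp
  also have "take (Suc j) gs = take j gs @ [gs ! j]" using assms by (rule take_Suc_conv_app_nth)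
  finally show ?thesis using assms by (simp add: avals_snoc nth_append)
qed

lemma avals_AIn: "j < length gs \<Longrightarrow> gs ! j = AIn i \<Longrightarrow> avals A xs gs ! j = xs ! i"
  by (simp add: avals_nth_prefix)

lemma avals_ACst: "j < length gs \<Longrightarrow> gs ! j = ACst a \<Longrightarrow> avals A xs gs ! j = a"
  by (simp add: avals_nth_prefix)

lemma acirc_wf_AOp:
  assumes "acirc_wf A n gs" "j < length gs" "gs ! j = AOp k as"
  shows "k < length (ops A)" "length as = fst (ops A ! k)" "\<And>i. i < length as \<Longrightarrow> as ! i < j"
proof -
  have "case gs ! j of AIn i \<Rightarrow> i < n | ACst a \<Rightarrow> a \<in> car A
     | AOp k as \<Rightarrow> k < length (ops A) \<and> length as = fst (ops A ! k) \<and> (\<forall>a \<in> set as. a < j)"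
    using assms(1,2) unfolding acirc_wf_def by blast
  then show "k < length (ops A)" "length as = fst (ops A ! k)" "\<And>i. i < length as \<Longrightarrow> as ! i < j"
    using assms(3) by auto
qed

lemma acirc_wf_AIn: "acirc_wf A n gs \<Longrightarrow> j < length gs \<Longrightarrow> gs ! j = AIn i \<Longrightarrow> i < n"
  unfolding acirc_wf_def by fastforce

lemma acirc_wf_ACst: "acirc_wf A n gs \<Longrightarrow> j < length gs \<Longrightarrow> gs ! j = ACst a \<Longrightarrow> a \<in> car A"
  unfolding acirc_wf_def by fastforce

lemma avals_AOp:
  assumes "acirc_wf A n gs" "j < length gs" "gs ! j = AOp k as"
  shows "avals A xs gs ! j = snd (ops A ! k) (map (\<lambda>a. avals A xs gs ! a) as)"
proof -
  have "avals A xs (take j gs) ! a = avals A xs gs ! a" if "a \<in> set as" for a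
  proof -
    obtain i where "i < length as" "a = as ! i" using \<open>a \<in> set as\<close> by (auto simp: in_set_conv_nth)
    then have "a < j" using acirc_wf_AOp(3)[OF assms] by simp
    then show ?thesis
      using avals_append_nth[of a "take j gs" A xs "drop j gs"] assms(2) by simp
  qed
  then show ?thesis using avals_nth_prefix[OF assms(2), of A xs] assms(3) by (simp cong: map_cong)
qed

lemma avals_closed:
  assumes fin: "finite_alg A" and wf: "acirc_wf A n gs" and xs: "xs \<in> cube (car A) n"
  shows "j < length gs \<Longrightarrow> avals A xs gs ! j \<in> car A"
proof (induction j rule: less_induct)
  case (less j)
  show ?case
  proof (cases "gs ! j")
    case (AIn i)
    then show ?thesis using acirc_wf_AIn[OF wf less.prems AIn] xs avals_AIn[OF less.prems AIn, of A xs]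
      by (simp add: in_cube_iff)
  next
    case (ACst a)
    then show ?thesis using acirc_wf_ACst[OF wf less.prems ACst] avals_ACst[OF less.prems ACst, of A xs] by simp
  next
    case (AOp k as)
    note w = acirc_wf_AOp[OF wf less.prems AOp]
    have "avals A xs gs ! a \<in> car A" if "a \<in> set as" for a
    proof -
      obtain i where "i < length as" "a = as ! i" using \<open>a \<in> set as\<close> by (auto simp: in_set_conv_nth)
      then have "a < j" using w(3) by simp
      then show ?thesis using less by simp
    qed
    then show ?thesis unfolding avals_AOp[OF wf less.prems AOp]
      using op_closed[OF fin w(1), of "map (\<lambda>a. avals A xs gs ! a) as"] w(2) by auto
  qed
qed

definition gate_fun :: "'a alg \<Rightarrow> (bool \<Rightarrow> 'a) \<Rightarrow> 'a agate list \<Rightarrow> nat \<Rightarrow> bool list \<Rightarrow> 'a" where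
  "gate_fun A \<iota> gs j w = avals A (map \<iota> w) gs ! j"

lemma gate_fun_closed:
  assumes "finite_alg A" "acirc_wf A n gs" "\<And>b. \<iota> b \<in> car A" "length w = n" "j < length gs"
  shows "gate_fun A \<iota> gs j w \<in> car A"
  unfolding gate_fun_def using assms(3,4)
  by (intro avals_closed[OF assms(1,2) _ assms(5)]) (auto simp: cube_def)

definition max_arity :: "'a alg \<Rightarrow> nat" where
  "max_arity A = sum_list (map fst (ops A))"

lemma arity_le_max: "j < length (ops A) \<Longrightarrow> fst (ops A ! j) \<le> max_arity A"
  unfolding max_arity_def by (rule member_le_sum_list) (auto intro: nth_mem)

lemma card_lists_le:
  assumes "finite S" "S \<noteq> {}" "k \<le> m"
  shows "finite {xs. set xs \<subseteq> S \<and> length xs = k}" "card {xs. set xs \<subseteq> S \<and> length xs = k} \<le> card S ^ m"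
proof -
  show "finite {xs. set xs \<subseteq> S \<and> length xs = k}" using assms(1) by (rule finite_lists_length_eq)
  have "card S \<ge> 1" using assms by (simp add: Suc_leI card_gt_0_iff)
  then have "card S ^ k \<le> card S ^ m" using assms(3) by (rule power_increasing[rotated])
  then show "card {xs. set xs \<subseteq> S \<and> length xs = k} \<le> card S ^ m" using card_lists_length_eq[OF assms(1)] by simp
qed

text \<open>By monotonicity the output reaches rank \<open>a\<close> exactly if the arguments
  dominate, coordinate by coordinate, the ranks of some tuple whose image reaches \<open>a\<close>;
  the actual arguments are such a tuple. The tuples range over the fixed algebra, so the normal form
  has constant size.\<close>

lemma bext_threshold_gate:
  assumes fin: "finite_alg A" and wf: "acirc_wf A n gs" and \<iota>: "\<And>b. \<iota> b \<in> car A"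
    and m: "m < length gs"
    and r: "rank_mono A r" "r (\<iota> False) \<le> r (\<iota> True)" "\<And>x. x \<in> car A \<Longrightarrow> r x \<le> B"
    and F: "\<And>i. i < n \<Longrightarrow> (\<lambda>w. w ! i) \<in> F"
      "\<And>j a. j < m \<Longrightarrow> a \<le> B \<Longrightarrow> (\<lambda>w. a \<le> r (gate_fun A \<iota> gs j w)) \<in> F"
  shows "bext True n (card (car A) ^ max_arity A * (max_arity A + 1))
    (card (car A) ^ max_arity A + max_arity A) F {\<lambda>w. a \<le> r (gate_fun A \<iota> gs m w)}"
    (is "bext True n ?s ?d F {?t}")
proof (cases "gs ! m")
  case (AIn i)
  have i: "i < n" by (rule acirc_wf_AIn[OF wf m AIn])
  have t: "?t w = (a \<le> r (\<iota> (w ! i)))" if "length w = n" for w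
    using avals_AIn[OF m AIn, of A "map \<iota> w"] i that by (simp add: gate_fun_def)
  \<comment> \<open>The orientation of the rank leaves three cases: constantly true, the input bit
    itself, constantly false. The negated bit cannot arise.\<close>
  consider "a \<le> r (\<iota> False)" | "\<not> a \<le> r (\<iota> False)" "a \<le> r (\<iota> True)" | "\<not> a \<le> r (\<iota> True)" by linarith
  then show ?thesis
  proof cases
    case 1
    have c: "?t w = True" if "length w = n" for w
      using t[OF that] 1 r(2) by (cases "w ! i") (auto intro: order.trans)
    show ?thesis by (rule bext_cong[OF bext_const[of True n ?s ?d F True]]) (use c in auto)
  next
    case 2
    have c: "?t w = (w ! i)" if "length w = n" for w using t[OF that] 2 by (cases "w ! i") auto
    have "bext True n ?s ?d F {\<lambda>w. w ! i}" by (rule bextI_subset) (use F(1)[OF i] in simp)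
    then show ?thesis by (rule bext_cong) (use c in auto)
  next
    case 3
    have c: "?t w = False" if "length w = n" for w using t[OF that] 3 r(2) by (cases "w ! i") auto
    show ?thesis by (rule bext_cong[OF bext_const[of True n ?s ?d F False]]) (use c in auto)
  qed
next
  case (ACst b)
  have "?t = (\<lambda>w. a \<le> r b)" using avals_ACst[OF m ACst] by (simp add: gate_fun_def)
  then show ?thesis using bext_const[of True n ?s ?d F "a \<le> r b"] by simp
next
  case (AOp k as)
  note w = acirc_wf_AOp[OF wf m AOp]
  define f where "f = snd (ops A ! k)"
  define I where "I = {xs. set xs \<subseteq> car A \<and> length xs = length as \<and> a \<le> r (f xs)}"
  have ar: "length as \<le> max_arity A" using arity_le_max[OF w(1)] w(2) by simp
  have fc: "finite (car A)" "car A \<noteq> {}" using fin by (auto simp: finite_alg_def)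
  note cl = card_lists_le[OF fc ar]
  have Isub: "I \<subseteq> {xs. set xs \<subseteq> car A \<and> length xs = length as}" by (auto simp: I_def)
  have fI: "finite I" using Isub cl(1) by (rule finite_subset)
  have cI: "card I \<le> card (car A) ^ max_arity A" using card_mono[OF cl(1) Isub] cl(2) by simp
  let ?h = "\<lambda>xs i w. r (xs ! i) \<le> r (gate_fun A \<iota> gs (as ! i) w)"
  have "bext True n (card I * (max_arity A + 1)) (card I + max_arity A) F
      {\<lambda>w. \<exists>xs\<in>I. \<forall>i\<in>{..<length as}. ?h xs i w}"
  proof (rule bext_Bex_Ball[OF fI, where J = "\<lambda>_. {..<length as}" and f = ?h])
    fix xs i assume xs: "xs \<in> I" and i: "i \<in> {..<length as}"
    then have "xs ! i \<in> car A" by (auto simp: I_def)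
    then show "?h xs i \<in> F" using F(2) r(3) w(3) i by simp
  qed (use ar in simp)
  then have "bext True n (card I * (max_arity A + 1)) (card I + max_arity A) F {?t}"
  proof (rule bext_cong)
    fix h assume h: "h \<in> {?t}"
    have "(\<exists>xs\<in>I. \<forall>i\<in>{..<length as}. ?h xs i u) = ?t u" if u: "length u = n" for u
    proof -
      define ys where "ys = map (\<lambda>b. gate_fun A \<iota> gs b u) as"
      have g: "gate_fun A \<iota> gs m u = f ys"
        unfolding gate_fun_def ys_def f_def by (rule avals_AOp[OF wf m AOp])
      have ysc: "ys ! i \<in> car A" if "i < length as" for i
      proof -
        have "as ! i < length gs" using w(3)[OF that] m by simp
        then show ?thesis using gate_fun_closed[OF fin wf \<iota> u] that by (simp add: ys_def)
      qed
      then have ysS: "set ys \<subseteq> car A" by (auto simp: ys_def in_set_conv_nth)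
      show ?thesis
      proof
        assume "\<exists>xs\<in>I. \<forall>i\<in>{..<length as}. ?h xs i u"
        then obtain xs where xs: "xs \<in> I" "\<And>i. i < length as \<Longrightarrow> r (xs ! i) \<le> r (ys ! i)"
          by (auto simp: ys_def)
        have "r (f xs) \<le> r (f ys)" unfolding f_def
          by (rule rank_monoD[OF r(1) w(1)])
            (use xs ysS w(2) in \<open>auto simp: cube_def I_def ys_def\<close>)
        then show "?t u" using xs(1) g by (simp add: I_def)
      next
        assume "?t u"
        then have "ys \<in> I" using ysS g by (simp add: I_def ys_def)
        moreover have "\<forall>i\<in>{..<length as}. ?h ys i u" by (simp add: ys_def)
        ultimately show "\<exists>xs\<in>I. \<forall>i\<in>{..<length as}. ?h xs i u" by blast
      qed
    qed
    then show "\<exists>g\<in>{\<lambda>w. \<exists>xs\<in>I. \<forall>i\<in>{..<length as}. ?h xs i w}. \<forall>xs. length xs = n \<longrightarrow> g xs = h xs"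
      using h by simp
  qed
  then show ?thesis
    by (rule bext_mono) (use cI in \<open>simp_all only: add_le_mono1 mult_le_mono1 subset_refl\<close>)
qed

text \<open>The range extends to \<open>Suc B\<close> because equality with a rank
  \<open>v \<le> B\<close> is later tested as reaching \<open>v\<close> but not
  \<open>Suc v\<close>.\<close>

definition thresholds :: "'a alg \<Rightarrow> (bool \<Rightarrow> 'a) \<Rightarrow> ('a \<Rightarrow> nat) set \<Rightarrow> nat \<Rightarrow> 'a agate list \<Rightarrow> nat \<Rightarrow>
    (bool list \<Rightarrow> bool) set" where
  "thresholds A \<iota> Rk B gs m = (\<lambda>(j, r, a) w. a \<le> r (gate_fun A \<iota> gs j w)) ` ({..<m} \<times> Rk \<times> {..Suc B})"

text \<open>Gate by gate along the circuit. The depth grows linearly, which is harmless since the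
  monotone part is bounded in size only.\<close>

lemma bext_thresholds:
  assumes fin: "finite_alg A" and \<iota>: "\<And>b. \<iota> b \<in> car A" and Rk: "finite Rk"
    and r: "\<And>r. r \<in> Rk \<Longrightarrow> rank_mono A r" "\<And>r. r \<in> Rk \<Longrightarrow> r (\<iota> False) \<le> r (\<iota> True)"
      "\<And>r x. r \<in> Rk \<Longrightarrow> x \<in> car A \<Longrightarrow> r x \<le> B"
  shows "\<exists>K. \<forall>n gs. acirc_wf A n gs \<longrightarrow>
    bext True n (K * length gs) (K * length gs) ((\<lambda>i w. w ! i) ` {..<n}) (thresholds A \<iota> Rk B gs (length gs))"
proof -
  define s where "s = card (car A) ^ max_arity A * (max_arity A + 1)"
  define d where "d = card (car A) ^ max_arity A + max_arity A"
  define K where "K = card (Rk \<times> {..Suc B}) * s + d"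
  have "bext True n (K * length gs) (K * length gs) ((\<lambda>i w. w ! i) ` {..<n}) (thresholds A \<iota> Rk B gs (length gs))"
    if wf: "acirc_wf A n gs" for n gs
  proof -
    let ?F0 = "(\<lambda>i w. w ! i) ` {..<n} :: (bool list \<Rightarrow> bool) set"
    let ?T = "\<lambda>m. thresholds A \<iota> Rk B gs m"
    have "bext True n (K * m) (K * m) ?F0 (?F0 \<union> ?T m)" if "m \<le> length gs" for m
      using that
    proof (induction m)
      case 0
      then show ?case by (simp add: thresholds_def bextI_subset)
    next
      case (Suc m)
      then have m: "m < length gs" by simp
      let ?new = "\<Union>x\<in>Rk \<times> {..Suc B}. {\<lambda>w. snd x \<le> fst x (gate_fun A \<iota> gs m w)}"
      have "bext True n (card (Rk \<times> {..Suc B}) * s) d (?F0 \<union> ?T m) ?new"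
      proof (rule bext_UN)
        show "finite (Rk \<times> {..Suc B})" using Rk by simp
        fix x assume x: "x \<in> Rk \<times> {..Suc B}"
        then have x1: "fst x \<in> Rk" by auto
        show "bext True n s d (?F0 \<union> ?T m) {\<lambda>w. snd x \<le> fst x (gate_fun A \<iota> gs m w)}"
          unfolding s_def d_def
        proof (rule bext_threshold_gate[OF fin wf \<iota> m r(1)[OF x1] r(2)[OF x1] r(3)[OF x1]])
          show "(\<lambda>w. w ! i) \<in> ?F0 \<union> ?T m" if "i < n" for i using that by blast
          show "(\<lambda>w. a \<le> fst x (gate_fun A \<iota> gs j w)) \<in> ?F0 \<union> ?T m" if "j < m" "a \<le> B" for j a
          proof (rule UnI2)
            show "(\<lambda>w. a \<le> fst x (gate_fun A \<iota> gs j w)) \<in> ?T m"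
              unfolding thresholds_def using that x1 by (intro image_eqI[of _ _ "(j, fst x, a)"]) auto
          qed
        qed
      qed
      then have "bext True n (card (Rk \<times> {..Suc B}) * s) d (?F0 \<union> ?T m) ((?F0 \<union> ?T m) \<union> ?new)"
        by (rule bext_keep)
      from bext_trans[OF Suc.IH this] m
      have "bext True n (K * m + card (Rk \<times> {..Suc B}) * s) (K * m + d) ?F0 ((?F0 \<union> ?T m) \<union> ?new)" by simp
      moreover have "?T (Suc m) \<subseteq> ?T m \<union> ?new"
      proof
        fix h assume "h \<in> ?T (Suc m)"
        then obtain j q a where h: "h = (\<lambda>w. a \<le> q (gate_fun A \<iota> gs j w))" and jqa: "j < Suc m" "q \<in> Rk" "a \<le> Suc B"
          by (auto simp: thresholds_def)
        show "h \<in> ?T m \<union> ?new"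
        proof (cases "j = m")
          case True
          then show ?thesis using h jqa by (intro UnI2 UN_I[of "(q, a)"]) auto
        next
          case False
          then have "h \<in> ?T m" unfolding thresholds_def h using jqa
            by (intro image_eqI[of _ _ "(j, q, a)"]) auto
          then show ?thesis by blast
        qed
      qed
      ultimately show ?case by (elim bext_mono) (auto simp: K_def)
    qed
    from this[of "length gs"] show ?thesis by (rule bext_mono) auto
  qed
  then show ?thesis by blast
qed

section \<open>Layers of branching programs\<close>

text \<open>Describes layered circuits with several outputs, so that a layer can be put on top of
  another; for \<open>ps = []\<close> the outputs are those of the monotone circuits.\<close>

definition realizes :: "nat \<Rightarrow> nat list \<Rightarrow> nat \<Rightarrow> (bool list \<Rightarrow> bool) list \<Rightarrow> bool" where
  "realizes n ps s fs \<longleftrightarrow> (\<exists>Ls Ms. (\<forall>M\<in>set Ms. bcirc_wf True n M) \<and> layers_wf (length Ms) ps Ls \<and>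
     layers_size Ls + sum_list (map bcirc_size Ms) \<le> s \<and> length fs = out_length (length Ms) Ls \<and>
     (\<forall>w. length w = n \<longrightarrow> layers_eval ps Ls (map (bcirc_eval w) Ms) = map (\<lambda>f. f w) fs))"

lemma realizes_mono: "realizes n ps s fs \<Longrightarrow> s \<le> s' \<Longrightarrow> realizes n ps s' fs"
  unfolding realizes_def by (meson order.trans)

lemma sum_list_bound:
  fixes f :: "'a \<Rightarrow> nat"
  assumes "\<And>x. x \<in> set xs \<Longrightarrow> f x \<le> b"
  shows "sum_list (map f xs) \<le> length xs * b"
  using sum_list_mono[of xs f "\<lambda>_. b"] assms by (simp add: sum_list_triv)

definition nonconst :: "nat \<Rightarrow> (bool list \<Rightarrow> bool) \<Rightarrow> bool" where
  "nonconst n f \<longleftrightarrow> \<not> (\<exists>b. \<forall>w. length w = n \<longrightarrow> f w = b)"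

text \<open>Each output receives its own prefix of the common gate list, hence the factor
  \<open>length fs\<close>; the 3 is that of \<open>bcirc_size_le\<close>. Constants have no gate in
  a monotone circuit and are filtered out; \<open>acomp_monotone_var\<close> brings them back as
  labels.\<close>

lemma realizes_monotone:
  assumes "bext True n s d ((\<lambda>i w. w ! i) ` {..<n}) (set fs)"
  shows "realizes n [] (length fs * (3 * (n + s))) (filter (nonconst n) fs)"
proof -
  obtain gs where gs: "bgates_wf True n gs" "length gs \<le> n + s" "\<forall>f\<in>set fs. bprov n gs d f"
    using bext_from_inputs[OF assms] by blast
  have "\<exists>j<length gs. \<forall>w. length w = n \<longrightarrow> bvals w gs ! j = f w" if "f \<in> set fs" "nonconst n f" for f
    using gs(3) that unfolding bprov_def nonconst_def by blast
  then obtain ix where ix: "\<And>f. f \<in> set fs \<Longrightarrow> nonconst n f \<Longrightarrow> ix f < length gs"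
    "\<And>f w. f \<in> set fs \<Longrightarrow> nonconst n f \<Longrightarrow> length w = n \<Longrightarrow> bvals w gs ! ix f = f w" by metis
  let ?fs = "filter (nonconst n) fs"
  let ?Ms = "map (\<lambda>f. take (Suc (ix f)) gs) ?fs"
  have "bcirc_wf True n M" if "M \<in> set ?Ms" for M
  proof -
    from that obtain f where "f \<in> set fs" "nonconst n f" and M: "M = take (Suc (ix f)) gs" by auto
    then have "gs \<noteq> []" using ix(1)[of f] by auto
    then show ?thesis unfolding M bcirc_wf_alt using bgates_wf_take[OF gs(1)] by simp
  qed
  moreover have "sum_list (map bcirc_size ?Ms) \<le> length fs * (3 * (n + s))"
  proof -
    have "bcirc_size M \<le> 3 * (n + s)" if "M \<in> set ?Ms" for M
    proof -
      from that have "length M \<le> n + s" using gs(2) by auto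
      then have "3 * length M \<le> 3 * (n + s)" by (rule mult_le_mono2)
      with bcirc_size_le[of M] show ?thesis by (rule le_trans)
    qed
    then have "sum_list (map bcirc_size ?Ms) \<le> length ?Ms * (3 * (n + s))" by (rule sum_list_bound)
    also have "\<dots> \<le> length fs * (3 * (n + s))" by (intro mult_le_mono1) simp
    finally show ?thesis .
  qed
  moreover have "map (bcirc_eval w) ?Ms = map (\<lambda>f. f w) ?fs" if "length w = n" for w
    using ix that by (auto simp: bcirc_eval_take)
  ultimately show ?thesis unfolding realizes_def
    by (intro exI[of _ "[]"] exI[of _ ?Ms]) (simp add: layers_size_def out_length_def)
qed

lemma acomp_monotone_var:
  assumes "f \<in> set fs" "p > 1"
  shows "acomp p {w. length w = n} (filter (nonconst n) fs) 2 {\<lambda>w. of_bool (f w)}"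
proof (cases "nonconst n f")
  case True
  then show ?thesis using assms(1) by (intro acomp_var) simp
next
  case False
  then obtain b where b: "\<And>w. length w = n \<Longrightarrow> f w = b" unfolding nonconst_def by blast
  have "acomp p {w. length w = n} (filter (nonconst n) fs) 2 {\<lambda>w. of_bool b}"
    by (rule acomp_const[OF assms(2)])
  then show ?thesis by (rule acomp_cong) (use b in auto)
qed

text \<open>The computed values are 0 and 1, distinct modulo \<open>p > 1\<close>, so every gate of
  the layer accepts on \<open>{1}\<close>.\<close>

lemma realizes_layer:
  assumes fs: "realizes n ps s fs" and p: "p > 1"
    and comp: "\<And>f. f \<in> set fs' \<Longrightarrow> acomp p {w. length w = n} fs t {\<lambda>w. of_bool (f w)}"
  shows "realizes n (p # ps) (s + length fs' * (t + 3)) fs'"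
proof -
  obtain Ls Ms where R: "\<forall>M\<in>set Ms. bcirc_wf True n M" "layers_wf (length Ms) ps Ls"
     "layers_size Ls + sum_list (map bcirc_size Ms) \<le> s" "length fs = out_length (length Ms) Ls"
     "\<And>w. length w = n \<Longrightarrow> layers_eval ps Ls (map (bcirc_eval w) Ms) = map (\<lambda>f. f w) fs"
    using fs unfolding realizes_def by blast
  have "\<forall>f\<in>set fs'. \<exists>G. babp_wf p (length fs) G \<and> babp_size G \<le> t + 3 \<and>
      (\<forall>w\<in>{w. length w = n}. babp_eval p G (map (\<lambda>f. f w) fs) = (of_bool (f w) mod int p \<in> {1}))"
  proof
    fix f assume "f \<in> set fs'"
    from acomp_babp[OF comp[OF this] p, of "{1}"] p
    show "\<exists>G. babp_wf p (length fs) G \<and> babp_size G \<le> t + 3 \<and>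
      (\<forall>w\<in>{w. length w = n}. babp_eval p G (map (\<lambda>f. f w) fs) = (of_bool (f w) mod int p \<in> {1}))" by simp
  qed
  from bchoice[OF this] obtain G where G': "\<forall>f\<in>set fs'. babp_wf p (length fs) (G f) \<and> babp_size (G f) \<le> t + 3 \<and>
      (\<forall>w\<in>{w. length w = n}. babp_eval p (G f) (map (\<lambda>f. f w) fs) = (of_bool (f w) mod int p \<in> {1}))" ..
  have G: "babp_wf p (length fs) (G f)" "babp_size (G f) \<le> t + 3"
    "\<And>w. length w = n \<Longrightarrow> babp_eval p (G f) (map (\<lambda>f. f w) fs) = (of_bool (f w) mod int p \<in> {1})"
    if "f \<in> set fs'" for f
    using bspec[OF G' that] by simp_all
  have G3: "babp_eval p (G f) (map (\<lambda>f. f w) fs) = f w" if "f \<in> set fs'" "length w = n" for f w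
    using G(3)[OF that] p by (cases "f w") auto
  show ?thesis unfolding realizes_def
  proof (intro exI[of _ "map G fs' # Ls"] exI[of _ Ms] conjI allI impI)
    show "\<forall>M\<in>set Ms. bcirc_wf True n M" by (rule R)
    show "layers_wf (length Ms) (p # ps) (map G fs' # Ls)" using R(2,4) G(1) by auto
    have "sum_list (map babp_size (map G fs')) \<le> length (map G fs') * (t + 3)"
      by (rule sum_list_bound) (use G(2) in auto)
    then show "layers_size (map G fs' # Ls) + sum_list (map bcirc_size Ms) \<le> s + length fs' * (t + 3)"
      using R(3) by (simp add: layers_size_def)
    show "length fs' = out_length (length Ms) (map G fs' # Ls)" by (simp add: out_length_def)
    fix w :: "bool list" assume "length w = n"
    then show "layers_eval (p # ps) (map G fs' # Ls) (map (bcirc_eval w) Ms) = map (\<lambda>f. f w) fs'"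
      using R(5) G3 by simp
  qed
qed

lemma acomp_insert_cong:
  assumes "acomp p D fs s (insert f \<Psi>)" "\<And>w. w \<in> D \<Longrightarrow> [f w = g w] (mod int p)"
  shows "acomp p D fs s (insert g \<Psi>)"
proof (rule acomp_cong[OF assms(1)])
  fix \<psi>' assume "\<psi>' \<in> insert g \<Psi>"
  then show "\<exists>\<psi>\<in>insert f \<Psi>. \<forall>w\<in>D. [\<psi> w = \<psi>' w] (mod int p)"
  proof
    assume "\<psi>' = g"
    then show ?thesis using assms(2) by (intro bexI[of _ f]) auto
  next
    assume "\<psi>' \<in> \<Psi>"
    then show ?thesis by (intro bexI[of _ \<psi>']) auto
  qed
qed

text \<open>The shape of one step of a linear recurrence: each \<open>a i\<close> is already stored
  at a vertex, and a fresh computation of \<open>b i\<close> is hung behind that vertex. Two stored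
  values are never multiplied.\<close>

lemma acomp_insert_sum:
  assumes \<Psi>: "acomp p D fs s \<Psi>" "(\<lambda>w. 1) \<in> \<Psi>" and I: "finite I" and a: "\<And>i. i \<in> I \<Longrightarrow> a i \<in> \<Psi>"
    and b: "\<And>i. i \<in> I \<Longrightarrow> acomp p D fs t {b i}" and p: "p > 1"
  shows "acomp p D fs (s + (card I * (t + 3) + 2)) (insert (\<lambda>w. \<Sum>i\<in>I. a i w * b i w) \<Psi>)"
  using I a b
proof (induction I rule: finite_induct)
  case empty
  have "acomp p D fs (s + 2) (\<Psi> \<union> (\<lambda>\<psi>' w. 1 * \<psi>' w) ` {\<lambda>w. 0})"
    by (rule acomp_seq[OF \<Psi> acomp_const[OF p]])
  then have "acomp p D fs (s + 2) (insert (\<lambda>w. 0) \<Psi>)" by (rule acomp_mono) auto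
  then show ?case by (simp add: numeral_2_eq_2)
next
  case (insert i I)
  let ?S = "\<lambda>w. \<Sum>i\<in>I. a i w * b i w"
  have 1: "acomp p D fs (s + (card I * (t + 3) + 2)) (insert ?S \<Psi>)"
    by (rule insert.IH) (use insert.prems in auto)
  have 2: "acomp p D fs (s + (card I * (t + 3) + 2) + t)
      (insert ?S \<Psi> \<union> (\<lambda>\<psi>' w. a i w * \<psi>' w) ` {b i})"
    by (rule acomp_seq[OF 1 _ insert.prems(2)]) (use insert.prems(1) in auto)
  have "acomp p D fs (s + (card I * (t + 3) + 2) + t + 3)
      (insert (\<lambda>w. a i w * b i w + ?S w) (insert ?S \<Psi> \<union> (\<lambda>\<psi>' w. a i w * \<psi>' w) ` {b i}))"
    by (rule acomp_add[OF 2 _ _ p]) auto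
  then show ?case by (rule acomp_mono) (use insert(1,2) in auto)
qed

lemma acomp_insert_family:
  assumes "acomp p D fs s \<Psi>" "finite J"
    and step: "\<And>j \<Psi>' s'. j \<in> J \<Longrightarrow> \<Psi> \<subseteq> \<Psi>' \<Longrightarrow> acomp p D fs s' \<Psi>' \<Longrightarrow> acomp p D fs (s' + t) (insert (\<psi> j) \<Psi>')"
  shows "acomp p D fs (s + card J * t) (\<Psi> \<union> \<psi> ` J)"
  using assms(2,3)
proof (induction J rule: finite_induct)
  case empty
  then show ?case using assms(1) by simp
next
  case (insert j J)
  have "acomp p D fs (s + card J * t) (\<Psi> \<union> \<psi> ` J)"
    by (rule insert.IH, rule insert.prems) auto
  then have "acomp p D fs (s + card J * t + t) (insert (\<psi> j) (\<Psi> \<union> \<psi> ` J))"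
    by (rule insert.prems[rotated 2]) auto
  then show ?case by (rule acomp_mono) (use insert(1,2) in auto)
qed

lemma prod_of_bool: "finite I \<Longrightarrow> (\<Prod>i\<in>I. of_bool (P i)) = (of_bool (\<forall>i\<in>I. P i) :: int)"
  by (induction I rule: finite_induct) auto

section \<open>Computing one congruence layer\<close>

definition class_list :: "'a alg \<Rightarrow> ('a \<times> 'a) set \<Rightarrow> 'a set list" where
  "class_list A \<theta> = (SOME Cs. set Cs = car A // \<theta> \<and> distinct Cs)"

text \<open>What one layer hands to the next: the class of every gate, and also the input bits,
  which are needed again at the input gates of the circuit.\<close>

definition state_funs :: "'a alg \<Rightarrow> (bool \<Rightarrow> 'a) \<Rightarrow> ('a \<times> 'a) set \<Rightarrow> nat \<Rightarrow> 'a agate list \<Rightarrow>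
    (bool list \<Rightarrow> bool) list" where
  "state_funs A \<iota> \<theta> n gs = map (\<lambda>i w. w ! i) [0..<n] @
     map (\<lambda>x w. gate_fun A \<iota> gs (fst x) w \<in> snd x) (List.product [0..<length gs] (class_list A \<theta>))"

lemma finite_classes:
  assumes "finite_alg A" "\<theta> \<in> Con A"
  shows "finite (car A // \<theta>)"
proof -
  have "finite (car A)" using assms(1) by (simp add: finite_alg_def)
  then show ?thesis by (rule finite_quotient) (use equivD(1)[OF Con_equiv[OF assms(2)]] in auto)
qed

lemma class_list:
  assumes "finite_alg A" "\<theta> \<in> Con A"
  shows "set (class_list A \<theta>) = car A // \<theta>" "length (class_list A \<theta>) = card (car A // \<theta>)"
proof -
  have "\<exists>Cs. set Cs = car A // \<theta> \<and> distinct Cs" by (rule finite_distinct_list[OF finite_classes[OF assms]])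
  then have "set (class_list A \<theta>) = car A // \<theta> \<and> distinct (class_list A \<theta>)"
    unfolding class_list_def by (rule someI_ex)
  then show "set (class_list A \<theta>) = car A // \<theta>" "length (class_list A \<theta>) = card (car A // \<theta>)"
    using distinct_card by fastforce+
qed

lemma length_state_funs:
  assumes "finite_alg A" "\<theta> \<in> Con A"
  shows "length (state_funs A \<iota> \<theta> n gs) \<le> (1 + card (car A // \<theta>)) * (n + length gs)"
  using class_list(2)[OF assms] by (simp add: state_funs_def length_product algebra_simps)

lemma state_funs_bit: "i < n \<Longrightarrow> (\<lambda>w. w ! i) \<in> set (state_funs A \<iota> \<theta> n gs)"
  unfolding state_funs_def by auto

lemma state_funs_class:
  assumes "finite_alg A" "\<theta> \<in> Con A" "j < length gs" "C \<in> car A // \<theta>"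
  shows "(\<lambda>w. gate_fun A \<iota> gs j w \<in> C) \<in> set (state_funs A \<iota> \<theta> n gs)"
proof -
  have "(j, C) \<in> set (List.product [0..<length gs] (class_list A \<theta>))"
    using class_list(1)[OF assms(1,2)] assms(3,4) by simp
  then have "(\<lambda>x w. gate_fun A \<iota> gs (fst x) w \<in> snd x) (j, C) \<in>
      (\<lambda>x w. gate_fun A \<iota> gs (fst x) w \<in> snd x) ` set (List.product [0..<length gs] (class_list A \<theta>))"
    by (rule imageI)
  then show ?thesis unfolding state_funs_def by simp
qed

lemma state_funs_cases:
  assumes "finite_alg A" "\<theta> \<in> Con A" "f \<in> set (state_funs A \<iota> \<theta> n gs)"
  obtains i where "i < n" "f = (\<lambda>w. w ! i)"
  | j C where "j < length gs" "C \<in> car A // \<theta>" "f = (\<lambda>w. gate_fun A \<iota> gs j w \<in> C)"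
  using assms(3) class_list(1)[OF assms(1,2)] unfolding state_funs_def by auto

lemma affine_coords_op:
  assumes "affine_coords A \<gamma> \<delta> p \<Phi>" "j < length (ops A)" "length Cs = fst (ops A ! j)"
    "set Cs \<subseteq> car A // \<delta>" "\<phi> \<in> \<Phi> C" "\<forall>xs. list_all2 (\<in>) xs Cs \<longrightarrow> snd (ops A ! j) xs \<in> C"
  shows "\<exists>c \<phi>s. (\<forall>i < length Cs. \<phi>s i \<in> \<Phi> (Cs ! i)) \<and> (\<forall>xs. list_all2 (\<in>) xs Cs \<longrightarrow>
     [\<phi> (snd (ops A ! j) xs) = c + (\<Sum>i<length Cs. \<phi>s i (xs ! i))] (mod int p))"
proof -
  have "\<forall>j < length (ops A). \<forall>Cs C \<phi>. length Cs = fst (ops A ! j) \<and> set Cs \<subseteq> car A // \<delta> \<and> \<phi> \<in> \<Phi> C \<and>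
        (\<forall>xs. list_all2 (\<in>) xs Cs \<longrightarrow> snd (ops A ! j) xs \<in> C) \<longrightarrow>
        (\<exists>c \<phi>s. (\<forall>i < length Cs. \<phi>s i \<in> \<Phi> (Cs ! i)) \<and> (\<forall>xs. list_all2 (\<in>) xs Cs \<longrightarrow>
           [\<phi> (snd (ops A ! j) xs) = c + (\<Sum>i<length Cs. \<phi>s i (xs ! i))] (mod int p)))"
    using assms(1) unfolding affine_coords_def by (elim conjE)
  from mp[OF spec[OF spec[OF spec[OF mp[OF spec[OF this, of j] assms(2)], of Cs], of C], of \<phi>]]
  show ?thesis using assms(3-6) by simp
qed

lemma affine_coordsD:
  assumes "affine_coords A \<gamma> \<delta> p \<Phi>"
  shows "prime p" "C \<in> car A // \<delta> \<Longrightarrow> finite (\<Phi> C)"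
    "C \<in> car A // \<delta> \<Longrightarrow> \<phi> \<in> \<Phi> C \<Longrightarrow> x \<notin> C \<Longrightarrow> \<phi> x = 0"
    "C \<in> car A // \<delta> \<Longrightarrow> x \<in> C \<Longrightarrow> y \<in> C \<Longrightarrow> (x, y) \<in> \<gamma> \<longleftrightarrow> (\<forall>\<phi>\<in>\<Phi> C. \<phi> x = \<phi> y)"
    "C \<in> car A // \<delta> \<Longrightarrow> \<phi> \<in> \<Phi> C \<Longrightarrow> x \<in> C \<Longrightarrow> \<phi> x \<in> {0..<int p}"
  using assms unfolding affine_coords_def by (elim conjE, (drule bspec, assumption)?, simp)+

text \<open>The cost of \<open>acomp_insert_sum\<close> for the tuples of classes, with up to
  \<open>max_arity A + 1\<close> terms per tuple: a coordinate for each argument and the constant. A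
  term needs two units per class indicator; the 9 is the cost of interpolating at an input gate and
  also covers the remaining factor.\<close>

definition layer_cost :: "'a alg \<Rightarrow> ('a \<times> 'a) set \<Rightarrow> nat" where
  "layer_cost A \<delta> = card (car A // \<delta>) ^ max_arity A * (max_arity A + 1) * (2 * max_arity A + 9 + 3) + 2"

text \<open>At an operation gate, sum over the tuples \<open>Cs\<close> of
  \<open>\<delta>\<close>-classes mapped into \<open>C\<close> the indicator of \<open>Cs\<close>
  times the affine form valid on \<open>Cs\<close>. Indicators are inputs of the layer and
  coordinates of the arguments are stored vertices, so the sum is linear in stored values. At most
  one indicator is 1.\<close>

lemma acomp_gate_coord:
  assumes fin: "finite_alg A" and wf: "acirc_wf A n gs" and \<iota>: "\<And>b. \<iota> b \<in> car A"
    and \<delta>: "\<delta> \<in> Con A" and ac: "affine_coords A \<gamma> \<delta> p \<Phi>" and m: "m < length gs"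
    and C: "C \<in> car A // \<delta>" and \<phi>: "\<phi> \<in> \<Phi> C"
    and \<Psi>: "acomp p {w. length w = n} (state_funs A \<iota> \<delta> n gs) s \<Psi>" "(\<lambda>w. 1) \<in> \<Psi>"
      "\<And>j C \<phi>. j < m \<Longrightarrow> C \<in> car A // \<delta> \<Longrightarrow> \<phi> \<in> \<Phi> C \<Longrightarrow> (\<lambda>w. \<phi> (gate_fun A \<iota> gs j w)) \<in> \<Psi>"
  shows "acomp p {w. length w = n} (state_funs A \<iota> \<delta> n gs) (s + layer_cost A \<delta>)
    (insert (\<lambda>w. \<phi> (gate_fun A \<iota> gs m w)) \<Psi>)"
proof -
  let ?D = "{w. length w = n} :: bool list set" and ?fs = "state_funs A \<iota> \<delta> n gs"
  let ?g = "gate_fun A \<iota> gs"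
  have p: "prime p" by (rule affine_coordsD(1)[OF ac])
  then have p1: "p > 1" by (rule prime_gt_1_nat)
  note e\<delta> = equivD[OF Con_equiv[OF \<delta>]]
  have finQ: "finite (car A // \<delta>)" by (rule finite_classes[OF fin \<delta>])
  have neQ: "car A // \<delta> \<noteq> {}" using C by (metis empty_iff)
  have cost: "14 \<le> layer_cost A \<delta>"
  proof -
    have "1 \<le> card (car A // \<delta>)" using finQ neQ by (simp add: Suc_leI card_gt_0_iff)
    then have "1 \<le> card (car A // \<delta>) ^ max_arity A" by simp
    then have "1 * 1 * 12 \<le> card (car A // \<delta>) ^ max_arity A * (max_arity A + 1) * (2 * max_arity A + 9 + 3)"
      by (intro mult_le_mono) auto
    then show ?thesis by (simp add: layer_cost_def)
  qed
  have single: ?thesis if b: "acomp p ?D ?fs 9 {b}" "\<And>w. w \<in> ?D \<Longrightarrow> b w = \<phi> (?g m w)" for b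
  proof -
    have "acomp p ?D ?fs (s + (card {()} * (9 + 3) + 2)) (insert (\<lambda>w. \<Sum>i\<in>{()}. 1 * b w) \<Psi>)"
      by (rule acomp_insert_sum[OF \<Psi>(1,2), where a = "\<lambda>i w. 1" and b = "\<lambda>i. b"]) (use \<Psi>(2) b(1) p1 in simp_all)
    then have "acomp p ?D ?fs (s + layer_cost A \<delta>) (insert b \<Psi>)"
      by (rule acomp_mono) (use cost in auto)
    then show ?thesis by (rule acomp_insert_cong) (use b(2) in simp)
  qed
  show ?thesis
  proof (cases "gs ! m")
    case (AIn i)
    have i: "i < n" by (rule acirc_wf_AIn[OF wf m AIn])
    \<comment> \<open>Affine interpolation between the two possible values of the input bit.\<close>
    let ?b = "\<lambda>w. \<phi> (\<iota> False) + (\<phi> (\<iota> True) - \<phi> (\<iota> False)) * of_bool (w ! i)"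
    have "acomp p ?D ?fs (2 + (2 + 2) + 3) {?b}"
      by (intro acomp_plus acomp_mult acomp_const acomp_var state_funs_bit i p1)
    moreover have "?b w = \<phi> (?g m w)" if "w \<in> ?D" for w
      using avals_AIn[OF m AIn, of A "map \<iota> w"] i that by (cases "w ! i") (simp_all add: gate_fun_def)
    ultimately show ?thesis by (intro single[of ?b]) simp_all
  next
    case (ACst b)
    have "acomp p ?D ?fs 9 {\<lambda>w. \<phi> b}" by (rule acomp_mono[OF acomp_const[OF p1]]) auto
    then show ?thesis
      by (rule single) (use avals_ACst[OF m ACst] in \<open>simp add: gate_fun_def\<close>)
  next
    case (AOp k as)
    note w = acirc_wf_AOp[OF wf m AOp]
    define f where "f = snd (ops A ! k)"
    define r where "r = length as"
    define Tup where "Tup = {Cs. set Cs \<subseteq> car A // \<delta> \<and> length Cs = r \<and>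
      (\<forall>xs. list_all2 (\<in>) xs Cs \<longrightarrow> f xs \<in> C)}"
    have ar: "r \<le> max_arity A" using arity_le_max[OF w(1)] w(2) by (simp add: r_def)
    note cl = card_lists_le[OF finQ neQ ar]
    have Tsub: "Tup \<subseteq> {Cs. set Cs \<subseteq> car A // \<delta> \<and> length Cs = r}" by (auto simp: Tup_def)
    have fT: "finite Tup" using Tsub cl(1) by (rule finite_subset)
    have cT: "card Tup \<le> card (car A // \<delta>) ^ max_arity A" using card_mono[OF cl(1) Tsub] cl(2) by simp
    have "\<forall>Cs\<in>Tup. \<exists>cf. (\<forall>i<r. snd cf i \<in> \<Phi> (Cs ! i)) \<and> (\<forall>xs. list_all2 (\<in>) xs Cs \<longrightarrow>
           [\<phi> (f xs) = fst cf + (\<Sum>i<r. snd cf i (xs ! i))] (mod int p))"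
    proof
      fix Cs assume "Cs \<in> Tup"
      then have Cs: "set Cs \<subseteq> car A // \<delta>" "length Cs = r" "\<forall>xs. list_all2 (\<in>) xs Cs \<longrightarrow> f xs \<in> C"
        by (simp_all add: Tup_def)
      obtain c \<phi>s where "(\<forall>i<length Cs. \<phi>s i \<in> \<Phi> (Cs ! i)) \<and> (\<forall>xs. list_all2 (\<in>) xs Cs \<longrightarrow>
           [\<phi> (f xs) = c + (\<Sum>i<length Cs. \<phi>s i (xs ! i))] (mod int p))"
        using affine_coords_op[OF ac w(1) _ Cs(1) \<phi> Cs(3)[unfolded f_def]] Cs(2) w(2)
        unfolding f_def r_def by auto
      then show "\<exists>cf. (\<forall>i<r. snd cf i \<in> \<Phi> (Cs ! i)) \<and> (\<forall>xs. list_all2 (\<in>) xs Cs \<longrightarrow>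
           [\<phi> (f xs) = fst cf + (\<Sum>i<r. snd cf i (xs ! i))] (mod int p))"
        using Cs(2) by (intro exI[of _ "(c, \<phi>s)"]) simp
    qed
    from bchoice[OF this] obtain cf where cf: "\<forall>Cs\<in>Tup. (\<forall>i<r. snd (cf Cs) i \<in> \<Phi> (Cs ! i)) \<and>
        (\<forall>xs. list_all2 (\<in>) xs Cs \<longrightarrow>
           [\<phi> (f xs) = fst (cf Cs) + (\<Sum>i<r. snd (cf Cs) i (xs ! i))] (mod int p))" ..
    define c where "c Cs = fst (cf Cs)" for Cs
    define \<phi>s where "\<phi>s Cs = snd (cf Cs)" for Cs
    have c: "\<And>i. i < r \<Longrightarrow> \<phi>s Cs i \<in> \<Phi> (Cs ! i)"
      "\<And>xs. list_all2 (\<in>) xs Cs \<Longrightarrow> [\<phi> (f xs) = c Cs + (\<Sum>i<r. \<phi>s Cs i (xs ! i))] (mod int p)"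
      if "Cs \<in> Tup" for Cs
      using bspec[OF cf that] by (simp_all add: c_def \<phi>s_def)
    define ind where "ind Cs w = (\<Prod>l<r. of_bool (?g (as ! l) w \<in> Cs ! l) :: int)" for Cs w
    \<comment> \<open>An index \<open>(Cs, i)\<close> with \<open>i < r\<close> stands for the
      coordinate of argument \<open>i\<close>. For \<open>i = r\<close> it stands for the constant
      term, where the stored factor is 1 and \<open>c Cs\<close> joins the fresh factor.\<close>
    let ?a = "\<lambda>x w. if snd x = r then 1 else \<phi>s (fst x) (snd x) (?g (as ! snd x) w)"
    let ?b = "\<lambda>x w. ind (fst x) w * (if snd x = r then c (fst x) else 1)"
    have "acomp p ?D ?fs (s + (card (Tup \<times> {..r}) * ((2 * max_arity A + 9) + 3) + 2))
        (insert (\<lambda>w. \<Sum>x\<in>Tup \<times> {..r}. ?a x w * ?b x w) \<Psi>)"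
    proof (rule acomp_insert_sum[OF \<Psi>(1,2) _ _ _ p1])
      show "finite (Tup \<times> {..r})" using fT by simp
    next
      fix x assume x: "x \<in> Tup \<times> {..r}"
      then have CsQ: "\<And>i. i < r \<Longrightarrow> fst x ! i \<in> car A // \<delta>" by (auto simp: Tup_def)
      show "?a x \<in> \<Psi>"
      proof (cases "snd x = r")
        case True
        then show ?thesis using \<Psi>(2) by simp
      next
        case False
        then have ir: "snd x < r" using x by auto
        have "(\<lambda>w. \<phi>s (fst x) (snd x) (?g (as ! snd x) w)) \<in> \<Psi>"
        proof (rule \<Psi>(3))
          show "as ! snd x < m" using w(3) ir by (simp add: r_def)
          show "fst x ! snd x \<in> car A // \<delta>" using CsQ ir by simp
          show "\<phi>s (fst x) (snd x) \<in> \<Phi> (fst x ! snd x)" using c(1) x ir by auto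
        qed
        then show ?thesis using False by simp
      qed
      have "acomp p ?D ?fs (card {..<r} * 2) {ind (fst x)}"
        unfolding ind_def
      proof (rule acomp_prod)
        fix l assume "l \<in> {..<r}"
        then have l: "l < r" by simp
        have "as ! l < length gs" using w(3)[of l] m l by (simp add: r_def)
        then show "acomp p ?D ?fs 2 {\<lambda>w. of_bool (?g (as ! l) w \<in> fst x ! l)}"
          using CsQ[OF l] by (intro acomp_var state_funs_class[OF fin \<delta>])
      qed simp
      then have "acomp p ?D ?fs (card {..<r} * 2 + 2) {\<lambda>w. ind (fst x) w * (if snd x = r then c (fst x) else 1)}"
        by (rule acomp_mult) (rule acomp_const[OF p1])
      then show "acomp p ?D ?fs (2 * max_arity A + 9) {?b x}"
        by (rule acomp_mono) (use ar in simp_all)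
    qed
    then have "acomp p ?D ?fs (s + layer_cost A \<delta>) (insert (\<lambda>w. \<Sum>x\<in>Tup \<times> {..r}. ?a x w * ?b x w) \<Psi>)"
    proof (rule acomp_mono)
      have "card (Tup \<times> {..r}) \<le> card (car A // \<delta>) ^ max_arity A * (max_arity A + 1)"
        unfolding card_cartesian_product using cT ar by (intro mult_le_mono) auto
      then have "card (Tup \<times> {..r}) * ((2 * max_arity A + 9) + 3) \<le>
          card (car A // \<delta>) ^ max_arity A * (max_arity A + 1) * (2 * max_arity A + 9 + 3)"
        by (rule mult_le_mono1)
      then show "s + (card (Tup \<times> {..r}) * ((2 * max_arity A + 9) + 3) + 2) \<le> s + layer_cost A \<delta>"
        unfolding layer_cost_def by linarith
    qed simp
    then show ?thesis
    proof (rule acomp_insert_cong)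
      fix u :: "bool list" assume "u \<in> ?D"
      then have u: "length u = n" by simp
      define v where "v = map (\<lambda>b. ?g b u) as"
      define Cs0 where "Cs0 = map (\<lambda>x. \<delta> `` {x}) v"
      have gm: "?g m u = f v" unfolding gate_fun_def v_def f_def by (rule avals_AOp[OF wf m AOp])
      have lv: "length v = r" "length Cs0 = r" by (simp_all add: v_def Cs0_def r_def)
      have v_nth: "v ! l = ?g (as ! l) u" if "l < r" for l using that by (simp add: v_def r_def)
      have vc: "v ! l \<in> car A" if "l < r" for l
      proof -
        have "as ! l < length gs" using w(3)[of l] m that by (simp add: r_def)
        then show ?thesis using gate_fun_closed[OF fin wf \<iota> u] v_nth[OF that] by simp
      qed
      have Cs0_nth: "Cs0 ! l = \<delta> `` {v ! l}" if "l < r" for l using that lv by (simp add: Cs0_def)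
      have la0: "list_all2 (\<in>) v Cs0"
        using lv Cs0_nth vc e\<delta>(2) by (simp add: list_all2_conv_all_nth)
      have ind_eq: "ind Cs u = of_bool (Cs = Cs0)" if Cs: "Cs \<in> Tup" for Cs
      proof -
        have "(\<forall>l\<in>{..<r}. ?g (as ! l) u \<in> Cs ! l) \<longleftrightarrow> Cs = Cs0"
        proof
          assume h: "\<forall>l\<in>{..<r}. ?g (as ! l) u \<in> Cs ! l"
          show "Cs = Cs0"
          proof (rule nth_equalityI)
            show "length Cs = length Cs0" using Cs lv by (simp add: Tup_def)
            fix l assume "l < length Cs"
            then have l: "l < r" using Cs by (simp add: Tup_def)
            have "Cs ! l \<in> car A // \<delta>" using Cs l by (auto simp: Tup_def)
            moreover have "v ! l \<in> Cs ! l" using h l v_nth by simp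
            ultimately show "Cs ! l = Cs0 ! l"
              unfolding Cs0_nth[OF l] using Con_equiv[OF \<delta>]
              by (metis Image_singleton_iff equiv_class_eq_iff quotientE)
          qed
        next
          assume "Cs = Cs0"
          then show "\<forall>l\<in>{..<r}. ?g (as ! l) u \<in> Cs ! l"
            using Cs0_nth v_nth vc e\<delta>(2) by simp
        qed
        then show ?thesis unfolding ind_def by (subst prod_of_bool) simp_all
      qed
      have "(\<Sum>x\<in>Tup \<times> {..r}. ?a x u * ?b x u) =
          (\<Sum>Cs\<in>Tup. \<Sum>i\<le>r. ?a (Cs, i) u * ?b (Cs, i) u)"
        unfolding sum.cartesian_product by (rule sum.cong) auto
      also have "\<dots> = (\<Sum>Cs\<in>Tup. if Cs = Cs0 then c Cs0 + (\<Sum>i<r. \<phi>s Cs0 i (v ! i)) else 0)"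
      proof (rule sum.cong[OF refl])
        fix Cs assume Cs: "Cs \<in> Tup"
        have "(\<Sum>i\<le>r. ?a (Cs, i) u * ?b (Cs, i) u) =
            (\<Sum>i<r. ?a (Cs, i) u * ?b (Cs, i) u) + ?a (Cs, r) u * ?b (Cs, r) u"
          unfolding lessThan_Suc_atMost[symmetric] by (rule sum.lessThan_Suc)
        also have "(\<Sum>i<r. ?a (Cs, i) u * ?b (Cs, i) u) = (\<Sum>i<r. \<phi>s Cs i (v ! i) * ind Cs u)"
          by (rule sum.cong) (simp_all add: v_nth)
        also have "?a (Cs, r) u * ?b (Cs, r) u = c Cs * ind Cs u" by simp
        finally have eq: "(\<Sum>i\<le>r. ?a (Cs, i) u * ?b (Cs, i) u) =
            (\<Sum>i<r. \<phi>s Cs i (v ! i) * ind Cs u) + c Cs * ind Cs u" .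
        show "(\<Sum>i\<le>r. ?a (Cs, i) u * ?b (Cs, i) u) =
            (if Cs = Cs0 then c Cs0 + (\<Sum>i<r. \<phi>s Cs0 i (v ! i)) else 0)"
          unfolding eq ind_eq[OF Cs] by (cases "Cs = Cs0") simp_all
      qed
      also have "\<dots> = (if Cs0 \<in> Tup then c Cs0 + (\<Sum>i<r. \<phi>s Cs0 i (v ! i)) else 0)"
        using fT by simp
      finally have sum_eq: "(\<Sum>x\<in>Tup \<times> {..r}. ?a x u * ?b x u) =
          (if Cs0 \<in> Tup then c Cs0 + (\<Sum>i<r. \<phi>s Cs0 i (v ! i)) else 0)" .
      show "[(\<Sum>x\<in>Tup \<times> {..r}. ?a x u * ?b x u) = \<phi> (?g m u)] (mod int p)"
      proof (cases "Cs0 \<in> Tup")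
        case True
        then show ?thesis unfolding sum_eq gm using c(2)[OF True la0] by (simp add: cong_sym_eq)
      next
        case False
        \<comment> \<open>If \<open>f v\<close> were in \<open>C\<close>, compatibility with
          \<open>\<delta>\<close> would map every tuple from the classes in \<open>Cs0\<close> into
          \<open>C\<close>, so \<open>Cs0\<close> would belong to \<open>Tup\<close>. Both sides are
          therefore zero.\<close>
        have "f v \<notin> C"
        proof
          assume fv: "f v \<in> C"
          have "f xs \<in> C" if xs: "list_all2 (\<in>) xs Cs0" for xs
          proof -
            have lx: "length xs = r" and xl: "\<And>l. l < r \<Longrightarrow> (v ! l, xs ! l) \<in> \<delta>"
              using xs lv Cs0_nth by (auto simp: list_all2_conv_all_nth)
            have "(f v, f xs) \<in> \<delta>" unfolding f_def
              by (rule Con_op[OF \<delta> w(1)]) (use lv lx xl w(2) in \<open>auto simp: r_def\<close>)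
            then show ?thesis using C fv e\<delta>(4) by (auto elim!: quotientE)
          qed
          moreover have "set Cs0 \<subseteq> car A // \<delta>"
          proof
            fix X assume "X \<in> set Cs0"
            then obtain l where "l < r" "X = Cs0 ! l" using lv by (auto simp: in_set_conv_nth)
            then show "X \<in> car A // \<delta>" using Cs0_nth vc by (simp add: quotientI)
          qed
          ultimately show False using False lv by (simp add: Tup_def)
        qed
        then have "\<phi> (f v) = 0" by (rule affine_coordsD(3)[OF ac C \<phi>])
        then show ?thesis unfolding sum_eq gm using False by simp
      qed
    qed
  qed
qed

text \<open>All coordinates of all gates are vertices of one program, so its size is linear in the
  length of the circuit, however often gates are shared.\<close>

lemma acomp_coords:
  assumes fin: "finite_alg A" and wf: "acirc_wf A n gs" and \<iota>: "\<And>b. \<iota> b \<in> car A"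
    and \<delta>: "\<delta> \<in> Con A" and ac: "affine_coords A \<gamma> \<delta> p \<Phi>" and m: "m \<le> length gs"
  shows "acomp p {w. length w = n} (state_funs A \<iota> \<delta> n gs)
    (m * (card (Sigma (car A // \<delta>) \<Phi>) * layer_cost A \<delta>))
    (insert (\<lambda>w. 1) ((\<lambda>x w. snd (snd x) (gate_fun A \<iota> gs (fst x) w)) ` ({..<m} \<times> Sigma (car A // \<delta>) \<Phi>)))"
  using m
proof (induction m)
  case 0
  then show ?case using acomp_one by simp
next
  case (Suc m)
  let ?D = "{w. length w = n} :: bool list set" and ?fs = "state_funs A \<iota> \<delta> n gs"
  let ?J = "Sigma (car A // \<delta>) \<Phi>"
  let ?F = "\<lambda>x w. snd (snd x) (gate_fun A \<iota> gs (fst x) w)"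
  let ?\<Psi> = "\<lambda>m. insert (\<lambda>w. 1) (?F ` ({..<m} \<times> ?J))"
  have fJ: "finite ?J" using finite_classes[OF fin \<delta>] affine_coordsD(2)[OF ac] by (rule finite_SigmaI)
  have m: "m < length gs" and IH: "acomp p ?D ?fs (m * (card ?J * layer_cost A \<delta>)) (?\<Psi> m)" using Suc by simp_all
  have "acomp p ?D ?fs (m * (card ?J * layer_cost A \<delta>) + card ?J * layer_cost A \<delta>)
      (?\<Psi> m \<union> (\<lambda>y w. snd y (gate_fun A \<iota> gs m w)) ` ?J)"
  proof (rule acomp_insert_family[OF IH fJ])
    fix y \<Psi>' s' assume y: "y \<in> ?J" and sub: "?\<Psi> m \<subseteq> \<Psi>'" and c: "acomp p ?D ?fs s' \<Psi>'"
    have y1: "fst y \<in> car A // \<delta>" "snd y \<in> \<Phi> (fst y)" using y by auto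
    show "acomp p ?D ?fs (s' + layer_cost A \<delta>) (insert (\<lambda>w. snd y (gate_fun A \<iota> gs m w)) \<Psi>')"
    proof (rule acomp_gate_coord[OF fin wf \<iota> \<delta> ac m y1 c])
      show "(\<lambda>w. 1) \<in> \<Psi>'" using sub by blast
      fix j C \<phi> assume "j < m" "C \<in> car A // \<delta>" "\<phi> \<in> \<Phi> C"
      then have "?F (j, C, \<phi>) \<in> ?F ` ({..<m} \<times> ?J)" by (intro imageI) simp
      then show "(\<lambda>w. \<phi> (gate_fun A \<iota> gs j w)) \<in> \<Psi>'" using sub by auto
    qed
  qed
  then show ?case
  proof (rule acomp_mono)
    show "?\<Psi> (Suc m) \<subseteq> ?\<Psi> m \<union> (\<lambda>y w. snd y (gate_fun A \<iota> gs m w)) ` ?J"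
    proof
      fix h assume "h \<in> ?\<Psi> (Suc m)"
      then consider "h = (\<lambda>w. 1)" | j y where "j < Suc m" "y \<in> ?J" "h = ?F (j, y)" by auto
      then show "h \<in> ?\<Psi> m \<union> (\<lambda>y w. snd y (gate_fun A \<iota> gs m w)) ` ?J"
      proof cases
        case 1
        then show ?thesis by simp
      next
        case 2
        show ?thesis
        proof (cases "j = m")
          case True
          then have "h = (\<lambda>y w. snd y (gate_fun A \<iota> gs m w)) y" using 2 by simp
          then show ?thesis using 2(2) by (intro UnI2 image_eqI)
        next
          case False
          then have "(j, y) \<in> {..<m} \<times> ?J" using 2 by simp
          then show ?thesis using 2(3) by (intro UnI1 insertI2 image_eqI)
        qed
      qed
    qed
  qed simp
qed

section \<open>Zero tests and the indicators of the finer classes\<close>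

lemma fermat_of_bool:
  fixes a :: int
  assumes p: "prime p"
  shows "[1 - a ^ (p - 1) = of_bool (int p dvd a)] (mod int p)"
proof (cases "int p dvd a")
  case True
  have "p - 1 > 0" using prime_gt_1_nat[OF p] by simp
  then have "int p dvd a ^ (p - 1)" using True by (meson dvd_power dvd_trans)
  then show ?thesis using True by (simp add: cong_iff_dvd_diff)
next
  case False
  define b where "b = nat (a mod int p)"
  have p0: "p > 0" using prime_gt_0_nat[OF p] .
  have ab: "[a = int b] (mod int p)" using p0 by (simp add: b_def cong_def)
  have "\<not> p dvd b"
  proof
    assume "p dvd b"
    then have "[int b = 0] (mod int p)" by (simp add: cong_0_iff)
    from cong_trans[OF ab this] have "int p dvd a" by (simp add: cong_0_iff)
    then show False using False by simp
  qed
  then have "[b ^ (p - 1) = 1] (mod p)" by (rule fermat_theorem[OF p])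
  then have "[int b ^ (p - 1) = 1] (mod int p)" by (metis cong_int_iff of_nat_1 of_nat_power)
  then have "[a ^ (p - 1) = 1] (mod int p)" by (rule cong_trans[OF cong_pow[OF ab]])
  then have "[1 - a ^ (p - 1) = 1 - 1] (mod int p)" by (rule cong_diff[OF cong_refl])
  then show ?thesis using False by simp
qed

text \<open>The indicator of the \<open>\<delta>\<close>-class around \<open>X\<close>, times one
  zero test for each coordinate of that class. A product is a sequence of programs, so the power
  \<open>p - 1\<close> repeats the whole coordinate program that many times; the number of copies
  depends on the algebra alone and the size stays linear in the circuit.\<close>

lemma acomp_class_indicator:
  assumes fin: "finite_alg A" and wf: "acirc_wf A n gs" and \<iota>: "\<And>b. \<iota> b \<in> car A"
    and \<gamma>: "\<gamma> \<in> Con A" and \<delta>: "\<delta> \<in> Con A" and sub: "\<gamma> \<subseteq> \<delta>" and ac: "affine_coords A \<gamma> \<delta> p \<Phi>"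
    and j: "j < length gs" and X: "X \<in> car A // \<gamma>"
  defines "np \<equiv> card (Sigma (car A // \<delta>) \<Phi>)"
  shows "acomp p {w. length w = n} (state_funs A \<iota> \<delta> n gs)
    (np * ((p - 1) * (length gs * (np * layer_cost A \<delta>) + 5) + 7) + 2)
    {\<lambda>w. of_bool (gate_fun A \<iota> gs j w \<in> X)}"
proof -
  let ?D = "{w. length w = n} :: bool list set" and ?fs = "state_funs A \<iota> \<delta> n gs"
  let ?g = "gate_fun A \<iota> gs j"
  let ?t = "length gs * (np * layer_cost A \<delta>)"
  have p: "prime p" by (rule affine_coordsD(1)[OF ac])
  then have p1: "p > 1" by (rule prime_gt_1_nat)
  note e\<gamma> = equivD[OF Con_equiv[OF \<gamma>]] and e\<delta> = equivD[OF Con_equiv[OF \<delta>]]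
  obtain x where x: "x \<in> car A" "X = \<gamma> `` {x}" using X by (rule quotientE)
  define C where "C = \<delta> `` {x}"
  have C: "C \<in> car A // \<delta>" unfolding C_def using x(1) by (rule quotientI)
  have xC: "x \<in> C" unfolding C_def using e\<delta>(2)[OF x(1)] by simp
  have finQ: "finite (car A // \<delta>)" by (rule finite_classes[OF fin \<delta>])
  have fJ: "finite (Sigma (car A // \<delta>) \<Phi>)" using finQ affine_coordsD(2)[OF ac] by (rule finite_SigmaI)
  have card_le: "card (\<Phi> C) \<le> np"
  proof -
    have "Pair C ` \<Phi> C \<subseteq> Sigma (car A // \<delta>) \<Phi>" using C by auto
    from card_mono[OF fJ this] show ?thesis unfolding np_def by (simp add: card_image inj_on_def)
  qed
  let ?f = "\<lambda>\<phi> w. 1 + - 1 * (\<Prod>i<p - 1. \<phi> (?g w) + - \<phi> x)"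
  have factor: "acomp p ?D ?fs (2 + (2 + card {..<p - 1} * (?t + 2 + 3)) + 3) {?f \<phi>}" if \<phi>: "\<phi> \<in> \<Phi> C" for \<phi>
  proof -
    have "acomp p ?D ?fs ?t {\<lambda>w. \<phi> (?g w)}"
    proof (rule acomp_mono[OF acomp_coords[OF fin wf \<iota> \<delta> ac order.refl]])
      have "(\<lambda>x w. snd (snd x) (gate_fun A \<iota> gs (fst x) w)) (j, C, \<phi>) \<in>
         (\<lambda>x w. snd (snd x) (gate_fun A \<iota> gs (fst x) w)) ` ({..<length gs} \<times> Sigma (car A // \<delta>) \<Phi>)"
        using j C \<phi> by (intro imageI) simp
      then show "{\<lambda>w. \<phi> (?g w)} \<subseteq> insert (\<lambda>w. 1) ((\<lambda>x w. snd (snd x) (gate_fun A \<iota> gs (fst x) w)) `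
          ({..<length gs} \<times> Sigma (car A // \<delta>) \<Phi>))" by simp
    qed (simp add: np_def)
    from acomp_plus[OF this acomp_const[OF p1, of _ _ "- \<phi> x"] p1]
    have "acomp p ?D ?fs (card {..<p - 1} * (?t + 2 + 3)) {\<lambda>w. \<Prod>i<p - 1. \<phi> (?g w) + - \<phi> x}"
      by (intro acomp_prod) simp_all
    from acomp_plus[OF acomp_const[OF p1, of _ _ 1] acomp_mult[OF acomp_const[OF p1, of _ _ "- 1"] this] p1]
    show ?thesis .
  qed
  have "acomp p ?D ?fs (2 + card (\<Phi> C) * (2 + (2 + card {..<p - 1} * (?t + 2 + 3)) + 3))
      {\<lambda>w. of_bool (?g w \<in> C) * (\<Prod>\<phi>\<in>\<Phi> C. ?f \<phi> w)}"
    by (intro acomp_mult acomp_var state_funs_class[OF fin \<delta> j C] acomp_prod factor affine_coordsD(2)[OF ac C])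
  then have "acomp p ?D ?fs (np * ((p - 1) * (?t + 5) + 7) + 2)
      {\<lambda>w. of_bool (?g w \<in> C) * (\<Prod>\<phi>\<in>\<Phi> C. ?f \<phi> w)}"
  proof (rule acomp_mono)
    have "card (\<Phi> C) * (2 + (2 + card {..<p - 1} * (?t + 2 + 3)) + 3) \<le> np * ((p - 1) * (?t + 5) + 7)"
      using card_le by (intro mult_le_mono) auto
    then show "2 + card (\<Phi> C) * (2 + (2 + card {..<p - 1} * (?t + 2 + 3)) + 3) \<le>
        np * ((p - 1) * (?t + 5) + 7) + 2" by simp
  qed simp
  then show ?thesis
  proof (rule acomp_cong)
    fix \<psi>' assume psi: "\<psi>' \<in> {\<lambda>w. of_bool (?g w \<in> X) :: int}"
    have "[of_bool (?g w \<in> C) * (\<Prod>\<phi>\<in>\<Phi> C. ?f \<phi> w) = of_bool (?g w \<in> X)] (mod int p)" if w: "length w = n" for w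
    proof -
      define v where "v = ?g w"
      have v: "v \<in> car A" unfolding v_def by (rule gate_fun_closed[OF fin wf \<iota> w j])
      show ?thesis
      proof (cases "v \<in> C")
        case False
        then have "v \<notin> X" unfolding C_def x(2) using sub by blast
        then show ?thesis using False by (simp add: v_def)
      next
        case True
        have "[(\<Prod>\<phi>\<in>\<Phi> C. ?f \<phi> w) = (\<Prod>\<phi>\<in>\<Phi> C. of_bool (\<phi> x = \<phi> v))] (mod int p)"
        proof (rule cong_prod)
          fix \<phi> assume \<phi>: "\<phi> \<in> \<Phi> C"
          have r: "\<phi> v \<in> {0..<int p}" "\<phi> x \<in> {0..<int p}"
            using affine_coordsD(5)[OF ac C \<phi>] True xC by blast+
          have "int p dvd (\<phi> v - \<phi> x) \<longleftrightarrow> \<phi> x = \<phi> v"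
          proof -
            have "int p dvd (\<phi> v - \<phi> x) \<longleftrightarrow> [\<phi> v = \<phi> x] (mod int p)" by (simp add: cong_iff_dvd_diff)
            also have "\<dots> \<longleftrightarrow> \<phi> x = \<phi> v" using r by (auto simp: cong_def)
            finally show ?thesis .
          qed
          then show "[?f \<phi> w = of_bool (\<phi> x = \<phi> v)] (mod int p)"
            using fermat_of_bool[OF p, of "\<phi> v - \<phi> x"] by (simp add: v_def)
        qed
        also have "(\<Prod>\<phi>\<in>\<Phi> C. of_bool (\<phi> x = \<phi> v)) = (of_bool (\<forall>\<phi>\<in>\<Phi> C. \<phi> x = \<phi> v) :: int)"
          by (rule prod_of_bool[OF affine_coordsD(2)[OF ac C]])
        also have "(\<forall>\<phi>\<in>\<Phi> C. \<phi> x = \<phi> v) \<longleftrightarrow> v \<in> X"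
          using affine_coordsD(4)[OF ac C xC True] by (simp add: x(2))
        finally show ?thesis using True by (simp add: v_def)
      qed
    qed
    then show "\<exists>\<psi>\<in>{\<lambda>w. of_bool (?g w \<in> C) * (\<Prod>\<phi>\<in>\<Phi> C. ?f \<phi> w)}. \<forall>w\<in>?D. [\<psi> w = \<psi>' w] (mod int p)"
      using psi by simp
  qed
qed

lemma linear_bound_step:
  fixes x y N a b :: nat
  assumes "x \<le> y * N" "1 \<le> N"
  shows "a * x + b \<le> (a * y + b) * N"
proof -
  have "a * x \<le> a * (y * N)" using assms(1) by (rule mult_le_mono2)
  moreover have "b * 1 \<le> b * N" using assms(2) by (rule mult_le_mono2)
  ultimately have "a * x + b * 1 \<le> a * (y * N) + b * N" by (rule add_mono)
  then show ?thesis by (simp only: distrib_right mult.assoc mult_1_right)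
qed

text \<open>\<open>K\<close> is chosen before the circuit and the layers below, so costs merely add
  up along a chain of congruences. The square arises from linearly many outputs with programs of
  linear size.\<close>

lemma realizes_step:
  assumes fin: "finite_alg A" and \<iota>: "\<And>b. \<iota> b \<in> car A"
    and \<gamma>: "\<gamma> \<in> Con A" and \<delta>: "\<delta> \<in> Con A" and sub: "\<gamma> \<subseteq> \<delta>" and ac: "affine_coords A \<gamma> \<delta> p \<Phi>"
  shows "\<exists>K. \<forall>n gs ps s. n \<ge> 1 \<and> acirc_wf A n gs \<and> realizes n ps s (state_funs A \<iota> \<delta> n gs) \<longrightarrow>
    realizes n (p # ps) (s + K * (n + length gs)\<^sup>2) (state_funs A \<iota> \<gamma> n gs)"
proof -
  define np where "np = card (Sigma (car A // \<delta>) \<Phi>)"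
  define c where "c = np * ((p - 1) * (np * layer_cost A \<delta> + 5) + 7) + 5"
  define q where "q = 1 + card (car A // \<gamma>)"
  have p1: "p > 1" using prime_gt_1_nat[OF affine_coordsD(1)[OF ac]] .
  have "realizes n (p # ps) (s + q * c * (n + length gs)\<^sup>2) (state_funs A \<iota> \<gamma> n gs)"
    if n: "n \<ge> 1" and wf: "acirc_wf A n gs" and R: "realizes n ps s (state_funs A \<iota> \<delta> n gs)" for n gs ps s
  proof -
    define N where "N = n + length gs"
    define t where "t = np * ((p - 1) * (length gs * (np * layer_cost A \<delta>) + 5) + 7) + 2"
    have N1: "1 \<le> N" using n by (simp add: N_def)
    have "np * layer_cost A \<delta> * length gs + 5 \<le> (np * layer_cost A \<delta> * 1 + 5) * N"
      by (rule linear_bound_step[OF _ N1]) (simp add: N_def)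
    then have "length gs * (np * layer_cost A \<delta>) + 5 \<le> (np * layer_cost A \<delta> + 5) * N"
      by (simp only: mult.commute[of "length gs"] mult_1_right)
    from linear_bound_step[OF linear_bound_step[OF this N1, of "p - 1" 7] N1, of np 5]
    have tN: "t + 3 \<le> c * N" unfolding t_def c_def by simp
    have "realizes n (p # ps) (s + length (state_funs A \<iota> \<gamma> n gs) * (t + 3)) (state_funs A \<iota> \<gamma> n gs)"
    proof (rule realizes_layer[OF R p1])
      fix f assume "f \<in> set (state_funs A \<iota> \<gamma> n gs)"
      then show "acomp p {w. length w = n} (state_funs A \<iota> \<delta> n gs) t {\<lambda>w. of_bool (f w)}"
      proof (cases rule: state_funs_cases[OF fin \<gamma>, consumes 1])
        case (1 i)
        have "acomp p {w. length w = n} (state_funs A \<iota> \<delta> n gs) 2 {\<lambda>w. of_bool (f w)}"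
          unfolding 1(2) by (rule acomp_var[OF state_funs_bit[OF 1(1)]])
        then show ?thesis by (rule acomp_mono) (simp_all add: t_def)
      next
        case (2 j C)
        show ?thesis unfolding 2(3) t_def np_def
          by (rule acomp_class_indicator[OF fin wf \<iota> \<gamma> \<delta> sub ac 2(1,2)])
      qed
    qed
    then show ?thesis
    proof (rule realizes_mono)
      have "length (state_funs A \<iota> \<gamma> n gs) * (t + 3) \<le> (q * N) * (c * N)"
        using length_state_funs[OF fin \<gamma>] tN unfolding q_def N_def by (rule mult_le_mono)
      also have "\<dots> = q * c * N\<^sup>2" by (simp add: power2_eq_square)
      finally show "s + length (state_funs A \<iota> \<gamma> n gs) * (t + 3) \<le> s + q * c * (n + length gs)\<^sup>2"
        by (simp add: N_def)
    qed
  qed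
  then show ?thesis by blast
qed

text \<open>Turns thresholds into exact classes: the rank equals that of \<open>c\<close> if it
  reaches \<open>r c\<close> but not \<open>Suc (r c)\<close>, and all ranks together determine the
  class modulo \<open>\<beta>\<close>. The identity holds over the integers, so 2 is an arbitrary
  choice of prime.\<close>

lemma realizes_base:
  assumes fin: "finite_alg A" and \<iota>: "\<And>b. \<iota> b \<in> car A" and \<beta>: "\<beta> \<in> Con A"
    and sd: "subdirect_tot (quot A \<beta>)"
  shows "\<exists>K. \<forall>n gs. n \<ge> 1 \<and> acirc_wf A n gs \<longrightarrow>
    realizes n [2] (K * (n + length gs)\<^sup>2) (state_funs A \<iota> \<beta> n gs)"
proof -
  obtain Rk B where Rk': "finite Rk \<and>
      (\<forall>r\<in>Rk. rank_mono A r \<and> r (\<iota> False) \<le> r (\<iota> True) \<and> (\<forall>x\<in>car A. r x \<le> B)) \<and>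
      (\<forall>x\<in>car A. \<forall>y\<in>car A. (x, y) \<in> \<beta> \<longleftrightarrow> (\<forall>r\<in>Rk. r x = r y))"
    using subdirect_tot_oriented_ranks[OF fin \<beta> sd, of "\<iota> False" "\<iota> True"] by (elim exE) (rule that)
  then have Rk: "finite Rk" "\<And>r. r \<in> Rk \<Longrightarrow> rank_mono A r" "\<And>r. r \<in> Rk \<Longrightarrow> r (\<iota> False) \<le> r (\<iota> True)"
    "\<And>r x. r \<in> Rk \<Longrightarrow> x \<in> car A \<Longrightarrow> r x \<le> B"
    "\<And>x y. x \<in> car A \<Longrightarrow> y \<in> car A \<Longrightarrow> (x, y) \<in> \<beta> \<longleftrightarrow> (\<forall>r\<in>Rk. r x = r y)"
    by simp_all
  have "\<exists>K. \<forall>n gs. acirc_wf A n gs \<longrightarrow> bext True n (K * length gs) (K * length gs)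
      ((\<lambda>i w. w ! i) ` {..<n}) (thresholds A \<iota> Rk B gs (length gs))"
  proof (rule bext_thresholds[OF fin \<iota> Rk(1)])
    show "rank_mono A r" "r (\<iota> False) \<le> r (\<iota> True)" if "r \<in> Rk" for r
      using Rk(2,3) that by simp_all
    show "r x \<le> B" if "r \<in> Rk" "x \<in> car A" for r x using Rk(4) that by simp
  qed
  then obtain K1 where K1: "\<forall>n gs. acirc_wf A n gs \<longrightarrow> bext True n (K1 * length gs) (K1 * length gs)
      ((\<lambda>i w. w ! i) ` {..<n}) (thresholds A \<iota> Rk B gs (length gs))"
    by (elim exE) (rule that)
  define cR where "cR = card (Rk \<times> {..Suc B})"
  define q where "q = 1 + card (car A // \<beta>)"
  \<comment> \<open>One equality test of ranks costs \<open>2 + (2 + (2 + 2) + 3) = 11\<close>; the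
    final 2 leaves room for passing on an input bit.\<close>
  define t where "t = card Rk * 11 + 2"
  define K where "K = (1 + cR) * (3 * (1 + K1)) + q * (t + 3)"
  have "realizes n [2] (K * (n + length gs)\<^sup>2) (state_funs A \<iota> \<beta> n gs)"
    if n: "n \<ge> 1" and wf: "acirc_wf A n gs" for n gs
  proof -
    define N where "N = n + length gs"
    have N1: "1 \<le> N" using n by (simp add: N_def)
    let ?T = "thresholds A \<iota> Rk B gs (length gs)"
    have finT: "finite ?T" unfolding thresholds_def using Rk(1) by simp
    then obtain Ts where Ts: "set Ts = ?T" "distinct Ts" using finite_distinct_list by blast
    have "card ?T \<le> card ({..<length gs} \<times> Rk \<times> {..Suc B})"
      unfolding thresholds_def by (rule card_image_le) (use Rk(1) in simp)
    then have lenT: "length Ts \<le> length gs * cR"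
      using distinct_card[OF Ts(2)] Ts(1) by (simp add: card_cartesian_product cR_def)
    define fs where "fs = map (\<lambda>i w. w ! i) [0..<n] @ Ts"
    have set_fs: "set fs = (\<lambda>i w. w ! i) ` {..<n} \<union> ?T" by (auto simp: fs_def Ts(1))
    have "length fs \<le> n + length gs * cR" using lenT by (simp add: fs_def)
    also have "\<dots> \<le> (1 + cR) * N" by (simp add: N_def algebra_simps)
    finally have len_fs: "length fs \<le> (1 + cR) * N" .
    have "bext True n (K1 * length gs) (K1 * length gs) ((\<lambda>i w. w ! i) ` {..<n}) (set fs)"
      unfolding set_fs using K1 wf by (intro bext_keep) simp
    from realizes_monotone[OF this]
    have R0: "realizes n [] (length fs * (3 * (n + K1 * length gs))) (filter (nonconst n) fs)" .
    have "realizes n [2] (length fs * (3 * (n + K1 * length gs)) + length (state_funs A \<iota> \<beta> n gs) * (t + 3))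
        (state_funs A \<iota> \<beta> n gs)"
    proof (rule realizes_layer[OF R0])
      fix f assume "f \<in> set (state_funs A \<iota> \<beta> n gs)"
      then show "acomp 2 {w. length w = n} (filter (nonconst n) fs) t {\<lambda>w. of_bool (f w)}"
      proof (cases rule: state_funs_cases[OF fin \<beta>, consumes 1])
        case (1 i)
        then have "f \<in> set fs" unfolding set_fs by blast
        then have "acomp 2 {w. length w = n} (filter (nonconst n) fs) 2 {\<lambda>w. of_bool (f w)}"
          by (rule acomp_monotone_var) simp
        then show ?thesis by (rule acomp_mono) (simp_all add: t_def)
      next
        case (2 j C)
        obtain c where c: "c \<in> car A" "C = \<beta> `` {c}" using 2(2) by (rule quotientE)
        let ?g = "gate_fun A \<iota> gs j"
        have thr: "acomp 2 {w. length w = n} (filter (nonconst n) fs) 2 {\<lambda>w. of_bool (a \<le> r (?g w))}"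
          if "r \<in> Rk" "a \<le> Suc B" for r a
        proof (rule acomp_monotone_var)
          have "(\<lambda>w. a \<le> r (?g w)) \<in> ?T" unfolding thresholds_def
            using that 2(1) by (intro image_eqI[of _ _ "(j, r, a)"]) auto
          then show "(\<lambda>w. a \<le> r (?g w)) \<in> set fs" unfolding set_fs by blast
        qed simp
        have "acomp 2 {w. length w = n} (filter (nonconst n) fs) (card Rk * (2 + (2 + (2 + 2) + 3)))
            {\<lambda>w. \<Prod>r\<in>Rk. of_bool (r c \<le> r (?g w)) * (1 + - 1 * of_bool (Suc (r c) \<le> r (?g w)))}"
        proof (rule acomp_prod[OF Rk(1)])
          fix r assume r: "r \<in> Rk"
          have rc: "r c \<le> B" by (rule Rk(4)[OF r c(1)])
          show "acomp 2 {w. length w = n} (filter (nonconst n) fs) (2 + (2 + (2 + 2) + 3))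
            {\<lambda>w. of_bool (r c \<le> r (?g w)) * (1 + - 1 * of_bool (Suc (r c) \<le> r (?g w)))}"
            by (intro acomp_mult acomp_plus acomp_const thr r) (use rc in simp_all)
        qed
        then have "acomp 2 {w. length w = n} (filter (nonconst n) fs) t
            {\<lambda>w. \<Prod>r\<in>Rk. of_bool (r c \<le> r (?g w)) * (1 + - 1 * of_bool (Suc (r c) \<le> r (?g w)))}"
          by (rule acomp_mono) (simp_all add: t_def)
        then show ?thesis
        proof (rule acomp_cong)
          fix \<psi>' assume psi: "\<psi>' \<in> {\<lambda>w. of_bool (f w) :: int}"
          have "(\<Prod>r\<in>Rk. of_bool (r c \<le> r (?g w)) * (1 + - 1 * of_bool (Suc (r c) \<le> r (?g w)))) =
              (of_bool (f w) :: int)" if w: "length w = n" for w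
          proof -
            have v: "?g w \<in> car A" by (rule gate_fun_closed[OF fin wf \<iota> w 2(1)])
            have "(\<Prod>r\<in>Rk. of_bool (r c \<le> r (?g w)) * (1 + - 1 * of_bool (Suc (r c) \<le> r (?g w)))) =
                (\<Prod>r\<in>Rk. of_bool (r c = r (?g w)) :: int)"
              by (rule prod.cong) (auto simp: of_bool_def)
            also have "\<dots> = of_bool (\<forall>r\<in>Rk. r c = r (?g w))" by (rule prod_of_bool[OF Rk(1)])
            also have "(\<forall>r\<in>Rk. r c = r (?g w)) \<longleftrightarrow> (c, ?g w) \<in> \<beta>" using Rk(5)[OF c(1) v] by simp
            also have "\<dots> \<longleftrightarrow> f w" by (simp add: 2(3) c(2))
            finally show ?thesis .
          qed
          then show "\<exists>\<psi>\<in>{\<lambda>w. \<Prod>r\<in>Rk. of_bool (r c \<le> r (?g w)) * (1 + - 1 * of_bool (Suc (r c) \<le> r (?g w)))}.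
              \<forall>w\<in>{w. length w = n}. [\<psi> w = \<psi>' w] (mod int 2)"
            using psi by simp
        qed
      qed
    qed simp
    then show ?thesis
    proof (rule realizes_mono)
      have "3 * (n + K1 * length gs) \<le> 3 * (1 + K1) * N" by (simp add: N_def algebra_simps)
      with len_fs have "length fs * (3 * (n + K1 * length gs)) \<le> ((1 + cR) * N) * (3 * (1 + K1) * N)"
        by (rule mult_le_mono)
      also have "\<dots> = (1 + cR) * (3 * (1 + K1)) * N\<^sup>2" by (simp only: power2_eq_square mult_ac)
      finally have a: "length fs * (3 * (n + K1 * length gs)) \<le> (1 + cR) * (3 * (1 + K1)) * N\<^sup>2" .
      have "length (state_funs A \<iota> \<beta> n gs) * (t + 3) \<le> (q * N) * (t + 3)"
        using length_state_funs[OF fin \<beta>] unfolding q_def N_def by (rule mult_le_mono1)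
      also have "\<dots> = q * (t + 3) * N" by (simp only: mult_ac)
      also have "\<dots> \<le> q * (t + 3) * N\<^sup>2"
        using N1 by (intro mult_le_mono2) (simp add: power2_eq_square)
      finally have "length (state_funs A \<iota> \<beta> n gs) * (t + 3) \<le> q * (t + 3) * N\<^sup>2" .
      from add_mono[OF a this]
      show "length fs * (3 * (n + K1 * length gs)) + length (state_funs A \<iota> \<beta> n gs) * (t + 3)
          \<le> K * (n + length gs)\<^sup>2"
        unfolding K_def N_def[symmetric] distrib_right .
    qed
  qed
  then show ?thesis by blast
qed

section \<open>Descending to the identity congruence\<close>

definition state_realizable :: "'a alg \<Rightarrow> (bool \<Rightarrow> 'a) \<Rightarrow> ('a \<times> 'a) set \<Rightarrow> bool" where
  "state_realizable A \<iota> \<theta> \<longleftrightarrow> (\<exists>ps K. (\<forall>p\<in>set ps. prime p) \<and> (\<forall>n gs. n \<ge> 1 \<and> acirc_wf A n gs \<longrightarrow>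
     realizes n ps (K * (n + length gs)\<^sup>2) (state_funs A \<iota> \<theta> n gs)))"

lemma Id_on_Con:
  assumes "finite_alg A"
  shows "Id_on (car A) \<in> Con A"
proof -
  have "equiv (car A) (Id_on (car A))"
    by (rule equivI) (auto simp: refl_on_def sym_def trans_def)
  moreover have "(f xs, f ys) \<in> Id_on (car A)"
    if kf: "(k, f) \<in> set (ops A)" and xs: "length xs = k" "set xs \<subseteq> car A"
      and r: "list_all2 (\<lambda>x y. (x, y) \<in> Id_on (car A)) xs ys" for k f xs ys
  proof -
    have "xs = ys"
    proof (rule nth_equalityI)
      show "length xs = length ys" using r by (rule list_all2_lengthD)
      fix i assume "i < length xs"
      from list_all2_nthD[OF r this] show "xs ! i = ys ! i" by auto
    qed
    moreover have "f xs \<in> car A" using assms kf xs unfolding finite_alg_def by blast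
    ultimately show ?thesis by (auto intro: Id_onI)
  qed
  ultimately show ?thesis unfolding Con_def is_cong_def by blast
qed

lemma lower_cover_exists:
  assumes fin: "finite_alg A" and \<delta>: "\<delta> \<in> Con A" "\<delta> \<noteq> Id_on (car A)"
  shows "\<exists>\<gamma>. prime_quot A \<gamma> \<delta>"
proof -
  have fC: "finite (car A)" using fin by (simp add: finite_alg_def)
  have "\<theta> \<subseteq> car A \<times> car A" if "\<theta> \<in> Con A" for \<theta> using Con_equiv[OF that] by (simp add: equiv_def)
  then have "Con A \<subseteq> Pow (car A \<times> car A)" by blast
  then have finCon: "finite (Con A)" by (rule finite_subset) (simp add: fC)
  have "Id_on (car A) \<subseteq> \<delta>" using equivD(2)[OF Con_equiv[OF \<delta>(1)]] by auto
  then have "Id_on (car A) \<in> {\<theta> \<in> Con A. \<theta> \<subset> \<delta>}" using Id_on_Con[OF fin] \<delta>(2) by auto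
  then have "\<exists>\<gamma>\<in>{\<theta> \<in> Con A. \<theta> \<subset> \<delta>}. \<forall>\<theta>\<in>{\<theta> \<in> Con A. \<theta> \<subset> \<delta>}. \<gamma> \<subseteq> \<theta> \<longrightarrow> \<gamma> = \<theta>"
    using finCon by (intro finite_has_maximal) auto
  then obtain \<gamma> where \<gamma>: "\<gamma> \<in> Con A" "\<gamma> \<subset> \<delta>"
    and max: "\<And>\<theta>. \<theta> \<in> Con A \<Longrightarrow> \<theta> \<subset> \<delta> \<Longrightarrow> \<gamma> \<subseteq> \<theta> \<Longrightarrow> \<gamma> = \<theta>" by auto
  have "\<not> (\<exists>\<theta>\<in>Con A. \<gamma> \<subset> \<theta> \<and> \<theta> \<subset> \<delta>)"
  proof
    assume "\<exists>\<theta>\<in>Con A. \<gamma> \<subset> \<theta> \<and> \<theta> \<subset> \<delta>"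
    then obtain \<theta> where "\<theta> \<in> Con A" "\<gamma> \<subset> \<theta>" "\<theta> \<subset> \<delta>" by auto
    then show False using max[of \<theta>] psubset_imp_subset by (metis psubset_eq)
  qed
  then have "prime_quot A \<gamma> \<delta>" unfolding prime_quot_def using \<gamma> \<delta>(1) by simp
  then show ?thesis ..
qed

text \<open>Descent by minimality: a smallest realizable congruence below \<open>\<beta>\<close> has
  no lower cover, since the quotient would be of type 2 and \<open>realizes_step\<close> would make
  the cover realizable. Hence it is the identity.\<close>

lemma state_realizable_identity:
  assumes fin: "finite_alg A" and \<iota>: "\<And>b. \<iota> b \<in> car A" and \<beta>: "\<beta> \<in> Con A"
    and sd: "subdirect_tot (quot A \<beta>)"
    and t2: "\<forall>\<gamma> \<delta>. prime_quot A \<gamma> \<delta> \<and> \<delta> \<subseteq> \<beta> \<longrightarrow> has_type2 A \<gamma> \<delta>"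
  shows "state_realizable A \<iota> (Id_on (car A))"
proof -
  define Q where "Q \<delta> \<longleftrightarrow> \<delta> \<in> Con A \<and> \<delta> \<subseteq> \<beta> \<and> state_realizable A \<iota> \<delta>" for \<delta>
  obtain K where "\<forall>n gs. n \<ge> 1 \<and> acirc_wf A n gs \<longrightarrow>
      realizes n [2] (K * (n + length gs)\<^sup>2) (state_funs A \<iota> \<beta> n gs)"
    using realizes_base[where \<iota> = \<iota>, OF fin \<iota> \<beta> sd] by (elim exE) (rule that)
  then have "state_realizable A \<iota> \<beta>"
    unfolding state_realizable_def by (intro exI[of _ "[2]"] exI[of _ K]) simp
  then have "Q \<beta>" using \<beta> by (simp add: Q_def)
  then obtain \<delta> where \<delta>: "Q \<delta>" and min: "\<And>\<theta>. Q \<theta> \<Longrightarrow> card \<delta> \<le> card \<theta>"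
    using ex_has_least_nat[of Q \<beta> card] by blast
  have "\<delta> = Id_on (car A)"
  proof (rule ccontr)
    assume ne: "\<delta> \<noteq> Id_on (car A)"
    have \<delta>C: "\<delta> \<in> Con A" "\<delta> \<subseteq> \<beta>" using \<delta> by (auto simp: Q_def)
    obtain ps K where ps: "\<forall>p\<in>set ps. prime p" and R: "\<And>n gs. n \<ge> 1 \<Longrightarrow> acirc_wf A n gs \<Longrightarrow>
        realizes n ps (K * (n + length gs)\<^sup>2) (state_funs A \<iota> \<delta> n gs)"
      using \<delta> unfolding Q_def state_realizable_def by blast
    obtain \<gamma> where pq: "prime_quot A \<gamma> \<delta>" using lower_cover_exists[OF fin \<delta>C(1) ne] by blast
    then have \<gamma>: "\<gamma> \<in> Con A" "\<gamma> \<subset> \<delta>" by (auto simp: prime_quot_def)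
    have "has_type2 A \<gamma> \<delta>" using t2 pq \<delta>C(2) by blast
    then obtain p \<Phi> where ac: "affine_coords A \<gamma> \<delta> p \<Phi>"
      using has_type2_affine_coords[OF fin pq] by blast
    obtain K' where K': "\<forall>n gs ps s. n \<ge> 1 \<and> acirc_wf A n gs \<and> realizes n ps s (state_funs A \<iota> \<delta> n gs) \<longrightarrow>
        realizes n (p # ps) (s + K' * (n + length gs)\<^sup>2) (state_funs A \<iota> \<gamma> n gs)"
      using realizes_step[where \<iota> = \<iota>, OF fin \<iota> \<gamma>(1) \<delta>C(1) psubset_imp_subset[OF \<gamma>(2)] ac]
      by (elim exE) (rule that)
    have "realizes n (p # ps) ((K + K') * (n + length gs)\<^sup>2) (state_funs A \<iota> \<gamma> n gs)"
      if "n \<ge> 1" "acirc_wf A n gs" for n gs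
      using K'[rule_format, of n gs ps "K * (n + length gs)\<^sup>2"] R[OF that] that
      by (simp add: distrib_right)
    moreover have "\<forall>r\<in>set (p # ps). prime r" using ps affine_coordsD(1)[OF ac] by simp
    ultimately have "state_realizable A \<iota> \<gamma>"
      unfolding state_realizable_def by (intro exI[of _ "p # ps"] exI[of _ "K + K'"]) simp
    then have "Q \<gamma>" using \<gamma> \<delta>C(2) by (auto simp: Q_def)
    then have "card \<delta> \<le> card \<gamma>" by (rule min)
    moreover have "card \<gamma> < card \<delta>"
    proof (rule psubset_card_mono[OF _ \<gamma>(2)])
      have "\<delta> \<subseteq> car A \<times> car A" using Con_equiv[OF \<delta>C(1)] by (simp add: equiv_def)
      then show "finite \<delta>" by (rule finite_subset) (use fin in \<open>simp add: finite_alg_def\<close>)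
    qed
    ultimately show False by simp
  qed
  then show ?thesis using \<delta> by (simp add: Q_def)
qed

section \<open>Acceptance and the size of the whole circuit\<close>

text \<open>Classes of the identity are singletons, and at most one of the indicators over
  \<open>S\<close> fires at the output gate, so their sum is already 0 or 1. This supplies the
  single gate required on top; each element of \<open>S\<close> costs a label and an addition, 5
  units.\<close>

lemma realizes_accepting:
  assumes fin: "finite_alg A" and \<iota>: "\<And>b. \<iota> b \<in> car A" and S: "S \<subseteq> car A" and wf: "acirc_wf A n gs"
    and R: "realizes n ps s (state_funs A \<iota> (Id_on (car A)) n gs)"
  shows "realizes n (2 # ps) (s + (card (car A) * 5 + 5)) [\<lambda>w. acirc_eval A (map \<iota> w) gs \<in> S]"
proof -
  let ?D = "{w. length w = n} :: bool list set" and ?fs = "state_funs A \<iota> (Id_on (car A)) n gs"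
  let ?j = "length gs - 1"
  have ne: "gs \<noteq> []" using wf by (simp add: acirc_wf_def)
  have fS: "finite S" using S fin finite_subset by (auto simp: finite_alg_def)
  have cS: "card S \<le> card (car A)" using S fin by (intro card_mono) (auto simp: finite_alg_def)
  have "acomp 2 ?D ?fs (card S * (2 + 3) + 2) {\<lambda>w. \<Sum>a\<in>S. of_bool (gate_fun A \<iota> gs ?j w \<in> {a})}"
  proof (rule acomp_sum[OF fS])
    fix a assume a: "a \<in> S"
    then have "Id_on (car A) `` {a} \<in> car A // Id_on (car A)" using S by (intro quotientI) blast
    moreover have "Id_on (car A) `` {a} = {a}" using a S by auto
    ultimately have "{a} \<in> car A // Id_on (car A)" by simp
    then show "acomp 2 ?D ?fs 2 {\<lambda>w. of_bool (gate_fun A \<iota> gs ?j w \<in> {a})}"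
      using ne by (intro acomp_var state_funs_class[OF fin Id_on_Con[OF fin]]) simp_all
  qed simp
  moreover have "(\<Sum>a\<in>S. of_bool (gate_fun A \<iota> gs ?j w \<in> {a})) =
      (of_bool (acirc_eval A (map \<iota> w) gs \<in> S) :: int)" for w
  proof -
    have "gate_fun A \<iota> gs ?j w = acirc_eval A (map \<iota> w) gs"
      unfolding gate_fun_def by (rule acirc_eval_avals[OF ne, symmetric])
    moreover have "(\<Sum>a\<in>S. of_bool (x \<in> {a})) = (of_bool (x \<in> S) :: int)" for x
      using fS by (simp add: of_bool_def)
    ultimately show ?thesis by (simp only:)
  qed
  ultimately have "acomp 2 ?D ?fs (card S * (2 + 3) + 2) {\<lambda>w. of_bool (acirc_eval A (map \<iota> w) gs \<in> S)}"
    by simp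
  then have "realizes n (2 # ps) (s + length [\<lambda>w. acirc_eval A (map \<iota> w) gs \<in> S] * (card S * (2 + 3) + 2 + 3))
      [\<lambda>w. acirc_eval A (map \<iota> w) gs \<in> S]"
    by (intro realizes_layer[OF R]) simp_all
  then show ?thesis by (rule realizes_mono) (use cS in simp)
qed

lemma nuP_subset_nuItDet_MON:
  assumes fin: "finite_alg A" and \<beta>: "\<beta> \<in> Con A" and sd: "subdirect_tot (quot A \<beta>)"
    and t2: "\<forall>\<gamma> \<delta>. prime_quot A \<gamma> \<delta> \<and> \<delta> \<subseteq> \<beta> \<longrightarrow> has_type2 A \<gamma> \<delta>"
  shows "nuP A \<subseteq> nuItDet_MON"
proof
  fix L assume "L \<in> nuP A"
  then obtain \<iota> :: "bool \<Rightarrow> 'a" and S t c k where \<iota>': "\<forall>b. \<iota> b \<in> car A" and S: "S \<subseteq> car A"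
    and circ: "\<forall>n\<ge>1. acirc_wf A n (t n) \<and> acirc_size (t n) \<le> c * n ^ k + c"
    and acc: "\<forall>w. length w \<ge> 1 \<longrightarrow> (w \<in> L \<longleftrightarrow> acirc_eval A (map \<iota> w) (t (length w)) \<in> S)"
    unfolding nuP_def by blast
  have \<iota>: "\<And>b. \<iota> b \<in> car A" using \<iota>' by blast
  obtain ps K where ps: "\<forall>p\<in>set ps. prime p" and R: "\<And>n gs. n \<ge> 1 \<Longrightarrow> acirc_wf A n gs \<Longrightarrow>
      realizes n ps (K * (n + length gs)\<^sup>2) (state_funs A \<iota> (Id_on (car A)) n gs)"
    using state_realizable_identity[where \<iota> = \<iota>, OF fin \<iota> \<beta> sd t2] unfolding state_realizable_def by blast
  \<comment> \<open>For \<open>n \<ge> 1\<close> both \<open>n\<close> and the bound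
    \<open>c * n ^ k + c\<close> on the circuit are absorbed by
    \<open>(1 + 2 * c) * n ^ (k + 1)\<close>. The squared size bound turns this into the exponent
    \<open>2 * (k + 1)\<close>.\<close>
  define C where "C = K * (1 + 2 * c)\<^sup>2 + card (car A) * 5 + 5"
  have "\<exists>Ls Ms. itdet_wf (2 # ps) n Ls Ms \<and> itdet_size Ls Ms \<le> C * n ^ (2 * (k + 1)) + C \<and>
        (\<forall>w. length w = n \<longrightarrow> (w \<in> L \<longleftrightarrow> itdet_eval (2 # ps) Ls Ms w))" if n: "n \<ge> 1" for n
  proof -
    have wf: "acirc_wf A n (t n)" and size: "acirc_size (t n) \<le> c * n ^ k + c" using circ n by auto
    have len: "length (t n) \<le> c * n ^ k + c" using size by (simp add: acirc_size_def)
    from realizes_accepting[where \<iota> = \<iota>, OF fin \<iota> S wf R[OF n wf]]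
    obtain Ls Ms where M: "\<forall>M\<in>set Ms. bcirc_wf True n M" "layers_wf (length Ms) (2 # ps) Ls"
      and sz: "layers_size Ls + sum_list (map bcirc_size Ms) \<le>
        K * (n + length (t n))\<^sup>2 + (card (car A) * 5 + 5)"
      and l1: "length [\<lambda>w. acirc_eval A (map \<iota> w) (t n) \<in> S] = out_length (length Ms) Ls"
      and ev: "\<And>w. length w = n \<Longrightarrow> layers_eval (2 # ps) Ls (map (bcirc_eval w) Ms) =
        [acirc_eval A (map \<iota> w) (t n) \<in> S]"
      unfolding realizes_def by auto
    have ne: "Ls \<noteq> []" using layers_wf_length[OF M(2)] by auto
    have hd1: "length (hd Ls) = 1" using l1 ne by (simp add: out_length_def)
    have "itdet_wf (2 # ps) n Ls Ms"
      unfolding itdet_wf_def using M(1) M(2)[unfolded layers_wf_iff] hd1 by (intro conjI) (elim conjE, assumption)+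
    moreover have "itdet_size Ls Ms \<le> C * n ^ (2 * (k + 1)) + C"
    proof -
      have "1 \<le> n ^ k" using n by simp
      then have nk: "n * 1 \<le> n * n ^ k" by (rule mult_le_mono2)
      have kk: "1 * n ^ k \<le> n * n ^ k" using n by (rule mult_le_mono1)
      have "c * 1 \<le> c * (n * n ^ k)" using n nk by (intro mult_le_mono2) simp
      moreover have "c * n ^ k \<le> c * (n * n ^ k)" using kk by (intro mult_le_mono2) simp
      ultimately have "c * n ^ k + c * 1 \<le> c * (n * n ^ k) + c * (n * n ^ k)" by (intro add_mono)
      then have "length (t n) \<le> c * (n * n ^ k) + c * (n * n ^ k)"
        using len unfolding mult_1_right by (rule le_trans[rotated])
      with nk have "n * 1 + length (t n) \<le> n * n ^ k + (c * (n * n ^ k) + c * (n * n ^ k))"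
        by (rule add_mono)
      then have "n + length (t n) \<le> n * n ^ k + (c * (n * n ^ k) + c * (n * n ^ k))"
        unfolding mult_1_right .
      also have "\<dots> = (1 + 2 * c) * n ^ (k + 1)" by (simp add: algebra_simps)
      finally have "(n + length (t n))\<^sup>2 \<le> ((1 + 2 * c) * n ^ (k + 1))\<^sup>2" by (rule power_mono) simp
      also have "\<dots> = (1 + 2 * c)\<^sup>2 * n ^ (2 * (k + 1))"
        by (simp only: power_mult_distrib power_mult[symmetric] mult.commute)
      finally have "K * (n + length (t n))\<^sup>2 \<le> K * ((1 + 2 * c)\<^sup>2 * n ^ (2 * (k + 1)))"
        by (rule mult_le_mono2)
      also have "\<dots> = K * (1 + 2 * c)\<^sup>2 * n ^ (2 * (k + 1))" by (simp only: mult.assoc)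
      also have "\<dots> \<le> C * n ^ (2 * (k + 1))" by (rule mult_le_mono1) (simp add: C_def)
      finally have "K * (n + length (t n))\<^sup>2 \<le> C * n ^ (2 * (k + 1))" .
      moreover have "card (car A) * 5 + 5 \<le> C" by (simp add: C_def)
      ultimately have "K * (n + length (t n))\<^sup>2 + (card (car A) * 5 + 5) \<le> C * n ^ (2 * (k + 1)) + C"
        by (rule add_mono)
      with sz have "layers_size Ls + sum_list (map bcirc_size Ms) \<le> C * n ^ (2 * (k + 1)) + C"
        by (rule le_trans)
      then show ?thesis by (simp only: itdet_size_def layers_size_def)
    qed
    moreover have "w \<in> L \<longleftrightarrow> itdet_eval (2 # ps) Ls Ms w" if w: "length w = n" for w
    proof -
      have "itdet_eval (2 # ps) Ls Ms w = hd (layers_eval (2 # ps) Ls (map (bcirc_eval w) Ms))"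
        by (simp only: itdet_eval_def layers_eval_def)
      also have "\<dots> = (acirc_eval A (map \<iota> w) (t n) \<in> S)" unfolding ev[OF w] by simp
      finally show ?thesis using acc w n by auto
    qed
    ultimately show ?thesis by blast
  qed
  moreover have "\<forall>p\<in>set (2 # ps). prime p" using ps by simp
  ultimately show "L \<in> nuItDet_MON"
    unfolding nuItDet_MON_def by (intro CollectI exI[of _ "2 # ps"] exI[of _ C] exI[of _ "2 * (k + 1)"]) simp
qed

theorem mainTheorem17:
  fixes A :: "'a alg"
  assumes fin: "finite_alg A"
    and cm: "cm_variety A"
    and types: "\<forall>\<alpha> \<delta>. prime_quot A \<alpha> \<delta> \<longrightarrow> has_type2 A \<alpha> \<delta> \<or> has_type4 A \<alpha> \<delta>"
    and beta: "\<exists>\<beta> \<in> Con A.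
        (\<forall>\<alpha> \<delta>. prime_quot (quot A \<beta>) \<alpha> \<delta> \<longrightarrow> has_type4 (quot A \<beta>) \<alpha> \<delta>) \<and>
        (\<exists>\<alpha> \<delta>. prime_quot (quot A \<beta>) \<alpha> \<delta>) \<and>
        (\<forall>\<gamma> \<delta>. prime_quot A \<gamma> \<delta> \<and> \<delta> \<subseteq> \<beta> \<longrightarrow> has_type2 A \<gamma> \<delta>) \<and>
        subdirect_tot (quot A \<beta>)"
  shows "nuP A \<subseteq> nuItDet_MON \<and> nuP A \<subseteq> NC2_MON"
proof -
  obtain \<beta> where "\<beta> \<in> Con A" "subdirect_tot (quot A \<beta>)"
    "\<forall>\<gamma> \<delta>. prime_quot A \<gamma> \<delta> \<and> \<delta> \<subseteq> \<beta> \<longrightarrow> has_type2 A \<gamma> \<delta>" using beta by blast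
  then have "nuP A \<subseteq> nuItDet_MON" by (rule nuP_subset_nuItDet_MON[OF fin])
  then show ?thesis using nuItDet_MON_subset_NC2_MON by blast
qed

end
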